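(* Let $(N^{2k},\hat\omega)$ be an almost symplectic submanifold of an almost quaternionic skew-Hermitian manifold $(M^{4n},Q,\omega)$, $n>1$, with $k\le 2n$. Then the connection $\tilde\nabla_XY:=(\nabla^{Q,\omega}_XY)^\top$ induced on $N$ by $\nabla^{Q,\omega}$ is an almost symplectic connection on $(N,\hat\omega)$, i.e. $\tilde\nabla\hat\omega=0$. Its torsion satisfies $$\tilde T(X,Y)=(T^{Q,\omega}(X,Y))^\top,\qquad X,Y\in\Gamma(TN),$$ where $T^{Q,\omega}$ is the torsion of $\nabla^{Q,\omega}$. When $\nabla^{Q,\omega}$ is torsion-free, $\tilde\nabla$ is a symplectic connection (torsion-free and preserving $\hat\omega$) on the symplectic submanifold $(N,\hat\omega)$.
   Context: An almost quaternionic structure on $M^{4n}$ ($n>1$) is a rank-3 subbundle $Q\subset\mathrm{End}(TM)$ locally spanned by an admissible basis $J_1,J_2,J_3$, i.e. $J_a^2=-\mathrm{Id}$, $J_1J_2=J_3=-J_2J_1$. An almost quaternionic skew-Hermitian (qs-H) manifold $(M^{4n},Q,\omega)$ is such a manifold with a non-degenerate 2-form $\omega$ satisfying $\omega(J_aX,J_aY)=\omega(X,Y)$ for every admissible basis. Adapted connection. $N_J(X,Y)=[JX,JY]-J[JX,Y]-J[X,JY]-[X,Y]$. The Obata connection $\nabla^H$ of an admissible basis $H=\{J_a\}$ is the unique connection with $\nabla^HJ_a=0$ and torsion $T^H=\frac16\sum_aN_{J_a}$. With $\mathrm{vol}=\omega^{2n}$, the unimodular Oproiu connection $\nabla^{Q,\mathrm{vol}}$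 is the unique connection preserving $Q$ and $\mathrm{vol}$ whose torsion is, for any admissible basis, $T^Q=T^H+\sum_a\partial(\tau_a\otimes J_a)$, where $\tau_a(X)=\frac1{4n-2}\mathrm{tr}(J_aT^H_X)$ and $\partial(\tau\otimes J)(X,Y)=\tau(X)JY-\tau(Y)JX$. Then $\nabla^{Q,\omega}=\nabla^{Q,\mathrm{vol}}+A$ with $\omega(A(X,Y),Z)=\frac12(\nabla^{Q,\mathrm{vol}}_X\omega)(Y,Z)$; it preserves $Q$ and $\omega$. A submanifold $\iota:N\to M$ (immersion) is almost symplectic if $\hat\omega:=\iota^*\omega$ is non-degenerate, and symplectic if also $d\hat\omega=0$. Then $TM|_N=TN\oplus\nu(N)$ with $\nu_x(N)=\{u\in T_xM:\omega(u,v)=0\ \forall v\in T_xN\}$, and $\top$ is the projection onto $TN$. *)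

theory Defs
  imports "HOL-Analysis.Analysis" "HOL-Combinatorics.Permutations"
begin

section \<open>Smooth maps on open subsets of normed spaces\<close>

text \<open>For open \<open>S\<close> in a Euclidean space this is the usual class \<open>C\<^sup>k\<close>: all directional derivatives
  are iterated, so all partial derivatives up to order \<open>k\<close> exist and are continuous.\<close>

primrec Ck_on ::
    "nat \<Rightarrow> 'a::real_normed_vector set \<Rightarrow> ('a \<Rightarrow> 'b::real_normed_vector) \<Rightarrow> bool" where
  "Ck_on 0 S f \<longleftrightarrow> continuous_on S f"
| "Ck_on (Suc k) S f \<longleftrightarrow>
     f differentiable_on S \<and> (\<forall>v. Ck_on k S (\<lambda>x. frechet_derivative f (at x) v))"

definition smooth_on :: "'a::real_normed_vector set \<Rightarrow> ('a \<Rightarrow> 'b::real_normed_vector) \<Rightarrow> bool" where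
  "smooth_on S f \<longleftrightarrow> (\<forall>k. Ck_on k S f)"


section \<open>Smooth manifolds\<close>

text \<open>The points of a manifold form a whole type (Hausdorff and second countable by its type class).
  A chart \<open>(U, \<phi>)\<close> maps the open set \<open>U\<close> homeomorphically onto an open subset of the model space
  \<open>'e\<close>, so the dimension of the manifold is \<open>DIM('e)\<close>. Atlases need not be maximal.\<close>

type_synonym ('m, 'e) chart = "'m set \<times> ('m \<Rightarrow> 'e)"
type_synonym ('m, 'e) atlas = "('m, 'e) chart set"

abbreviation chart_dom :: "('m, 'e) chart \<Rightarrow> 'm set" where
  "chart_dom \<equiv> fst"
abbreviation chart_map :: "('m, 'e) chart \<Rightarrow> 'm \<Rightarrow> 'e" where
  "chart_map \<equiv> snd"
abbreviation chart_inv :: "('m, 'e) chart \<Rightarrow> 'e \<Rightarrow> 'm" where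
  "chart_inv c \<equiv> inv_into (fst c) (snd c)"

definition smooth_manifold ::
    "('m::{t2_space, second_countable_topology}, 'e::euclidean_space) atlas \<Rightarrow> bool" where
  "smooth_manifold \<A> \<longleftrightarrow>
     (\<forall>c\<in>\<A>. open (chart_dom c) \<and> open (chart_map c ` chart_dom c) \<and>
        homeomorphism (chart_dom c) (chart_map c ` chart_dom c) (chart_map c) (chart_inv c)) \<and>
     (\<forall>p. \<exists>c\<in>\<A>. p \<in> chart_dom c) \<and>
     (\<forall>c\<in>\<A>. \<forall>d\<in>\<A>.
        smooth_on (chart_map c ` (chart_dom c \<inter> chart_dom d)) (chart_map d \<circ> chart_inv c))"

definition chart_at :: "('m, 'e) atlas \<Rightarrow> 'm \<Rightarrow> ('m, 'e) chart" where
  "chart_at \<A> p = (SOME c. c \<in> \<A> \<and> p \<in> chart_dom c)"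

text \<open>A tangent vector at \<open>p\<close> is represented by its coordinates in the preferred chart
  \<open>chart_at \<A> p\<close>. Thus \<open>T\<^sub>pM\<close> is the vector space \<open>'e\<close>, and a vector field is a function
  \<open>'m \<Rightarrow> 'e\<close>. The coordinates in another chart are obtained by the derivative of the transition
  map; since the preferred chart varies with \<open>p\<close>, smoothness of a vector field always refers to its
  coordinates in a fixed chart.\<close>

definition transition_deriv ::
    "('m, 'e::real_normed_vector) chart \<Rightarrow> ('m, 'e) chart \<Rightarrow> 'm \<Rightarrow> 'e \<Rightarrow> 'e" where
  "transition_deriv c d p =
     frechet_derivative (chart_map d \<circ> chart_inv c) (at (chart_map c p))"

definition coords ::
    "('m, 'e::real_normed_vector) atlas \<Rightarrow> ('m, 'e) chart \<Rightarrow> 'm \<Rightarrow> 'e \<Rightarrow> 'e" where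
  "coords \<A> c p v = transition_deriv (chart_at \<A> p) c p v"

definition of_coords ::
    "('m, 'e::real_normed_vector) atlas \<Rightarrow> ('m, 'e) chart \<Rightarrow> 'm \<Rightarrow> 'e \<Rightarrow> 'e" where
  "of_coords \<A> c p u = transition_deriv c (chart_at \<A> p) p u"

definition smooth_fun ::
    "('m, 'e::real_normed_vector) atlas \<Rightarrow> 'm set \<Rightarrow> ('m \<Rightarrow> real) \<Rightarrow> bool" where
  "smooth_fun \<A> V f \<longleftrightarrow>
     (\<forall>c\<in>\<A>. smooth_on (chart_map c ` (V \<inter> chart_dom c)) (f \<circ> chart_inv c))"

definition field_in_chart ::
    "('m, 'e::real_normed_vector) atlas \<Rightarrow> ('m, 'e) chart \<Rightarrow> ('m \<Rightarrow> 'e) \<Rightarrow> 'e \<Rightarrow> 'e" where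
  "field_in_chart \<A> c X z = coords \<A> c (chart_inv c z) (X (chart_inv c z))"

definition smooth_field ::
    "('m, 'e::real_normed_vector) atlas \<Rightarrow> 'm set \<Rightarrow> ('m \<Rightarrow> 'e) \<Rightarrow> bool" where
  "smooth_field \<A> V X \<longleftrightarrow>
     (\<forall>c\<in>\<A>. smooth_on (chart_map c ` (V \<inter> chart_dom c)) (field_in_chart \<A> c X))"

definition dir_deriv ::
    "('m, 'e::real_normed_vector) atlas \<Rightarrow> ('m \<Rightarrow> 'b::real_normed_vector) \<Rightarrow> 'm \<Rightarrow> 'e \<Rightarrow> 'b" where
  "dir_deriv \<A> f p v =
     frechet_derivative (f \<circ> chart_inv (chart_at \<A> p)) (at (chart_map (chart_at \<A> p) p)) v"

text \<open>\<open>[X,Y]\<^sup>i = X\<^sup>j \<partial>\<^sub>j Y\<^sup>i - Y\<^sup>j \<partial>\<^sub>j X\<^sup>i\<close> in the preferred chart.\<close>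

definition lie_bracket ::
    "('m, 'e::real_normed_vector) atlas \<Rightarrow> ('m \<Rightarrow> 'e) \<Rightarrow> ('m \<Rightarrow> 'e) \<Rightarrow> 'm \<Rightarrow> 'e" where
  "lie_bracket \<A> X Y p = (let c = chart_at \<A> p in
     frechet_derivative (field_in_chart \<A> c Y) (at (chart_map c p)) (X p) -
     frechet_derivative (field_in_chart \<A> c X) (at (chart_map c p)) (Y p))"

text \<open>The local vector field extending \<open>u \<in> T\<^sub>pM\<close> with constant coordinates in the preferred chart
  at \<open>p\<close>; it is smooth on the domain of that chart.\<close>

definition const_field :: "('m, 'e::real_normed_vector) atlas \<Rightarrow> 'm \<Rightarrow> 'e \<Rightarrow> 'm \<Rightarrow> 'e" where
  "const_field \<A> p u q = of_coords \<A> (chart_at \<A> p) q u"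

text \<open>The value at \<open>p\<close>, on tangent vectors, of an operation on pairs of vector fields that is
  bilinear over the smooth functions (such as a torsion or Nijenhuis tensor).\<close>

definition tensor_at ::
    "('m, 'e::real_normed_vector) atlas \<Rightarrow> (('m \<Rightarrow> 'e) \<Rightarrow> ('m \<Rightarrow> 'e) \<Rightarrow> 'm \<Rightarrow> 'e) \<Rightarrow>
      'm \<Rightarrow> 'e \<Rightarrow> 'e \<Rightarrow> 'e" where
  "tensor_at \<A> B p u v = B (const_field \<A> p u) (const_field \<A> p v) p"


section \<open>Linear connections\<close>

text \<open>A connection on the open set \<open>U\<close> acts on the vector fields of every open \<open>V \<subseteq> U\<close>, compatibly
  with restriction (last clause), so that one operator \<open>D\<close>, with \<open>D X Y = \<nabla>\<^sub>X Y\<close>, serves for all \<open>V\<close>.\<close>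

definition linear_connection ::
    "('m::topological_space, 'e::real_normed_vector) atlas \<Rightarrow> 'm set \<Rightarrow>
      (('m \<Rightarrow> 'e) \<Rightarrow> ('m \<Rightarrow> 'e) \<Rightarrow> 'm \<Rightarrow> 'e) \<Rightarrow> bool" where
  "linear_connection \<A> U D \<longleftrightarrow>
     (\<forall>V X Y X' Y' f. open V \<and> V \<subseteq> U \<and> smooth_field \<A> V X \<and> smooth_field \<A> V Y \<and>
        smooth_field \<A> V X' \<and> smooth_field \<A> V Y' \<and> smooth_fun \<A> V f \<longrightarrow>
        smooth_field \<A> V (D X Y) \<and>
        (\<forall>x\<in>V. D (\<lambda>y. X y + X' y) Y x = D X Y x + D X' Y x) \<and>
        (\<forall>x\<in>V. D (\<lambda>y. f y *\<^sub>R X y) Y x = f x *\<^sub>R D X Y x) \<and>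
        (\<forall>x\<in>V. D X (\<lambda>y. Y y + Y' y) x = D X Y x + D X Y' x) \<and>
        (\<forall>x\<in>V. D X (\<lambda>y. f y *\<^sub>R Y y) x = dir_deriv \<A> f x (X x) *\<^sub>R Y x + f x *\<^sub>R D X Y x) \<and>
        ((\<forall>x\<in>V. X x = X' x \<and> Y x = Y' x) \<longrightarrow> (\<forall>x\<in>V. D X Y x = D X' Y' x)))"

definition torsion ::
    "('m, 'e::real_normed_vector) atlas \<Rightarrow> (('m \<Rightarrow> 'e) \<Rightarrow> ('m \<Rightarrow> 'e) \<Rightarrow> 'm \<Rightarrow> 'e) \<Rightarrow>
      ('m \<Rightarrow> 'e) \<Rightarrow> ('m \<Rightarrow> 'e) \<Rightarrow> 'm \<Rightarrow> 'e" where
  "torsion \<A> D X Y p = D X Y p - D Y X p - lie_bracket \<A> X Y p"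

definition torsion_free ::
    "('m::topological_space, 'e::real_normed_vector) atlas \<Rightarrow>
      (('m \<Rightarrow> 'e) \<Rightarrow> ('m \<Rightarrow> 'e) \<Rightarrow> 'm \<Rightarrow> 'e) \<Rightarrow> bool" where
  "torsion_free \<A> D \<longleftrightarrow>
     (\<forall>V X Y. open V \<and> smooth_field \<A> V X \<and> smooth_field \<A> V Y \<longrightarrow> (\<forall>x\<in>V. torsion \<A> D X Y x = 0))"


section \<open>Differential forms\<close>

definition two_form ::
    "('m::topological_space, 'e::euclidean_space) atlas \<Rightarrow> ('m \<Rightarrow> 'e \<Rightarrow> 'e \<Rightarrow> real) \<Rightarrow> bool" where
  "two_form \<A> \<omega> \<longleftrightarrow>
     (\<forall>x. bilinear (\<omega> x) \<and> (\<forall>u. \<omega> x u u = 0)) \<and>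
     (\<forall>V X Y. open V \<and> smooth_field \<A> V X \<and> smooth_field \<A> V Y \<longrightarrow>
        smooth_fun \<A> V (\<lambda>x. \<omega> x (X x) (Y x)))"

definition nondegenerate :: "('m \<Rightarrow> 'e::real_vector \<Rightarrow> 'e \<Rightarrow> real) \<Rightarrow> bool" where
  "nondegenerate \<omega> \<longleftrightarrow> (\<forall>x u. (\<forall>v. \<omega> x u v = 0) \<longrightarrow> u = 0)"

definition ext_deriv2 ::
    "('m, 'e::real_normed_vector) atlas \<Rightarrow> ('m \<Rightarrow> 'e \<Rightarrow> 'e \<Rightarrow> real) \<Rightarrow>
      ('m \<Rightarrow> 'e) \<Rightarrow> ('m \<Rightarrow> 'e) \<Rightarrow> ('m \<Rightarrow> 'e) \<Rightarrow> 'm \<Rightarrow> real" where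
  "ext_deriv2 \<A> \<omega> X Y Z x =
     dir_deriv \<A> (\<lambda>y. \<omega> y (Y y) (Z y)) x (X x)
     + dir_deriv \<A> (\<lambda>y. \<omega> y (Z y) (X y)) x (Y x)
     + dir_deriv \<A> (\<lambda>y. \<omega> y (X y) (Y y)) x (Z x)
     - \<omega> x (lie_bracket \<A> X Y x) (Z x)
     - \<omega> x (lie_bracket \<A> Y Z x) (X x)
     - \<omega> x (lie_bracket \<A> Z X x) (Y x)"

definition closed_two_form ::
    "('m::topological_space, 'e::real_normed_vector) atlas \<Rightarrow> ('m \<Rightarrow> 'e \<Rightarrow> 'e \<Rightarrow> real) \<Rightarrow> bool" where
  "closed_two_form \<A> \<omega> \<longleftrightarrow>
     (\<forall>V X Y Z. open V \<and> smooth_field \<A> V X \<and> smooth_field \<A> V Y \<and> smooth_field \<A> V Z \<longrightarrow>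
        (\<forall>x\<in>V. ext_deriv2 \<A> \<omega> X Y Z x = 0))"

definition cov_deriv_form ::
    "('m, 'e::real_normed_vector) atlas \<Rightarrow> (('m \<Rightarrow> 'e) \<Rightarrow> ('m \<Rightarrow> 'e) \<Rightarrow> 'm \<Rightarrow> 'e) \<Rightarrow>
      ('m \<Rightarrow> 'e \<Rightarrow> 'e \<Rightarrow> real) \<Rightarrow> ('m \<Rightarrow> 'e) \<Rightarrow> ('m \<Rightarrow> 'e) \<Rightarrow> ('m \<Rightarrow> 'e) \<Rightarrow> 'm \<Rightarrow> real" where
  "cov_deriv_form \<A> D \<omega> X Y Z x =
     dir_deriv \<A> (\<lambda>y. \<omega> y (Y y) (Z y)) x (X x) - \<omega> x (D X Y x) (Z x) - \<omega> x (Y x) (D X Z x)"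

definition preserves_two_form ::
    "('m::topological_space, 'e::real_normed_vector) atlas \<Rightarrow>
      (('m \<Rightarrow> 'e) \<Rightarrow> ('m \<Rightarrow> 'e) \<Rightarrow> 'm \<Rightarrow> 'e) \<Rightarrow> ('m \<Rightarrow> 'e \<Rightarrow> 'e \<Rightarrow> real) \<Rightarrow> bool" where
  "preserves_two_form \<A> D \<omega> \<longleftrightarrow>
     (\<forall>V X Y Z. open V \<and> smooth_field \<A> V X \<and> smooth_field \<A> V Y \<and> smooth_field \<A> V Z \<longrightarrow>
        (\<forall>x\<in>V. cov_deriv_form \<A> D \<omega> X Y Z x = 0))"

text \<open>The \<open>m\<close>-fold wedge power of a 2-form, evaluated on \<open>v 0, \<dots>, v (2 * m - 1)\<close>; normalised by
  \<open>(\<alpha> \<and> \<beta>)(v\<^sub>1, \<dots>) = 1/(p! q!) \<Sum>\<^sub>\<sigma> sgn \<sigma> \<alpha>(v\<^bsub>\<sigma> 1\<^esub>, \<dots>) \<beta>(\<dots>)\<close>.\<close>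

definition wedge_power :: "nat \<Rightarrow> ('e \<Rightarrow> 'e \<Rightarrow> real) \<Rightarrow> (nat \<Rightarrow> 'e) \<Rightarrow> real" where
  "wedge_power m \<omega> v =
     (\<Sum>\<sigma> | \<sigma> permutes {..<2 * m}.
        of_int (sign \<sigma>) * (\<Prod>i<m. \<omega> (v (\<sigma> (2 * i))) (v (\<sigma> (2 * i + 1))))) / 2 ^ m"

definition preserves_multi_form ::
    "('m::topological_space, 'e::real_normed_vector) atlas \<Rightarrow>
      (('m \<Rightarrow> 'e) \<Rightarrow> ('m \<Rightarrow> 'e) \<Rightarrow> 'm \<Rightarrow> 'e) \<Rightarrow> nat \<Rightarrow> ('m \<Rightarrow> (nat \<Rightarrow> 'e) \<Rightarrow> real) \<Rightarrow> bool" where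
  "preserves_multi_form \<A> D r \<alpha> \<longleftrightarrow>
     (\<forall>V X Y. open V \<and> smooth_field \<A> V X \<and> (\<forall>i<r. smooth_field \<A> V (Y i)) \<longrightarrow>
        (\<forall>x\<in>V. dir_deriv \<A> (\<lambda>y. \<alpha> y (\<lambda>j. Y j y)) x (X x) =
               (\<Sum>i<r. \<alpha> x ((\<lambda>j. Y j x)(i := D X (Y i) x)))))"


section \<open>Almost quaternionic skew-Hermitian structures\<close>

text \<open>\<open>End(T\<^sub>pM)\<close> is the space \<open>'e \<Rightarrow>\<^sub>L 'e\<close> of (bounded) linear maps.\<close>

definition endo_app :: "('m \<Rightarrow> 'e::real_normed_vector \<Rightarrow>\<^sub>L 'e) \<Rightarrow> ('m \<Rightarrow> 'e) \<Rightarrow> 'm \<Rightarrow> 'e" where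
  "endo_app J X x = blinfun_apply (J x) (X x)"

definition smooth_endo ::
    "('m::topological_space, 'e::real_normed_vector) atlas \<Rightarrow> 'm set \<Rightarrow> ('m \<Rightarrow> 'e \<Rightarrow>\<^sub>L 'e) \<Rightarrow> bool" where
  "smooth_endo \<A> U J \<longleftrightarrow>
     (\<forall>V X. open V \<and> V \<subseteq> U \<and> smooth_field \<A> V X \<longrightarrow> smooth_field \<A> V (endo_app J X))"

definition admissible_basis ::
    "('m::topological_space, 'e::real_normed_vector) atlas \<Rightarrow> ('m \<Rightarrow> ('e \<Rightarrow>\<^sub>L 'e) set) \<Rightarrow>
      'm set \<Rightarrow> (nat \<Rightarrow> 'm \<Rightarrow> 'e \<Rightarrow>\<^sub>L 'e) \<Rightarrow> bool" where
  "admissible_basis \<A> Q U J \<longleftrightarrow>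
     open U \<and> (\<forall>a\<in>{1..3}. smooth_endo \<A> U (J a)) \<and>
     (\<forall>x\<in>U. (\<forall>a\<in>{1..3}. J a x o\<^sub>L J a x = - id_blinfun) \<and>
            J 1 x o\<^sub>L J 2 x = J 3 x \<and> J 2 x o\<^sub>L J 1 x = - J 3 x \<and>
            Q x = span {J 1 x, J 2 x, J 3 x})"

definition almost_quaternionic ::
    "('m::topological_space, 'e::real_normed_vector) atlas \<Rightarrow> ('m \<Rightarrow> ('e \<Rightarrow>\<^sub>L 'e) set) \<Rightarrow> bool" where
  "almost_quaternionic \<A> Q \<longleftrightarrow>
     (\<forall>x. subspace (Q x) \<and> dim (Q x) = 3) \<and>
     (\<forall>p. \<exists>U J. p \<in> U \<and> admissible_basis \<A> Q U J)"

definition almost_qs_hermitian ::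
    "('m::{t2_space, second_countable_topology}, 'e::euclidean_space) atlas \<Rightarrow>
      ('m \<Rightarrow> ('e \<Rightarrow>\<^sub>L 'e) set) \<Rightarrow> ('m \<Rightarrow> 'e \<Rightarrow> 'e \<Rightarrow> real) \<Rightarrow> bool" where
  "almost_qs_hermitian \<A> Q \<omega> \<longleftrightarrow>
     smooth_manifold \<A> \<and> almost_quaternionic \<A> Q \<and> two_form \<A> \<omega> \<and> nondegenerate \<omega> \<and>
     (\<forall>U J. admissible_basis \<A> Q U J \<longrightarrow>
        (\<forall>x\<in>U. \<forall>a\<in>{1..3}. \<forall>u v. \<omega> x (J a x u) (J a x v) = \<omega> x u v))"


section \<open>The adapted connection\<close>

definition nijenhuis ::
    "('m, 'e::real_normed_vector) atlas \<Rightarrow> ('m \<Rightarrow> 'e \<Rightarrow>\<^sub>L 'e) \<Rightarrow>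
      ('m \<Rightarrow> 'e) \<Rightarrow> ('m \<Rightarrow> 'e) \<Rightarrow> 'm \<Rightarrow> 'e" where
  "nijenhuis \<A> J X Y x =
     lie_bracket \<A> (endo_app J X) (endo_app J Y) x
     - J x (lie_bracket \<A> (endo_app J X) Y x)
     - J x (lie_bracket \<A> X (endo_app J Y) x)
     - lie_bracket \<A> X Y x"

definition obata_connection ::
    "('m::topological_space, 'e::real_normed_vector) atlas \<Rightarrow> 'm set \<Rightarrow>
      (nat \<Rightarrow> 'm \<Rightarrow> 'e \<Rightarrow>\<^sub>L 'e) \<Rightarrow> (('m \<Rightarrow> 'e) \<Rightarrow> ('m \<Rightarrow> 'e) \<Rightarrow> 'm \<Rightarrow> 'e) \<Rightarrow> bool" where
  "obata_connection \<A> U J D \<longleftrightarrow>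
     linear_connection \<A> U D \<and>
     (\<forall>V X Y. open V \<and> V \<subseteq> U \<and> smooth_field \<A> V X \<and> smooth_field \<A> V Y \<longrightarrow>
        (\<forall>x\<in>V. (\<forall>a\<in>{1..3}. D X (endo_app (J a) Y) x = J a x (D X Y x)) \<and>
               torsion \<A> D X Y x = (1 / 6) *\<^sub>R (\<Sum>a\<in>{1..3}. nijenhuis \<A> (J a) X Y x)))"

definition endo_trace :: "('e::euclidean_space \<Rightarrow> 'e) \<Rightarrow> real" where
  "endo_trace f = (\<Sum>b\<in>Basis. f b \<bullet> b)"

text \<open>The 1-form \<open>\<tau>(u) = 1/(4n - 2) tr(J T\<^sub>u)\<close> at a point, where \<open>T\<^sub>u = T(u, \<cdot>)\<close>.\<close>

definition oproiu_form ::
    "nat \<Rightarrow> ('e::euclidean_space \<Rightarrow>\<^sub>L 'e) \<Rightarrow> ('e \<Rightarrow> 'e \<Rightarrow> 'e) \<Rightarrow> 'e \<Rightarrow> real" where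
  "oproiu_form n J T u = endo_trace (\<lambda>v. J (T u v)) / (4 * real n - 2)"

definition alt_tensor ::
    "('e::real_normed_vector \<Rightarrow> real) \<Rightarrow> ('e \<Rightarrow>\<^sub>L 'e) \<Rightarrow> 'e \<Rightarrow> 'e \<Rightarrow> 'e" where
  "alt_tensor \<tau> J u v = \<tau> u *\<^sub>R J v - \<tau> v *\<^sub>R J u"

text \<open>\<open>R\<close> is the covariant derivative \<open>\<nabla>\<^sub>X S\<close> of the section \<open>S\<close> of \<open>Q\<close> over \<open>V\<close>.\<close>

definition preserves_bundle ::
    "('m::topological_space, 'e::real_normed_vector) atlas \<Rightarrow>
      (('m \<Rightarrow> 'e) \<Rightarrow> ('m \<Rightarrow> 'e) \<Rightarrow> 'm \<Rightarrow> 'e) \<Rightarrow> ('m \<Rightarrow> ('e \<Rightarrow>\<^sub>L 'e) set) \<Rightarrow> bool" where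
  "preserves_bundle \<A> D Q \<longleftrightarrow>
     (\<forall>V X S. open V \<and> smooth_field \<A> V X \<and> smooth_endo \<A> V S \<and> (\<forall>x\<in>V. S x \<in> Q x) \<longrightarrow>
        (\<exists>R. (\<forall>x\<in>V. R x \<in> Q x) \<and>
             (\<forall>W Y. open W \<and> W \<subseteq> V \<and> smooth_field \<A> W Y \<longrightarrow>
                (\<forall>x\<in>W. R x (Y x) = D X (endo_app S Y) x - S x (D X Y x)))))"

definition unimodular_oproiu_connection ::
    "nat \<Rightarrow> ('m::topological_space, 'e::euclidean_space) atlas \<Rightarrow> ('m \<Rightarrow> ('e \<Rightarrow>\<^sub>L 'e) set) \<Rightarrow>
      ('m \<Rightarrow> (nat \<Rightarrow> 'e) \<Rightarrow> real) \<Rightarrow> (('m \<Rightarrow> 'e) \<Rightarrow> ('m \<Rightarrow> 'e) \<Rightarrow> 'm \<Rightarrow> 'e) \<Rightarrow> bool" where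
  "unimodular_oproiu_connection n \<A> Q vol D \<longleftrightarrow>
     linear_connection \<A> UNIV D \<and> preserves_bundle \<A> D Q \<and>
     preserves_multi_form \<A> D (4 * n) vol \<and>
     (\<forall>U J DH. admissible_basis \<A> Q U J \<and> obata_connection \<A> U J DH \<longrightarrow>
        (\<forall>x\<in>U. \<forall>u v. let TH = tensor_at \<A> (torsion \<A> DH) x in
           tensor_at \<A> (torsion \<A> D) x u v =
             TH u v + (\<Sum>a\<in>{1..3}. alt_tensor (oproiu_form n (J a x) TH) (J a x) u v)))"

text \<open>\<open>D\<close> is \<open>\<nabla>\<^bsup>Q,\<omega>\<^esup> = \<nabla>\<^bsup>Q,vol\<^esup> + A\<close>, with \<open>D0 = \<nabla>\<^bsup>Q,vol\<^esup>\<close> and \<open>vol = \<omega>\<^bsup>2n\<^esup>\<close>.\<close>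

definition adapted_connection ::
    "nat \<Rightarrow> ('m::topological_space, 'e::euclidean_space) atlas \<Rightarrow> ('m \<Rightarrow> ('e \<Rightarrow>\<^sub>L 'e) set) \<Rightarrow>
      ('m \<Rightarrow> 'e \<Rightarrow> 'e \<Rightarrow> real) \<Rightarrow> (('m \<Rightarrow> 'e) \<Rightarrow> ('m \<Rightarrow> 'e) \<Rightarrow> 'm \<Rightarrow> 'e) \<Rightarrow> bool" where
  "adapted_connection n \<A> Q \<omega> D \<longleftrightarrow>
     (\<exists>D0 A.
        unimodular_oproiu_connection n \<A> Q (\<lambda>x. wedge_power (2 * n) (\<omega> x)) D0 \<and>
        (\<forall>V X Y Z. open V \<and> smooth_field \<A> V X \<and> smooth_field \<A> V Y \<and> smooth_field \<A> V Z \<longrightarrow>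
           (\<forall>x\<in>V. \<omega> x (A x (X x) (Y x)) (Z x) = cov_deriv_form \<A> D0 \<omega> X Y Z x / 2)) \<and>
        (\<forall>V X Y. open V \<and> smooth_field \<A> V X \<and> smooth_field \<A> V Y \<longrightarrow>
           (\<forall>x\<in>V. D X Y x = D0 X Y x + A x (X x) (Y x))))"


section \<open>Almost symplectic submanifolds\<close>

definition smooth_map ::
    "('n::topological_space, 'f::real_normed_vector) atlas \<Rightarrow>
      ('m::topological_space, 'e::real_normed_vector) atlas \<Rightarrow> ('n \<Rightarrow> 'm) \<Rightarrow> bool" where
  "smooth_map \<B> \<A> \<iota> \<longleftrightarrow>
     continuous_on UNIV \<iota> \<and>
     (\<forall>c\<in>\<B>. \<forall>d\<in>\<A>. smooth_on (chart_map c ` (chart_dom c \<inter> \<iota> -` chart_dom d))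
        (chart_map d \<circ> \<iota> \<circ> chart_inv c))"

definition differential ::
    "('n, 'f::real_normed_vector) atlas \<Rightarrow> ('m, 'e::real_normed_vector) atlas \<Rightarrow>
      ('n \<Rightarrow> 'm) \<Rightarrow> 'n \<Rightarrow> 'f \<Rightarrow> 'e" where
  "differential \<B> \<A> \<iota> x u = dir_deriv \<B> (chart_map (chart_at \<A> (\<iota> x)) \<circ> \<iota>) x u"

definition immersion ::
    "('n::topological_space, 'f::real_normed_vector) atlas \<Rightarrow>
      ('m::topological_space, 'e::real_normed_vector) atlas \<Rightarrow> ('n \<Rightarrow> 'm) \<Rightarrow> bool" where
  "immersion \<B> \<A> \<iota> \<longleftrightarrow> smooth_map \<B> \<A> \<iota> \<and> (\<forall>x. inj (differential \<B> \<A> \<iota> x))"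

definition pullback_form ::
    "('n, 'f::real_normed_vector) atlas \<Rightarrow> ('m, 'e::real_normed_vector) atlas \<Rightarrow>
      ('n \<Rightarrow> 'm) \<Rightarrow> ('m \<Rightarrow> 'e \<Rightarrow> 'e \<Rightarrow> real) \<Rightarrow> 'n \<Rightarrow> 'f \<Rightarrow> 'f \<Rightarrow> real" where
  "pullback_form \<B> \<A> \<iota> \<omega> x u v =
     \<omega> (\<iota> x) (differential \<B> \<A> \<iota> x u) (differential \<B> \<A> \<iota> x v)"

definition almost_symplectic_submanifold ::
    "('n::{t2_space, second_countable_topology}, 'f::euclidean_space) atlas \<Rightarrow>
      ('m::topological_space, 'e::euclidean_space) atlas \<Rightarrow>
      ('n \<Rightarrow> 'm) \<Rightarrow> ('m \<Rightarrow> 'e \<Rightarrow> 'e \<Rightarrow> real) \<Rightarrow> bool" where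
  "almost_symplectic_submanifold \<B> \<A> \<iota> \<omega> \<longleftrightarrow>
     smooth_manifold \<B> \<and> immersion \<B> \<A> \<iota> \<and> nondegenerate (pullback_form \<B> \<A> \<iota> \<omega>)"

definition symplectic_submanifold ::
    "('n::{t2_space, second_countable_topology}, 'f::euclidean_space) atlas \<Rightarrow>
      ('m::topological_space, 'e::euclidean_space) atlas \<Rightarrow>
      ('n \<Rightarrow> 'm) \<Rightarrow> ('m \<Rightarrow> 'e \<Rightarrow> 'e \<Rightarrow> real) \<Rightarrow> bool" where
  "symplectic_submanifold \<B> \<A> \<iota> \<omega> \<longleftrightarrow>
     almost_symplectic_submanifold \<B> \<A> \<iota> \<omega> \<and> closed_two_form \<B> (pullback_form \<B> \<A> \<iota> \<omega>)"

definition normal_space ::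
    "('n, 'f::real_normed_vector) atlas \<Rightarrow> ('m, 'e::real_normed_vector) atlas \<Rightarrow>
      ('n \<Rightarrow> 'm) \<Rightarrow> ('m \<Rightarrow> 'e \<Rightarrow> 'e \<Rightarrow> real) \<Rightarrow> 'n \<Rightarrow> 'e set" where
  "normal_space \<B> \<A> \<iota> \<omega> x = {u. \<forall>v. \<omega> (\<iota> x) u (differential \<B> \<A> \<iota> x v) = 0}"

text \<open>The tangential part of \<open>u\<close> in \<open>T\<^bsub>\<iota> x\<^esub>M = d\<iota>(T\<^sub>xN) \<oplus> \<nu>\<^sub>x(N)\<close>, as an element of \<open>T\<^sub>xN\<close> (identified
  with its image under \<open>d\<iota>\<close>).\<close>

definition tangential ::
    "('n, 'f::real_normed_vector) atlas \<Rightarrow> ('m, 'e::real_normed_vector) atlas \<Rightarrow>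
      ('n \<Rightarrow> 'm) \<Rightarrow> ('m \<Rightarrow> 'e \<Rightarrow> 'e \<Rightarrow> real) \<Rightarrow> 'n \<Rightarrow> 'e \<Rightarrow> 'f" where
  "tangential \<B> \<A> \<iota> \<omega> x u =
     (THE w. u - differential \<B> \<A> \<iota> x w \<in> normal_space \<B> \<A> \<iota> \<omega> x)"

text \<open>The covariant derivative along \<open>\<iota>\<close> (pull-back connection on \<open>\<iota>\<^sup>*TM\<close>) of a section \<open>Z\<close> of
  \<open>\<iota>\<^sup>*TM\<close>. With the coordinate frame \<open>E\<^sub>i\<close> of the preferred chart at \<open>\<iota> x\<close> and \<open>Z = \<Sum> Z\<^sup>i (E\<^sub>i \<circ> \<iota>)\<close>
  near \<open>x\<close>, it is \<open>\<Sum> X(Z\<^sup>i) E\<^sub>i + \<Sum> Z\<^sup>i \<nabla>\<^bsub>d\<iota> X\<^esub> E\<^sub>i\<close>; at \<open>\<iota> x\<close> the first sum is the derivative of the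
  coordinates of \<open>Z\<close>, and the second is \<open>\<nabla>\<^bsub>d\<iota> X\<^esub>\<close> of the field with constant coordinates \<open>Z\<^sup>i(x)\<close>.
  It agrees with \<open>\<nabla>\<^bsub>X'\<^esub> Z'\<close> at \<open>\<iota> x\<close> for any local extensions \<open>X'\<close> of \<open>d\<iota> X\<close> and \<open>Z'\<close> of \<open>Z\<close>.\<close>

definition cov_deriv_along ::
    "('n, 'f::real_normed_vector) atlas \<Rightarrow> ('m, 'e::real_normed_vector) atlas \<Rightarrow> ('n \<Rightarrow> 'm) \<Rightarrow>
      (('m \<Rightarrow> 'e) \<Rightarrow> ('m \<Rightarrow> 'e) \<Rightarrow> 'm \<Rightarrow> 'e) \<Rightarrow> ('n \<Rightarrow> 'f) \<Rightarrow> ('n \<Rightarrow> 'e) \<Rightarrow> 'n \<Rightarrow> 'e" where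
  "cov_deriv_along \<B> \<A> \<iota> D X Z x =
     dir_deriv \<B> (\<lambda>y. coords \<A> (chart_at \<A> (\<iota> x)) (\<iota> y) (Z y)) x (X x)
     + D (const_field \<A> (\<iota> x) (differential \<B> \<A> \<iota> x (X x))) (const_field \<A> (\<iota> x) (Z x)) (\<iota> x)"

definition induced_connection ::
    "('n, 'f::real_normed_vector) atlas \<Rightarrow> ('m, 'e::real_normed_vector) atlas \<Rightarrow>
      ('n \<Rightarrow> 'm) \<Rightarrow> ('m \<Rightarrow> 'e \<Rightarrow> 'e \<Rightarrow> real) \<Rightarrow> (('m \<Rightarrow> 'e) \<Rightarrow> ('m \<Rightarrow> 'e) \<Rightarrow> 'm \<Rightarrow> 'e) \<Rightarrow>
      ('n \<Rightarrow> 'f) \<Rightarrow> ('n \<Rightarrow> 'f) \<Rightarrow> 'n \<Rightarrow> 'f" where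
  "induced_connection \<B> \<A> \<iota> \<omega> D X Y x =
     tangential \<B> \<A> \<iota> \<omega> x
       (cov_deriv_along \<B> \<A> \<iota> D X (\<lambda>y. differential \<B> \<A> \<iota> y (Y y)) x)"

definition almost_symplectic_connection ::
    "('n::topological_space, 'f::euclidean_space) atlas \<Rightarrow> ('n \<Rightarrow> 'f \<Rightarrow> 'f \<Rightarrow> real) \<Rightarrow>
      (('n \<Rightarrow> 'f) \<Rightarrow> ('n \<Rightarrow> 'f) \<Rightarrow> 'n \<Rightarrow> 'f) \<Rightarrow> bool" where
  "almost_symplectic_connection \<B> \<omega> D \<longleftrightarrow>
     two_form \<B> \<omega> \<and> nondegenerate \<omega> \<and> linear_connection \<B> UNIV D \<and> preserves_two_form \<B> D \<omega>"

definition symplectic_connection ::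
    "('n::topological_space, 'f::euclidean_space) atlas \<Rightarrow> ('n \<Rightarrow> 'f \<Rightarrow> 'f \<Rightarrow> real) \<Rightarrow>
      (('n \<Rightarrow> 'f) \<Rightarrow> ('n \<Rightarrow> 'f) \<Rightarrow> 'n \<Rightarrow> 'f) \<Rightarrow> bool" where
  "symplectic_connection \<B> \<omega> D \<longleftrightarrow>
     almost_symplectic_connection \<B> \<omega> D \<and> torsion_free \<B> D"

end

theory Submission
  imports Defs
begin

text \<open>Since \<open>\<omega>(A(X,Y),Z) = (\<nabla>\<^sub>X \<omega>)(Y,Z)/2\<close> for \<open>\<nabla> = \<nabla>\<^bsup>Q,vol\<^esup>\<close>, non-degeneracy makes \<open>A\<close> a smooth
  tensor, and skew-symmetry of \<open>\<omega>\<close> makes \<open>D = \<nabla> + A\<close> preserve \<open>\<omega>\<close>.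
  The normal part of a vector pairs to zero with \<open>TN\<close>, so \<open>\<iota>\<^sup>*\<omega>((D\<^sub>X Y)\<^sup>\<top>, Z) = \<omega>(D\<^sub>X Y, Z)\<close> for tangent
  \<open>Z\<close>. By non-degeneracy of \<open>\<iota>\<^sup>*\<omega>\<close> this identity determines the induced connection, gives its
  smoothness, and transports \<open>D\<omega> = 0\<close> to \<open>N\<close>. The torsion formula is the tangential part of
  \<open>D\<^sub>X(d\<iota> Y) - D\<^sub>Y(d\<iota> X) - d\<iota>[X,Y] = T(d\<iota> X, d\<iota> Y)\<close>, which is symmetry of the second derivative of \<open>\<iota>\<close>.
  A form preserved by a torsion-free connection is closed.\<close>

section \<open>Calculus of smooth maps on open sets\<close>

text \<open>Two objects are given only implicitly: \<open>A\<close> by its pairings under \<omega>,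
  and the tangential part by a definite description. The smoothness of both rests on one fact about
  linear systems: if the maps \<open>L z\<close> are injective with smooth matrix entries and
  \<open>L z (W z)\<close> is smooth in \<open>z\<close>, then \<open>W\<close> is smooth. It is
  proved with a left inverse at a single point, without determinants or a formula for inverse
  matrices.

  The encoding of tangent vectors is the other obstacle. The value of a field at \<open>p\<close> is
  its coordinate vector in the chart chosen at \<open>p\<close>, and this choice may jump from point
  to point. Identities at one point are simplest in that point's own chart, but smoothness needs one
  chart for all nearby points. Hence the derivatives of functions, of maps and of sections are also
  computed in an arbitrary chart.

  Finally, a section along \<iota> need not be the restriction of a field on M. What is known about
  fields on M reaches N by writing a section in a coordinate frame: with the coefficients frozen at
  the point, the frame fields live on M, and the derivatives of the coefficients are accounted for
  separately.\<close>

abbreviation fderiv :: "('a::real_normed_vector \<Rightarrow> 'b::real_normed_vector) \<Rightarrow> 'a \<Rightarrow> 'a \<Rightarrow> 'b" where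
  "fderiv f x \<equiv> frechet_derivative f (at x)"

lemma fderiv_eqI: "(f has_derivative f') (at x) \<Longrightarrow> fderiv f x = f'"
  using frechet_derivative_at by metis

lemma has_fderiv: "f differentiable (at x) \<Longrightarrow> (f has_derivative fderiv f x) (at x)"
  by (simp add: frechet_derivative_works)

lemma has_derivative_cong_open:
  assumes "open S" "x \<in> S" "\<And>y. y \<in> S \<Longrightarrow> f y = g y"
  shows "(f has_derivative f') (at x) \<longleftrightarrow> (g has_derivative f') (at x)"
  using assms by (metis has_derivative_transform_within_open)

text \<open>Points without a derivative are covered too: \<open>frechet_derivative\<close> chooses
  from the set of derivatives, and maps that agree near \<open>x\<close> have the same set.\<close>

lemma fderiv_cong_open:
  assumes "open S" "x \<in> S" "\<And>y. y \<in> S \<Longrightarrow> f y = g y"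
  shows "fderiv f x = fderiv g x"
  unfolding frechet_derivative_def using has_derivative_cong_open[OF assms] by simp

lemma differentiable_cong_open:
  assumes "open S" "x \<in> S" "\<And>y. y \<in> S \<Longrightarrow> f y = g y"
  shows "f differentiable (at x) \<longleftrightarrow> g differentiable (at x)"
  unfolding differentiable_def using has_derivative_cong_open[OF assms] by simp

lemma fderiv_bilinear:
  assumes "bounded_bilinear b" "f differentiable (at x)" "g differentiable (at x)"
  shows "fderiv (\<lambda>y. b (f y) (g y)) x v = b (f x) (fderiv g x v) + b (fderiv f x v) (g x)"
  by (rule fderiv_eqI[OF bounded_bilinear.FDERIV[OF assms(1) has_fderiv has_fderiv], THEN fun_cong])
     (use assms in auto)

lemma fderiv_linear:
  assumes "bounded_linear h" "f differentiable (at x)"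
  shows "fderiv (\<lambda>y. h (f y)) x v = h (fderiv f x v)"
  by (rule fderiv_eqI[OF bounded_linear.has_derivative[OF assms(1) has_fderiv], THEN fun_cong])
     (use assms in auto)

lemma fderiv_add:
  assumes "f differentiable (at x)" "g differentiable (at x)"
  shows "fderiv (\<lambda>y. f y + g y) x v = fderiv f x v + fderiv g x v"
  by (rule fderiv_eqI[OF has_derivative_add[OF has_fderiv has_fderiv], THEN fun_cong])
     (use assms in auto)

lemma fderiv_sum:
  assumes "\<And>i. i \<in> I \<Longrightarrow> f i differentiable (at x)"
  shows "fderiv (\<lambda>y. \<Sum>i\<in>I. f i y) x v = (\<Sum>i\<in>I. fderiv (f i) x v)"
  by (rule fderiv_eqI[OF has_derivative_sum[OF has_fderiv], THEN fun_cong])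
     (use assms in auto)

lemma fderiv_chain:
  assumes "f differentiable (at x)" "g differentiable (at (f x))"
  shows "fderiv (\<lambda>y. g (f y)) x v = fderiv g (f x) (fderiv f x v)"
  by (rule fderiv_eqI[OF has_derivative_compose[OF has_fderiv has_fderiv], THEN fun_cong])
     (use assms in auto)

section \<open>Closure properties of the classes C^k on open sets\<close>

lemma Ck_on_cong:
  assumes "open S" "\<And>x. x \<in> S \<Longrightarrow> f x = g x"
  shows "Ck_on k S f \<longleftrightarrow> Ck_on k S g"
  using assms(2)
proof (induction k arbitrary: f g)
  case 0
  then show ?case by (simp cong: continuous_on_cong)
next
  case (Suc k)
  have "f differentiable_on S \<longleftrightarrow> g differentiable_on S"
    unfolding differentiable_on_eq_differentiable_at[OF assms(1)]
    by (intro ball_cong refl differentiable_cong_open[OF assms(1)] Suc.prems)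
  moreover have "Ck_on k S (\<lambda>x. fderiv f x v) \<longleftrightarrow> Ck_on k S (\<lambda>x. fderiv g x v)" for v
    by (rule Suc.IH) (simp add: fderiv_cong_open[OF assms(1) _ Suc.prems])
  ultimately show ?case by simp
qed

lemma Ck_on_subset: "Ck_on k S f \<Longrightarrow> T \<subseteq> S \<Longrightarrow> Ck_on k T f"
  by (induction k arbitrary: f)
     (auto intro: continuous_on_subset differentiable_on_subset)

lemma Ck_on_local:
  assumes "\<And>x. x \<in> S \<Longrightarrow> \<exists>T. open T \<and> x \<in> T \<and> Ck_on k T f"
  shows "Ck_on k S f"
  using assms
proof (induction k arbitrary: f)
  case 0
  have "isCont f x" if "x \<in> S" for x
    using 0[OF that] by (auto simp: continuous_on_eq_continuous_at)
  then show ?case by (simp add: continuous_at_imp_continuous_on)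
next
  case (Suc k)
  have "f differentiable (at x)" if "x \<in> S" for x
    using Suc.prems[OF that] by (auto simp: differentiable_on_eq_differentiable_at)
  then have "f differentiable_on S"
    by (simp add: differentiable_at_imp_differentiable_on)
  moreover have "Ck_on k S (\<lambda>x. fderiv f x v)" for v
    by (rule Suc.IH) (use Suc.prems in auto)
  ultimately show ?case by simp
qed

lemma Ck_on_continuous: "Ck_on k S f \<Longrightarrow> continuous_on S f"
  by (cases k) (auto dest: differentiable_imp_continuous_on)

lemma Ck_on_Suc: "Ck_on (Suc k) S f \<Longrightarrow> Ck_on k S f"
  by (induction k arbitrary: f) (auto intro: differentiable_imp_continuous_on)

lemma Ck_on_const: "Ck_on k S (\<lambda>x. c)"
  by (induction k arbitrary: c) auto

lemma Ck_on_linear: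
  assumes "bounded_linear h" "open S" "Ck_on k S f"
  shows "Ck_on k S (\<lambda>x. h (f x))"
  using assms(3)
proof (induction k arbitrary: f)
  case 0
  then show ?case using assms(1) by (simp add: bounded_linear.continuous_on)
next
  case (Suc k)
  have d: "f differentiable (at x)" if "x \<in> S" for x
    using Suc.prems that differentiable_on_eq_differentiable_at[OF assms(2)] by auto
  have "(\<lambda>x. h (f x)) differentiable_on S"
    unfolding differentiable_on_eq_differentiable_at[OF assms(2)]
    using d bounded_linear.has_derivative[OF assms(1) has_fderiv] unfolding differentiable_def by blast
  moreover have "Ck_on k S (\<lambda>x. fderiv (\<lambda>x. h (f x)) x v)" for v
    using Suc.IH[of "\<lambda>x. fderiv f x v"] Suc.prems
    by (subst Ck_on_cong[OF assms(2) fderiv_linear[OF assms(1) d]]) auto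
  ultimately show ?case by simp
qed

lemma Ck_on_add:
  assumes "open S" "Ck_on k S f" "Ck_on k S g"
  shows "Ck_on k S (\<lambda>x. f x + g x)"
  using assms(2,3)
proof (induction k arbitrary: f g)
  case 0
  then show ?case by (simp add: continuous_on_add)
next
  case (Suc k)
  have d: "f differentiable (at x)" "g differentiable (at x)" if "x \<in> S" for x
    using Suc.prems that differentiable_on_eq_differentiable_at[OF assms(1)] by auto
  have "Ck_on k S (\<lambda>x. fderiv (\<lambda>x. f x + g x) x v)" for v
    using Suc.IH[of "\<lambda>x. fderiv f x v" "\<lambda>x. fderiv g x v"] Suc.prems
    by (subst Ck_on_cong[OF assms(1) fderiv_add[OF d]]) auto
  then show ?case using Suc.prems by simp
qed

lemma Ck_on_sum:
  assumes "open S" "\<And>i. i \<in> I \<Longrightarrow> Ck_on k S (f i)"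
  shows "Ck_on k S (\<lambda>x. \<Sum>i\<in>I. f i x)"
  using assms(2)
proof (induction I rule: infinite_finite_induct)
  case (insert i I)
  then show ?case using Ck_on_add[OF assms(1)] by auto
qed (simp_all add: Ck_on_const)

lemma Ck_on_bilinear:
  assumes "bounded_bilinear b" "open S" "Ck_on k S f" "Ck_on k S g"
  shows "Ck_on k S (\<lambda>x. b (f x) (g x))"
  using assms(3,4)
proof (induction k arbitrary: f g)
  case 0
  then show ?case using bounded_bilinear.continuous_on[OF assms(1)] by simp
next
  case (Suc k)
  have d: "f differentiable (at x)" "g differentiable (at x)" if "x \<in> S" for x
    using Suc.prems that differentiable_on_eq_differentiable_at[OF assms(2)] by auto
  have "(\<lambda>x. b (f x) (g x)) differentiable_on S"
    unfolding differentiable_on_eq_differentiable_at[OF assms(2)]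
    using d bounded_bilinear.FDERIV[OF assms(1) has_fderiv has_fderiv]
    unfolding differentiable_def by blast
  \<comment> \<open>Each term of the product rule keeps one factor undifferentiated, so both factors
    are needed in the lower class as well; \<open>Ck_on_Suc\<close> provides that.\<close>
  moreover have "Ck_on k S (\<lambda>x. fderiv (\<lambda>x. b (f x) (g x)) x v)" for v
    using Suc.IH[of f "\<lambda>x. fderiv g x v"] Suc.IH[of "\<lambda>x. fderiv f x v" g] Suc.prems
      Ck_on_Suc[OF Suc.prems(1)] Ck_on_Suc[OF Suc.prems(2)]
    by (subst Ck_on_cong[OF assms(2) fderiv_bilinear[OF assms(1) d]])
       (auto intro: Ck_on_add[OF assms(2)])
  ultimately show ?case by simp
qed

lemma linear_expand:
  fixes f :: "'a::euclidean_space \<Rightarrow> 'b::real_vector"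
  assumes "linear f"
  shows "f v = (\<Sum>b\<in>Basis. (v \<bullet> b) *\<^sub>R f b)"
proof -
  have "f (\<Sum>b\<in>Basis. (v \<bullet> b) *\<^sub>R b) = (\<Sum>b\<in>Basis. f ((v \<bullet> b) *\<^sub>R b))"
    using linear_sum[OF assms] by blast
  then show ?thesis by (simp add: euclidean_representation linear_cmul[OF assms])
qed

text \<open>The chain rule produces \<open>fderiv g (f x)\<close> in a direction that moves with
  \<open>x\<close>, which the induction hypothesis does not cover. Expanding this direction in the
  basis of the middle space leaves the compositions \<open>fderiv g (f x) b\<close> with fixed
  \<open>b\<close>, weighted by components of the derivative of \<open>f\<close>. So only
  \<open>g\<close> has to vary in the induction.\<close>

lemma Ck_on_compose:
  fixes f :: "'a::real_normed_vector \<Rightarrow> 'b::euclidean_space" and g :: "'b \<Rightarrow> 'c::real_normed_vector"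
  assumes S: "open S" and T: "open T" and "f ` S \<subseteq> T" "Ck_on k S f" "Ck_on k T g"
  shows "Ck_on k S (\<lambda>x. g (f x))"
  using assms(3-)
proof (induction k arbitrary: g)
  case 0
  then show ?case
    using continuous_on_compose2[of T g S f] by simp
next
  case (Suc k)
  have d: "f differentiable (at x)" "g differentiable (at (f x))" if "x \<in> S" for x
    using Suc.prems that differentiable_on_eq_differentiable_at[OF S, of f]
      differentiable_on_eq_differentiable_at[OF T, of g] by (auto simp: image_subset_iff)
  have "(\<lambda>x. g (f x)) differentiable_on S"
    unfolding differentiable_on_eq_differentiable_at[OF S]
    using d differentiable_chain_at[of f _ g] by (simp add: o_def)
  moreover have "Ck_on k S (\<lambda>x. fderiv (\<lambda>x. g (f x)) x v)" for v
  proof -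
    have eq: "fderiv (\<lambda>x. g (f x)) x v
        = (\<Sum>b\<in>Basis. (fderiv f x v \<bullet> b) *\<^sub>R fderiv g (f x) b)" if "x \<in> S" for x
      unfolding fderiv_chain[OF d[OF that]]
      by (rule linear_expand[OF linear_frechet_derivative[OF d(2)[OF that]]])
    have "Ck_on k S (\<lambda>x. fderiv g (f x) b)" for b
      using Suc.IH[of "\<lambda>y. fderiv g y b"] Suc.prems Ck_on_Suc[OF Suc.prems(2)] by auto
    moreover have "Ck_on k S (\<lambda>x. fderiv f x v \<bullet> b)" for b
      using Suc.prems by (auto intro!: Ck_on_linear[OF bounded_linear_inner_left S])
    ultimately show ?thesis
      by (subst Ck_on_cong[OF S eq])
         (auto intro!: Ck_on_sum[OF S] Ck_on_bilinear[OF bounded_bilinear_scaleR S])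
  qed
  ultimately show ?case by simp
qed

lemma smooth_on_cong:
  "open S \<Longrightarrow> (\<And>x. x \<in> S \<Longrightarrow> f x = g x) \<Longrightarrow> smooth_on S f \<longleftrightarrow> smooth_on S g"
  unfolding smooth_on_def by (intro all_cong1 Ck_on_cong)

lemma smooth_on_subset: "smooth_on S f \<Longrightarrow> T \<subseteq> S \<Longrightarrow> smooth_on T f"
  by (auto simp: smooth_on_def intro: Ck_on_subset)

lemma smooth_on_local:
  "(\<And>x. x \<in> S \<Longrightarrow> \<exists>T. open T \<and> x \<in> T \<and> smooth_on T f) \<Longrightarrow> smooth_on S f"
  unfolding smooth_on_def by (intro allI Ck_on_local) blast

lemma smooth_on_const: "smooth_on S (\<lambda>x. c)"
  by (simp add: smooth_on_def Ck_on_const)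

lemma smooth_on_linear:
  "bounded_linear h \<Longrightarrow> open S \<Longrightarrow> smooth_on S f \<Longrightarrow> smooth_on S (\<lambda>x. h (f x))"
  by (simp add: smooth_on_def Ck_on_linear)

lemma smooth_on_add:
  "open S \<Longrightarrow> smooth_on S f \<Longrightarrow> smooth_on S g \<Longrightarrow> smooth_on S (\<lambda>x. f x + g x)"
  by (simp add: smooth_on_def Ck_on_add)

lemma smooth_on_sum:
  "open S \<Longrightarrow> (\<And>i. i \<in> I \<Longrightarrow> smooth_on S (f i)) \<Longrightarrow> smooth_on S (\<lambda>x. \<Sum>i\<in>I. f i x)"
  by (simp add: smooth_on_def Ck_on_sum)

lemma smooth_on_bilinear:
  "bounded_bilinear b \<Longrightarrow> open S \<Longrightarrow> smooth_on S f \<Longrightarrow> smooth_on S g \<Longrightarrow>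
    smooth_on S (\<lambda>x. b (f x) (g x))"
  by (simp add: smooth_on_def Ck_on_bilinear)

lemmas smooth_on_scaleR = smooth_on_bilinear[OF bounded_bilinear_scaleR]

lemma smooth_on_compose:
  fixes f :: "'a::real_normed_vector \<Rightarrow> 'b::euclidean_space"
  shows "open S \<Longrightarrow> open T \<Longrightarrow> f ` S \<subseteq> T \<Longrightarrow> smooth_on S f \<Longrightarrow> smooth_on T g \<Longrightarrow>
    smooth_on S (\<lambda>x. g (f x))"
  by (simp add: smooth_on_def Ck_on_compose)

lemma smooth_on_fderiv: "smooth_on S f \<Longrightarrow> smooth_on S (\<lambda>x. fderiv f x v)"
  unfolding smooth_on_def using Ck_on.simps(2)[of _ S f] by blast

lemma smooth_on_differentiable:
  "smooth_on S f \<Longrightarrow> open S \<Longrightarrow> x \<in> S \<Longrightarrow> f differentiable (at x)"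
  unfolding smooth_on_def using Ck_on.simps(2)[of 0 S f] differentiable_on_eq_differentiable_at[of S f]
  by blast

lemma smooth_on_continuous: "smooth_on S f \<Longrightarrow> continuous_on S f"
  unfolding smooth_on_def using Ck_on_continuous by blast

text \<open>\<open>Ck_on\<close> differentiates in fixed directions only, while a vector field
  supplies a moving one; the basis expansion bridges the two.\<close>

lemma smooth_on_fderiv_field:
  fixes f :: "'a::euclidean_space \<Rightarrow> 'b::real_normed_vector"
  assumes "open S" "smooth_on S f" "smooth_on S g"
  shows "smooth_on S (\<lambda>x. fderiv f x (g x))"
proof -
  have eq: "fderiv f x (g x) = (\<Sum>b\<in>Basis. (g x \<bullet> b) *\<^sub>R fderiv f x b)" if "x \<in> S" for x
    by (intro linear_expand linear_frechet_derivative smooth_on_differentiable[OF assms(2,1) that])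
  show ?thesis
    by (subst smooth_on_cong[OF assms(1) eq])
       (use assms in \<open>auto intro!: smooth_on_sum smooth_on_scaleR smooth_on_fderiv
          smooth_on_linear[OF bounded_linear_inner_left]\<close>)
qed

text \<open>With the moving direction expanded in the basis, this is the product rule for scalar
  multiples. The split isolates the second derivative of \<open>f\<close>, which is symmetric, from
  the derivative of \<open>g\<close>, which later contributes to a Lie bracket.\<close>

lemma fderiv_smooth_field:
  fixes f :: "'a::euclidean_space \<Rightarrow> 'b::real_normed_vector"
  assumes S: "open S" "x \<in> S" and f: "smooth_on S f" and g: "g differentiable (at x)"
  shows "fderiv (\<lambda>y. fderiv f y (g y)) x v
       = fderiv (\<lambda>y. fderiv f y (g x)) x v + fderiv f x (fderiv g x v)"
proof -
  have d: "(\<lambda>y. fderiv f y b) differentiable (at x)" for b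
    using smooth_on_differentiable[OF smooth_on_fderiv[OF f] S] .
  have lin: "linear (fderiv f y)" if "y \<in> S" for y
    by (intro linear_frechet_derivative smooth_on_differentiable[OF f S(1) that])
  have dg: "(\<lambda>y. g y \<bullet> b) differentiable (at x)" for b
    using g by (intro differentiable_inner) auto
  have "fderiv (\<lambda>y. fderiv f y (g y)) x v
      = fderiv (\<lambda>y. \<Sum>b\<in>Basis. (g y \<bullet> b) *\<^sub>R fderiv f y b) x v"
    by (rule fun_cong[OF fderiv_cong_open[OF S]]) (rule linear_expand[OF lin])
  also have "\<dots> = (\<Sum>b\<in>Basis. (g x \<bullet> b) *\<^sub>R fderiv (\<lambda>y. fderiv f y b) x v
        + fderiv (\<lambda>y. g y \<bullet> b) x v *\<^sub>R fderiv f x b)"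
    by (subst fderiv_sum) (auto intro!: differentiable_scaleR d dg sum.cong fderiv_bilinear bounded_bilinear_scaleR)
  also have "\<dots> = (\<Sum>b\<in>Basis. (g x \<bullet> b) *\<^sub>R fderiv (\<lambda>y. fderiv f y b) x v)
        + (\<Sum>b\<in>Basis. (fderiv g x v \<bullet> b) *\<^sub>R fderiv f x b)"
    using fderiv_linear[OF bounded_linear_inner_left g] by (simp add: sum.distrib)
  also have "(\<Sum>b\<in>Basis. (fderiv g x v \<bullet> b) *\<^sub>R fderiv f x b) = fderiv f x (fderiv g x v)"
    by (rule linear_expand[OF lin[OF S(2)], symmetric])
  also have "(\<Sum>b\<in>Basis. (g x \<bullet> b) *\<^sub>R fderiv (\<lambda>y. fderiv f y b) x v)
      = fderiv (\<lambda>y. \<Sum>b\<in>Basis. (g x \<bullet> b) *\<^sub>R fderiv f y b) x v"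
    by (subst fderiv_sum) (auto intro!: differentiable_scaleR d sum.cong
        fderiv_linear[OF bounded_linear_scaleR_right, symmetric])
  also have "\<dots> = fderiv (\<lambda>y. fderiv f y (g x)) x v"
    by (rule fun_cong[OF fderiv_cong_open[OF S]]) (rule linear_expand[OF lin, symmetric])
  finally show ?thesis .
qed

section \<open>Symmetry of second derivatives\<close>

text \<open>Both mixed derivatives are limits of the second difference quotient at \<open>z\<close>, by the mean value
  theorem applied in each of the two variables.\<close>

lemma second_difference_mvt:
  fixes f :: "'a::real_normed_vector \<Rightarrow> real"
  assumes h: "h > 0"
    and in_S: "\<And>s t. 0 \<le> s \<Longrightarrow> s \<le> h \<Longrightarrow> 0 \<le> t \<Longrightarrow> t \<le> h \<Longrightarrow> z + s *\<^sub>R u + t *\<^sub>R v \<in> S"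
    and f: "\<And>x. x \<in> S \<Longrightarrow> f differentiable (at x)"
    and f': "\<And>x. x \<in> S \<Longrightarrow> (\<lambda>y. fderiv f y u) differentiable (at x)"
  shows "\<exists>s t. 0 \<le> s \<and> s \<le> h \<and> 0 \<le> t \<and> t \<le> h \<and>
    f (z + h *\<^sub>R u + h *\<^sub>R v) - f (z + h *\<^sub>R u) - f (z + h *\<^sub>R v) + f z
      = h * (h * fderiv (\<lambda>y. fderiv f y u) (z + s *\<^sub>R u + t *\<^sub>R v) v)"
proof -
  define g where "g s = f (z + s *\<^sub>R u + h *\<^sub>R v) - f (z + s *\<^sub>R u)" for s
  have line: "((\<lambda>s. F (p + s *\<^sub>R w)) has_real_derivative fderiv F (p + s *\<^sub>R w) w) (at s)"
    if "F differentiable (at (p + s *\<^sub>R w))" for F :: "'a \<Rightarrow> real" and p w s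
  proof -
    have "((\<lambda>s. p + s *\<^sub>R w) has_derivative (\<lambda>r. r *\<^sub>R w)) (at s)"
      by (auto intro!: derivative_eq_intros)
    from has_derivative_compose[OF this has_fderiv[OF that]]
    show ?thesis
      by (rule has_derivative_imp_has_field_derivative)
         (simp add: linear_cmul[OF linear_frechet_derivative[OF that]])
  qed
  have "(g has_real_derivative fderiv f (z + s *\<^sub>R u + h *\<^sub>R v) u - fderiv f (z + s *\<^sub>R u) u) (at s)"
    if "0 \<le> s" "s \<le> h" for s
  proof -
    have "z + h *\<^sub>R v + s *\<^sub>R u \<in> S" "z + s *\<^sub>R u \<in> S"
      using in_S[of s h] in_S[of s 0] that h by (simp_all add: add_ac)
    from DERIV_diff[OF line[OF f[OF this(1)]] line[OF f[OF this(2)]]]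
    show ?thesis by (simp add: g_def[abs_def] add_ac)
  qed
  from MVT2[OF h this] obtain s where s: "0 < s" "s < h"
    "g h - g 0 = (h - 0) * (fderiv f (z + s *\<^sub>R u + h *\<^sub>R v) u - fderiv f (z + s *\<^sub>R u) u)"
    by blast
  define k where "k t = fderiv f (z + s *\<^sub>R u + t *\<^sub>R v) u" for t
  have "(k has_real_derivative fderiv (\<lambda>y. fderiv f y u) (z + s *\<^sub>R u + t *\<^sub>R v) v) (at t)"
    if "0 \<le> t" "t \<le> h" for t
    unfolding k_def[abs_def]
    by (rule line[OF f']) (use in_S[of s t] that s in auto)
  from MVT2[OF h this] obtain t where t: "0 < t" "t < h"
    "k h - k 0 = (h - 0) * fderiv (\<lambda>y. fderiv f y u) (z + s *\<^sub>R u + t *\<^sub>R v) v"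
    by blast
  have "g h - g 0 = h * (h * fderiv (\<lambda>y. fderiv f y u) (z + s *\<^sub>R u + t *\<^sub>R v) v)"
    using s(3) t(3) by (simp add: k_def)
  then show ?thesis
    by (intro exI[of _ s] exI[of _ t]) (use s t in \<open>simp add: g_def\<close>)
qed

text \<open>The mean value argument in the two orders yields different intermediate points, so it
  equates the two mixed derivatives only at two separate points near \<open>z\<close>. Continuity of
  both derivatives brings the equality to \<open>z\<close>.\<close>

lemma fderiv_symmetric_real:
  fixes f :: "'a::real_normed_vector \<Rightarrow> real"
  assumes S: "open S" "z \<in> S" and f: "smooth_on S f"
  shows "fderiv (\<lambda>y. fderiv f y u) z v = fderiv (\<lambda>y. fderiv f y v) z u"
proof (rule ccontr)
  define P where "P x = fderiv (\<lambda>y. fderiv f y u) x v" for x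
  define R where "R x = fderiv (\<lambda>y. fderiv f y v) x u" for x
  \<comment> \<open>Half of the assumed gap: two errors below \<open>e\<close> cannot add up to
    \<open>2 * e\<close>.\<close>
  define e where "e = \<bar>P z - R z\<bar> / 2"
  assume "\<not> ?thesis"
  then have e: "e > 0" by (simp add: e_def P_def R_def)
  have "isCont P z" "isCont R z"
    using smooth_on_continuous[OF smooth_on_fderiv[OF smooth_on_fderiv[OF f]]] S
    by (auto simp: P_def[abs_def] R_def[abs_def] continuous_on_eq_continuous_at)
  then obtain d1 d2 where d12: "d1 > 0" "\<And>x. dist x z < d1 \<Longrightarrow> \<bar>P x - P z\<bar> < e"
    "d2 > 0" "\<And>x. dist x z < d2 \<Longrightarrow> \<bar>R x - R z\<bar> < e"
    unfolding continuous_at_eps_delta dist_real_def using e by metis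
  obtain d3 where d3: "d3 > 0" "\<And>x. dist x z < d3 \<Longrightarrow> x \<in> S"
    using S by (metis open_dist)
  define d where "d = min d1 (min d2 d3)"
  \<comment> \<open>The parallelogram with sides \<open>h u\<close> and \<open>h v\<close> must stay
    in the ball of radius \<open>d\<close>. The \<open>+ 1\<close> keeps the denominator positive
    when \<open>u = v = 0\<close>; the factor 2 bounds the distance by
    \<open>d / 2 < d\<close>.\<close>
  define h where "h = d / (2 * (norm u + norm v + 1))"
  have d: "d > 0" using d12 d3 by (simp add: d_def)
  have N: "norm u + norm v + 1 > 0" using norm_ge_zero[of u] norm_ge_zero[of v] by linarith
  then have h: "h > 0" using d by (simp add: h_def)
  have near: "dist (z + s *\<^sub>R u + t *\<^sub>R v) z < d" if "0 \<le> s" "s \<le> h" "0 \<le> t" "t \<le> h" for s t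
  proof -
    have "norm (s *\<^sub>R u + t *\<^sub>R v) \<le> s * norm u + t * norm v"
      by (rule norm_triangle_le) (use that in simp)
    also have "\<dots> \<le> h * norm u + h * norm v"
      using that by (intro add_mono mult_right_mono) auto
    also have "\<dots> \<le> h * (norm u + norm v + 1)" using h by (simp add: algebra_simps)
    also have "\<dots> = d / 2" using N by (simp add: h_def divide_simps)
    also have "\<dots> < d" using d by simp
    finally show ?thesis by (simp add: dist_norm add.assoc)
  qed
  have diff: "f differentiable (at x)" "(\<lambda>y. fderiv f y w) differentiable (at x)" if "x \<in> S" for x w
    using smooth_on_differentiable[OF _ S(1) that] f smooth_on_fderiv[OF f] by auto
  have inS: "z + s *\<^sub>R u + t *\<^sub>R v \<in> S" "z + t *\<^sub>R v + s *\<^sub>R u \<in> S"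
    if "0 \<le> s" "s \<le> h" "0 \<le> t" "t \<le> h" for s t
    using near[OF that] d3(2) by (auto simp: d_def add_ac)
  obtain s t where st: "0 \<le> s" "s \<le> h" "0 \<le> t" "t \<le> h"
    "f (z + h *\<^sub>R u + h *\<^sub>R v) - f (z + h *\<^sub>R u) - f (z + h *\<^sub>R v) + f z
      = h * (h * P (z + s *\<^sub>R u + t *\<^sub>R v))"
    using second_difference_mvt[OF h, of z u v S f] inS diff unfolding P_def by blast
  obtain s' t' where st': "0 \<le> s'" "s' \<le> h" "0 \<le> t'" "t' \<le> h"
    "f (z + h *\<^sub>R v + h *\<^sub>R u) - f (z + h *\<^sub>R v) - f (z + h *\<^sub>R u) + f z
      = h * (h * R (z + s' *\<^sub>R v + t' *\<^sub>R u))"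
    using second_difference_mvt[OF h, of z v u S f] inS diff unfolding R_def by blast
  have "h * (h * P (z + s *\<^sub>R u + t *\<^sub>R v)) = h * (h * R (z + s' *\<^sub>R v + t' *\<^sub>R u))"
    using st(5) st'(5) by (simp add: algebra_simps)
  then have eq: "P (z + s *\<^sub>R u + t *\<^sub>R v) = R (z + t' *\<^sub>R u + s' *\<^sub>R v)"
    using h by (simp add: add_ac)
  have "\<bar>P (z + s *\<^sub>R u + t *\<^sub>R v) - P z\<bar> < e" "\<bar>R (z + t' *\<^sub>R u + s' *\<^sub>R v) - R z\<bar> < e"
    using near[OF st(1-4)] near[OF st'(3,4,1,2)] d12 by (auto simp: d_def)
  then have "\<bar>P z - R z\<bar> < 2 * e" using eq by linarith
  then show False by (simp add: e_def)
qed

lemma fderiv_symmetric: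
  fixes f :: "'a::real_normed_vector \<Rightarrow> 'b::euclidean_space"
  assumes S: "open S" "z \<in> S" and f: "smooth_on S f"
  shows "fderiv (\<lambda>y. fderiv f y u) z v = fderiv (\<lambda>y. fderiv f y v) z u"
proof (rule euclidean_eqI)
  fix b :: 'b
  have comp: "fderiv (\<lambda>y. fderiv f y u) z v \<bullet> b = fderiv (\<lambda>y. fderiv (\<lambda>x. f x \<bullet> b) y u) z v" for u v
  proof -
    have "fderiv (\<lambda>y. fderiv f y u) z v \<bullet> b = fderiv (\<lambda>y. fderiv f y u \<bullet> b) z v"
      by (rule fderiv_linear[OF bounded_linear_inner_left, symmetric])
         (rule smooth_on_differentiable[OF smooth_on_fderiv[OF f] S])
    also have "\<dots> = fderiv (\<lambda>y. fderiv (\<lambda>x. f x \<bullet> b) y u) z v"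
      by (rule fun_cong[OF fderiv_cong_open[OF S]])
         (simp add: fderiv_linear[OF bounded_linear_inner_left smooth_on_differentiable[OF f S(1)]])
    finally show ?thesis .
  qed
  show "fderiv (\<lambda>y. fderiv f y u) z v \<bullet> b = fderiv (\<lambda>y. fderiv f y v) z u \<bullet> b"
    unfolding comp
    by (rule fderiv_symmetric_real[OF S smooth_on_linear[OF bounded_linear_inner_left S(1) f]])
qed

text \<open>Because \<open>N\<close> vanishes at \<open>z\<close>, the product of
  \<open>c y - c z\<close> with \<open>N y\<close> is o(|y - z|), so continuity of \<open>c\<close>
  takes the place of its derivative in the product rule. It serves for coefficients that are not yet
  known to be differentiable.\<close>

lemma has_derivative_scaleR_vanishing:
  fixes c :: "'a::real_normed_vector \<Rightarrow> real" and N :: "'a \<Rightarrow> 'b::real_normed_vector"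
  assumes c: "isCont c z" and N: "(N has_derivative N') (at z)" and N0: "N z = 0"
  shows "((\<lambda>y. c y *\<^sub>R N y) has_derivative (\<lambda>v. c z *\<^sub>R N' v)) (at z)"
proof -
  obtain K where K: "\<And>v. norm (N' v) \<le> norm v * K"
    using bounded_linear.bounded[OF has_derivative_bounded_linear[OF N]] by blast
  define err where "err y = norm (N y - N z - N' (y - z)) / norm (y - z)" for y
  have err: "(err \<longlongrightarrow> 0) (at z)"
    using N unfolding has_derivative_iff_norm err_def by simp
  have "((\<lambda>y. \<bar>c y - c z\<bar> * (err y + K)) \<longlongrightarrow> \<bar>c z - c z\<bar> * (0 + K)) (at z)"
    using c err by (intro tendsto_intros) (auto simp: isCont_def)
  then have lim: "((\<lambda>y. \<bar>c y - c z\<bar> * (err y + K)) \<longlongrightarrow> 0) (at z)" by simp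
  have "((\<lambda>y. norm ((c y - c z) *\<^sub>R N y) / norm (y - z)) \<longlongrightarrow> 0) (at z)"
  proof (rule tendsto_sandwich[OF _ _ tendsto_const lim])
    show "\<forall>\<^sub>F y in at z. norm ((c y - c z) *\<^sub>R N y) / norm (y - z) \<le> \<bar>c y - c z\<bar> * (err y + K)"
      unfolding eventually_at_filter
    proof (intro always_eventually allI impI)
      fix y assume "y \<noteq> z"
      have "norm (N y) \<le> norm (N y - N z - N' (y - z)) + norm (N' (y - z))"
        using norm_triangle_ineq[of "N y - N' (y - z)" "N' (y - z)"] by (simp add: N0)
      also have "\<dots> \<le> (err y + K) * norm (y - z)"
        using K[of "y - z"] \<open>y \<noteq> z\<close> by (simp add: err_def field_simps)
      finally have "\<bar>c y - c z\<bar> * norm (N y) \<le> \<bar>c y - c z\<bar> * ((err y + K) * norm (y - z))"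
        by (intro mult_left_mono) auto
      then show "norm ((c y - c z) *\<^sub>R N y) / norm (y - z) \<le> \<bar>c y - c z\<bar> * (err y + K)"
        using \<open>y \<noteq> z\<close> by (simp add: divide_le_eq mult.assoc)
    qed
  qed auto
  then have 1: "((\<lambda>y. (c y - c z) *\<^sub>R N y) has_derivative (\<lambda>v. 0)) (at z)"
    by (simp add: has_derivative_iff_norm)
  have "((\<lambda>y. c z *\<^sub>R N y + (c y - c z) *\<^sub>R N y) has_derivative (\<lambda>v. c z *\<^sub>R N' v + 0)) (at z)"
    by (rule has_derivative_add[OF has_derivative_scaleR_right[OF N] 1])
  then show ?thesis by (simp add: scaleR_left_diff_distrib)
qed

text \<open>The family will be the Gram matrices of a non-degenerate two-form in a coordinate frame.
  Smoothness is asked of the images of basis vectors, that is, of the matrix columns. The unknown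
  \<open>W\<close> is no parameter of the locale, since the induction on the order of
  differentiability replaces it by its own derivatives.\<close>

locale smooth_linear_system =
  fixes S :: "'a::real_normed_vector set"
    and L :: "'a \<Rightarrow> 'e::euclidean_space \<Rightarrow> 'g::euclidean_space"
  assumes S: "open S"
    and linear_L: "z \<in> S \<Longrightarrow> linear (L z)"
    and inj_L: "z \<in> S \<Longrightarrow> inj (L z)"
    and smooth_L: "b \<in> Basis \<Longrightarrow> smooth_on S (\<lambda>z. L z b)"
begin

text \<open>If \<open>M\<close> is a left inverse of \<open>L z0\<close> and \<open>L z (W z) = h z\<close>, then \<open>W = M h\<close> up to terms whose factors
  \<open>M (L z b - L z0 b)\<close> vanish at \<open>z0\<close>. Continuity and differentiability of \<open>W\<close> at \<open>z0\<close> follow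
  without inverting \<open>L\<close> at other points.\<close>

lemma solution_expansion:
  assumes "z0 \<in> S"
  obtains M where "bounded_linear M"
    "\<And>W z. z \<in> S \<Longrightarrow>
      W z = M (L z (W z)) - (\<Sum>b\<in>Basis. (W z \<bullet> b) *\<^sub>R M (L z b - L z0 b))"
proof -
  obtain M where M: "linear M" "M \<circ> L z0 = id"
    using linear_injective_left_inverse[OF linear_L inj_L] assms by blast
  have "W z = M (L z (W z)) - (\<Sum>b\<in>Basis. (W z \<bullet> b) *\<^sub>R M (L z b - L z0 b))" if "z \<in> S" for W z
  proof -
    have "(\<Sum>b\<in>Basis. (W z \<bullet> b) *\<^sub>R M (L z b - L z0 b)) = M (L z (W z)) - M (L z0 (W z))"
      unfolding linear_expand[OF linear_L[OF that], of "W z"]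
        linear_expand[OF linear_L[OF assms], of "W z"]
      by (simp add: linear_sum[OF M(1)] linear_cmul[OF M(1)] linear_diff[OF M(1)]
          scaleR_diff_right sum_subtractf)
    then show ?thesis using M(2) by (simp add: fun_eq_iff)
  qed
  then show ?thesis using that[of M] M(1) linear_conv_bounded_linear by blast
qed

lemma isCont_L: "b \<in> Basis \<Longrightarrow> z \<in> S \<Longrightarrow> isCont (\<lambda>z. L z b) z"
  using smooth_on_continuous[OF smooth_L] S continuous_on_eq_continuous_at by blast

text \<open>Nothing bounds \<open>W\<close> near \<open>z0\<close> at the outset. The deviation of
  \<open>W\<close> from the continuous map \<open>h'\<close> is at most
  \<open>norm (W z) * e z\<close> with \<open>e\<close> tending to 0; once \<open>e z < 1/2\<close>
  this is absorbed into the left-hand side and gives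
  \<open>norm (W z) \<le> 2 * norm (h' z)\<close>. Then the deviation itself tends to 0.\<close>

lemma solution_continuous:
  assumes z0: "z0 \<in> S" and h: "isCont (\<lambda>z. L z (W z)) z0"
  shows "isCont W z0"
proof -
  obtain M where M: "bounded_linear M"
    "\<And>z. z \<in> S \<Longrightarrow>
      W z = M (L z (W z)) - (\<Sum>b\<in>Basis. (W z \<bullet> b) *\<^sub>R M (L z b - L z0 b))"
    using solution_expansion[OF z0] by metis
  define h' where "h' z = M (L z (W z))" for z
  define e where "e z = (\<Sum>b\<in>Basis. norm (M (L z b - L z0 b)))" for z
  have h': "(h' \<longlongrightarrow> h' z0) (at z0)"
    using bounded_linear.tendsto[OF M(1)] h by (simp add: h'_def[abs_def] isCont_def)
  have "((\<lambda>z. M (L z b - L z0 b)) \<longlongrightarrow> M (L z0 b - L z0 b)) (at z0)" if "b \<in> Basis" for b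
    using isCont_L[OF that z0] unfolding isCont_def
    by (intro bounded_linear.tendsto[OF M(1)] tendsto_intros)
  then have "(e \<longlongrightarrow> (\<Sum>b\<in>(Basis::'e set). norm (M (L z0 b - L z0 b)))) (at z0)"
    unfolding e_def[abs_def] by (intro tendsto_intros)
  then have e: "(e \<longlongrightarrow> 0) (at z0)"
    by (simp add: linear_0[OF bounded_linear.linear[OF M(1)]])
  have W0: "W z0 = h' z0"
    using M(2)[OF z0] by (simp add: h'_def linear_0[OF bounded_linear.linear[OF M(1)]])
  have W_e: "norm (W z - h' z) \<le> norm (W z) * e z" if "z \<in> S" for z
  proof -
    have "norm (W z - h' z) = norm (\<Sum>b\<in>Basis. (W z \<bullet> b) *\<^sub>R M (L z b - L z0 b))"
      by (subst M(2)[OF that]) (simp add: h'_def norm_minus_commute)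
    also have "\<dots> \<le> (\<Sum>b\<in>Basis. norm ((W z \<bullet> b) *\<^sub>R M (L z b - L z0 b)))"
      by (rule norm_sum)
    also have "\<dots> \<le> (\<Sum>b\<in>Basis. norm (W z) * norm (M (L z b - L z0 b)))"
      by (intro sum_mono) (auto intro!: mult_right_mono Basis_le_norm)
    finally show ?thesis by (simp add: e_def sum_distrib_left)
  qed
  have ev: "\<forall>\<^sub>F z in at z0. z \<in> S \<and> e z < 1/2"
    using eventually_conj[OF eventually_at_in_open'[OF S z0] order_tendstoD(2)[OF e, of "1/2"]] by simp
  have bd: "norm (W z - W z0) \<le> norm (h' z - h' z0) + 2 * norm (h' z) * e z"
    if z: "z \<in> S" "e z < 1/2" for z
  proof -
    have e0: "e z \<ge> 0" by (auto simp: e_def intro: sum_nonneg)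
    have "norm (W z) \<le> norm (h' z) + norm (W z - h' z)"
      using norm_triangle_ineq[of "h' z" "W z - h' z"] by simp
    moreover have "norm (W z) * e z \<le> norm (W z) * (1/2)"
      using z by (intro mult_left_mono) auto
    ultimately have "norm (W z) \<le> 2 * norm (h' z)" using W_e[OF z(1)] by linarith
    then have "norm (W z) * e z \<le> 2 * norm (h' z) * e z" by (rule mult_right_mono[OF _ e0])
    moreover have "norm (W z - W z0) \<le> norm (h' z - h' z0) + norm (W z - h' z)"
      using norm_triangle_ineq[of "h' z - h' z0" "W z - h' z"] by (simp add: W0)
    ultimately show ?thesis using W_e[OF z(1)] by linarith
  qed
  have lim: "((\<lambda>z. norm (h' z - h' z0) + 2 * norm (h' z) * e z)
      \<longlongrightarrow> norm (h' z0 - h' z0) + 2 * norm (h' z0) * 0) (at z0)"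
    by (intro tendsto_intros h' e)
  have "((\<lambda>z. norm (W z - W z0)) \<longlongrightarrow> 0) (at z0)"
  proof (rule tendsto_sandwich[OF _ _ tendsto_const])
    show "\<forall>\<^sub>F z in at z0. norm (W z - W z0) \<le> norm (h' z - h' z0) + 2 * norm (h' z) * e z"
      by (rule eventually_mono[OF ev]) (use bd in blast)
    show "((\<lambda>z. norm (h' z - h' z0) + 2 * norm (h' z) * e z) \<longlongrightarrow> 0) (at z0)"
      using lim by simp
  qed simp
  then show ?thesis
    unfolding isCont_def by (simp add: LIM_zero_iff tendsto_norm_zero_iff)
qed

text \<open>In the expansion at \<open>z0\<close> the unknown components
  \<open>W z \<bullet> b\<close> are continuous and multiply terms vanishing at \<open>z0\<close>,
  exactly the situation of \<open>has_derivative_scaleR_vanishing\<close>.\<close>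

lemma solution_differentiable:
  assumes z0: "z0 \<in> S" and h: "(\<lambda>z. L z (W z)) differentiable (at z0)"
  shows "W differentiable (at z0)"
proof -
  obtain M where M: "bounded_linear M"
    "\<And>z. z \<in> S \<Longrightarrow>
      W z = M (L z (W z)) - (\<Sum>b\<in>Basis. (W z \<bullet> b) *\<^sub>R M (L z b - L z0 b))"
    using solution_expansion[OF z0] by metis
  have cont: "isCont W z0"
    using solution_continuous[OF z0] h differentiable_imp_continuous_within by blast
  have "(\<lambda>z. (W z \<bullet> b) *\<^sub>R M (L z b - L z0 b)) differentiable (at z0)" if b: "b \<in> Basis" for b
  proof -
    have "(\<lambda>z. L z b) differentiable (at z0)"
      using smooth_on_differentiable[OF smooth_L[OF b] S z0] .
    then obtain N where "((\<lambda>z. L z b) has_derivative N) (at z0)"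
      by (auto simp: differentiable_def)
    then have "((\<lambda>z. L z b - L z0 b) has_derivative N) (at z0)"
      by (auto intro!: derivative_eq_intros)
    from bounded_linear.has_derivative[OF M(1) this]
    have "((\<lambda>z. M (L z b - L z0 b)) has_derivative (\<lambda>v. M (N v))) (at z0)" .
    from has_derivative_scaleR_vanishing[OF _ this, of "\<lambda>z. W z \<bullet> b"] cont
    show ?thesis
      unfolding differentiable_def
      by (force simp: linear_0[OF bounded_linear.linear[OF M(1)]] intro: continuous_intros)
  qed
  moreover have "(\<lambda>z. M (L z (W z))) differentiable (at z0)"
    using bounded_linear.has_derivative[OF M(1) has_fderiv[OF h]] by (auto simp: differentiable_def)
  ultimately have "(\<lambda>z. M (L z (W z)) - (\<Sum>b\<in>Basis. (W z \<bullet> b) *\<^sub>R M (L z b - L z0 b)))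
      differentiable (at z0)"
    by (intro differentiable_diff differentiable_sum) auto
  then show ?thesis
    using differentiable_cong_open[of S z0 W, OF S z0 M(2)] by blast
qed

text \<open>Differentiating \<open>L W = h\<close> shows that \<open>W' = \<partial>\<^sub>v W\<close> solves \<open>L W' = \<partial>\<^sub>v h - (\<partial>\<^sub>v L) W\<close>, a system of the same
  form.\<close>

lemma Ck_on_solution:
  assumes "Ck_on k S (\<lambda>z. L z (W z))"
  shows "Ck_on k S W"
  using assms
proof (induction k arbitrary: W)
  case 0
  then show ?case
    by (simp add: continuous_on_eq_continuous_at[OF S] solution_continuous)
next
  case (Suc k)
  \<comment> \<open>The differentiated system has \<open>W\<close> itself on its right-hand side, so
    the lower regularity of \<open>W\<close> is secured first.\<close>
  have W: "Ck_on k S W" using Suc.IH Ck_on_Suc[OF Suc.prems] .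
  have d: "W differentiable (at z)" if "z \<in> S" for z
    using Suc.prems that solution_differentiable
    by (simp add: differentiable_on_eq_differentiable_at[OF S])
  have "Ck_on k S (\<lambda>z. fderiv W z v)" for v
  proof (rule Suc.IH)
    have eq: "L z (fderiv W z v) = fderiv (\<lambda>z. L z (W z)) z v
        + - (\<Sum>b\<in>Basis. (W z \<bullet> b) *\<^sub>R fderiv (\<lambda>z. L z b) z v)" if z: "z \<in> S" for z
    proof -
      have dL: "(\<lambda>z. L z b) differentiable (at z)" if "b \<in> Basis" for b
        using smooth_on_differentiable[OF smooth_L[OF that] S z] .
      have dW: "(\<lambda>z. W z \<bullet> b) differentiable (at z)" for b
        using d[OF z] by (intro differentiable_inner) auto
      have "fderiv (\<lambda>z. L z (W z)) z v = fderiv (\<lambda>z. \<Sum>b\<in>Basis. (W z \<bullet> b) *\<^sub>R L z b) z v"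
        by (rule fun_cong[OF fderiv_cong_open[OF S z]]) (rule linear_expand[OF linear_L])
      also have "\<dots> = (\<Sum>b\<in>Basis. (W z \<bullet> b) *\<^sub>R fderiv (\<lambda>z. L z b) z v
          + fderiv (\<lambda>z. W z \<bullet> b) z v *\<^sub>R L z b)"
        by (subst fderiv_sum)
           (auto intro!: differentiable_scaleR dL dW sum.cong fderiv_bilinear bounded_bilinear_scaleR)
      also have "\<dots> = (\<Sum>b\<in>Basis. (W z \<bullet> b) *\<^sub>R fderiv (\<lambda>z. L z b) z v) + L z (fderiv W z v)"
        using linear_expand[OF linear_L[OF z], of "fderiv W z v", symmetric]
        by (simp add: sum.distrib fderiv_linear[OF bounded_linear_inner_left d[OF z]])
      finally show ?thesis by simp
    qed
    have "Ck_on k S (\<lambda>z. fderiv (\<lambda>z. L z (W z)) z v)" using Suc.prems by simp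
    moreover have "Ck_on k S (\<lambda>z. - (\<Sum>b\<in>Basis. (W z \<bullet> b) *\<^sub>R fderiv (\<lambda>z. L z b) z v))"
      using smooth_on_fderiv[OF smooth_L] W
      by (intro Ck_on_linear[OF bounded_linear_minus[OF bounded_linear_ident] S] Ck_on_sum[OF S]
          Ck_on_bilinear[OF bounded_bilinear_scaleR S] Ck_on_linear[OF bounded_linear_inner_left S])
         (auto simp: smooth_on_def)
    ultimately have "Ck_on k S (\<lambda>z. fderiv (\<lambda>z. L z (W z)) z v
        + - (\<Sum>b\<in>Basis. (W z \<bullet> b) *\<^sub>R fderiv (\<lambda>z. L z b) z v))"
      by (rule Ck_on_add[OF S])
    then show "Ck_on k S (\<lambda>z. L z (fderiv W z v))"
      by (subst Ck_on_cong[OF S eq]) assumption+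
  qed
  moreover have "W differentiable_on S"
    using d by (simp add: differentiable_on_eq_differentiable_at[OF S])
  ultimately show ?case by simp
qed

lemma smooth_on_solution: "smooth_on S (\<lambda>z. L z (W z)) \<Longrightarrow> smooth_on S W"
  by (simp add: smooth_on_def Ck_on_solution)

end

section \<open>Smooth functions and vector fields on a manifold\<close>

text \<open>For values in a fixed vector space, in contrast to \<open>smooth_field\<close>, whose
  values are first converted to the coordinates of a chart. The coordinates of a field in one fixed
  chart are functions of this kind.\<close>

definition smooth_vfun ::
    "('m, 'e::real_normed_vector) atlas \<Rightarrow> 'm set \<Rightarrow> ('m \<Rightarrow> 'b::real_normed_vector) \<Rightarrow> bool" where
  "smooth_vfun \<A> V f \<longleftrightarrow>
     (\<forall>c\<in>\<A>. smooth_on (chart_map c ` (V \<inter> chart_dom c)) (f \<circ> chart_inv c))"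

lemma smooth_fun_eq_vfun: "smooth_fun \<A> V f \<longleftrightarrow> smooth_vfun \<A> V f"
  by (simp add: smooth_fun_def smooth_vfun_def)

locale manifold =
  fixes \<A> :: "('m::{t2_space, second_countable_topology}, 'e::euclidean_space) atlas"
  assumes smooth_manifold: "smooth_manifold \<A>"
begin

lemma open_chart_dom [simp, intro]: "c \<in> \<A> \<Longrightarrow> open (chart_dom c)"
  using smooth_manifold by (simp add: smooth_manifold_def)

lemma chart_homeomorphism:
  "c \<in> \<A> \<Longrightarrow> homeomorphism (chart_dom c) (chart_map c ` chart_dom c) (chart_map c) (chart_inv c)"
  using smooth_manifold by (simp add: smooth_manifold_def)

lemma open_chart_image:
  assumes "c \<in> \<A>" "open W" "W \<subseteq> chart_dom c"
  shows "open (chart_map c ` W)"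
proof -
  have "openin (top_of_set (chart_map c ` chart_dom c)) (chart_map c ` W)"
    using homeomorphism_imp_open_map[OF chart_homeomorphism[OF assms(1)]] assms
      open_openin_trans[OF open_chart_dom[OF assms(1)]] by blast
  moreover have "open (chart_map c ` chart_dom c)"
    using smooth_manifold assms(1) by (simp add: smooth_manifold_def)
  ultimately show ?thesis by (rule openin_open_trans)
qed

lemma chart_inv_map [simp]: "c \<in> \<A> \<Longrightarrow> p \<in> chart_dom c \<Longrightarrow> chart_inv c (chart_map c p) = p"
  using homeomorphism_apply1[OF chart_homeomorphism] .

lemma smooth_transition:
  assumes "c \<in> \<A>" "d \<in> \<A>" "W \<subseteq> chart_dom c \<inter> chart_dom d"
  shows "smooth_on (chart_map c ` W) (chart_map d \<circ> chart_inv c)"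
  using smooth_manifold assms smooth_on_subset image_mono
  unfolding smooth_manifold_def by metis

lemma chart_at [simp, intro]: "chart_at \<A> p \<in> \<A>" "p \<in> chart_dom (chart_at \<A> p)"
proof -
  have "\<exists>c. c \<in> \<A> \<and> p \<in> chart_dom c"
    using smooth_manifold unfolding smooth_manifold_def by blast
  from someI_ex[OF this] show "chart_at \<A> p \<in> \<A>" "p \<in> chart_dom (chart_at \<A> p)"
    unfolding chart_at_def by simp_all
qed

lemma transition_differentiable:
  assumes "c \<in> \<A>" "d \<in> \<A>" "p \<in> chart_dom c" "p \<in> chart_dom d"
  shows "(chart_map d \<circ> chart_inv c) differentiable (at (chart_map c p))"
  using assms
  by (intro smooth_on_differentiable[OF smooth_transition[OF assms(1,2) subset_refl]]
      open_chart_image) auto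

lemma linear_transition_deriv:
  assumes "c \<in> \<A>" "d \<in> \<A>" "p \<in> chart_dom c" "p \<in> chart_dom d"
  shows "linear (transition_deriv c d p)"
  unfolding transition_deriv_def
  by (intro linear_frechet_derivative transition_differentiable assms)

text \<open>The chain rule on the triple overlap. From this cocycle rule and
  \<open>transition_deriv_refl\<close> follow the relations between \<open>coords\<close> and
  \<open>of_coords\<close>, which both pass through the preferred chart.\<close>

lemma transition_deriv_comp:
  assumes "c \<in> \<A>" "d \<in> \<A>" "e \<in> \<A>" "p \<in> chart_dom c" "p \<in> chart_dom d" "p \<in> chart_dom e"
  shows "transition_deriv d e p (transition_deriv c d p v) = transition_deriv c e p v"
proof -
  define W where "W = chart_dom c \<inter> chart_dom d \<inter> chart_dom e"
  have W: "open (chart_map c ` W)" "chart_map c p \<in> chart_map c ` W"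
    using assms by (auto simp: W_def intro!: open_chart_image)
  let ?f = "chart_map d \<circ> chart_inv c" and ?g = "chart_map e \<circ> chart_inv d"
  have "fderiv (\<lambda>z. ?g (?f z)) (chart_map c p) v = fderiv ?g (?f (chart_map c p)) (fderiv ?f (chart_map c p) v)"
    using assms transition_differentiable[of d e p]
    by (intro fderiv_chain[of ?f _ ?g] transition_differentiable) simp_all
  moreover have "fderiv (\<lambda>z. ?g (?f z)) (chart_map c p) = fderiv (chart_map e \<circ> chart_inv c) (chart_map c p)"
    using assms by (intro fderiv_cong_open[OF W]) (auto simp: W_def chart_inv_map)
  ultimately show ?thesis
    using assms by (simp add: transition_deriv_def chart_inv_map)
qed

lemma transition_deriv_refl:
  assumes "c \<in> \<A>" "p \<in> chart_dom c"
  shows "transition_deriv c c p v = v"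
proof -
  have "fderiv (chart_map c \<circ> chart_inv c) (chart_map c p) = fderiv (\<lambda>z. z) (chart_map c p)"
    using assms
    by (intro fderiv_cong_open[OF open_chart_image[OF assms(1) _ subset_refl]])
       (auto simp: chart_inv_map)
  then show ?thesis by (simp add: transition_deriv_def)
qed

lemma linear_coords: "c \<in> \<A> \<Longrightarrow> p \<in> chart_dom c \<Longrightarrow> linear (coords \<A> c p)"
  unfolding coords_def[abs_def] using linear_transition_deriv chart_at by blast

lemma linear_of_coords: "c \<in> \<A> \<Longrightarrow> p \<in> chart_dom c \<Longrightarrow> linear (of_coords \<A> c p)"
  unfolding of_coords_def[abs_def] using linear_transition_deriv chart_at by blast

lemma coords_chart_at [simp]: "coords \<A> (chart_at \<A> p) p v = v"
  by (simp add: coords_def transition_deriv_refl chart_at)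

lemma of_coords_chart_at [simp]: "of_coords \<A> (chart_at \<A> p) p v = v"
  by (simp add: of_coords_def transition_deriv_refl chart_at)

lemma const_field_self [simp]: "const_field \<A> p u p = u"
  by (simp add: const_field_def)

lemma coords_of_coords:
  "c \<in> \<A> \<Longrightarrow> d \<in> \<A> \<Longrightarrow> p \<in> chart_dom c \<Longrightarrow> p \<in> chart_dom d \<Longrightarrow>
    coords \<A> d p (of_coords \<A> c p u) = transition_deriv c d p u"
  by (simp add: coords_def of_coords_def transition_deriv_comp chart_at)

lemma coords_of_coords_same [simp]:
  "c \<in> \<A> \<Longrightarrow> p \<in> chart_dom c \<Longrightarrow> coords \<A> c p (of_coords \<A> c p u) = u"
  by (simp add: coords_of_coords transition_deriv_refl)

lemma of_coords_coords [simp]: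
  "c \<in> \<A> \<Longrightarrow> p \<in> chart_dom c \<Longrightarrow> of_coords \<A> c p (coords \<A> c p v) = v"
  by (simp add: coords_def of_coords_def transition_deriv_comp transition_deriv_refl chart_at)

lemma transition_deriv_coords:
  "c \<in> \<A> \<Longrightarrow> d \<in> \<A> \<Longrightarrow> p \<in> chart_dom c \<Longrightarrow> p \<in> chart_dom d \<Longrightarrow>
    transition_deriv c d p (coords \<A> c p v) = coords \<A> d p v"
  by (simp add: coords_def transition_deriv_comp chart_at)

lemma frame_expansion:
  assumes "c \<in> \<A>" "p \<in> chart_dom c"
  shows "v = (\<Sum>b\<in>Basis. (coords \<A> c p v \<bullet> b) *\<^sub>R of_coords \<A> c p b)"
  using linear_expand[OF linear_of_coords[OF assms], of "coords \<A> c p v"] assms by simp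

lemma smooth_on_chart_change:
  assumes c: "c \<in> \<A>" "d \<in> \<A>" and W: "open W" "W \<subseteq> chart_dom c" "W \<subseteq> chart_dom d"
    and f: "smooth_on (chart_map c ` W) (f \<circ> chart_inv c)"
  shows "smooth_on (chart_map d ` W) (f \<circ> chart_inv d)"
proof -
  let ?t = "chart_map c \<circ> chart_inv d"
  have o: "open (chart_map c ` W)" "open (chart_map d ` W)"
    using assms by (auto intro: open_chart_image)
  have "smooth_on (chart_map d ` W) (\<lambda>z. (f \<circ> chart_inv c) (?t z))"
    using W c by (intro smooth_on_compose[OF o(2,1) _ _ f] smooth_transition)
      (auto simp: chart_inv_map subset_iff)
  then show ?thesis
    by (subst smooth_on_cong[OF o(2), where g = "\<lambda>z. (f \<circ> chart_inv c) (?t z)"])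
       (use W c in \<open>auto simp: chart_inv_map subset_iff\<close>)
qed

text \<open>The definition tests all charts, but their smooth compatibility makes one chart near
  each point enough. This permits choosing the chart preferred at the point under
  consideration.\<close>

lemma smooth_vfun_local:
  assumes "\<And>p. p \<in> V \<Longrightarrow> \<exists>c\<in>\<A>. \<exists>W. open W \<and> p \<in> W \<and> W \<subseteq> chart_dom c \<and>
    smooth_on (chart_map c ` W) (f \<circ> chart_inv c)"
  shows "smooth_vfun \<A> V f"
  unfolding smooth_vfun_def
proof (intro ballI smooth_on_local)
  fix d z assume d: "d \<in> \<A>" "z \<in> chart_map d ` (V \<inter> chart_dom d)"
  then obtain p where p: "p \<in> V" "p \<in> chart_dom d" "z = chart_map d p" by auto
  obtain c W where c: "c \<in> \<A>" "open W" "p \<in> W" "W \<subseteq> chart_dom c"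
    "smooth_on (chart_map c ` W) (f \<circ> chart_inv c)"
    using assms[OF p(1)] by blast
  let ?W = "W \<inter> chart_dom d"
  have "smooth_on (chart_map d ` ?W) (f \<circ> chart_inv d)"
    using c d smooth_on_subset[OF c(5), of "chart_map c ` ?W"]
    by (intro smooth_on_chart_change[of c d]) auto
  moreover have "open (chart_map d ` ?W)"
    using c d by (intro open_chart_image) auto
  ultimately show "\<exists>T. open T \<and> z \<in> T \<and> smooth_on T (f \<circ> chart_inv d)"
    using p c by blast
qed

lemma smooth_vfun_chart:
  assumes "smooth_vfun \<A> V f" "c \<in> \<A>" "W \<subseteq> V" "W \<subseteq> chart_dom c"
  shows "smooth_on (chart_map c ` W) (f \<circ> chart_inv c)"
  using assms smooth_on_subset[of "chart_map c ` (V \<inter> chart_dom c)" _ "chart_map c ` W"]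
  unfolding smooth_vfun_def by blast

lemma smooth_vfun_locally:
  assumes "\<And>p. p \<in> V \<Longrightarrow> \<exists>W. open W \<and> p \<in> W \<and> smooth_vfun \<A> W f"
  shows "smooth_vfun \<A> V f"
proof (rule smooth_vfun_local)
  fix p assume "p \<in> V"
  then obtain W where W: "open W" "p \<in> W" "smooth_vfun \<A> W f" using assms by blast
  let ?c = "chart_at \<A> p"
  show "\<exists>c\<in>\<A>. \<exists>W. open W \<and> p \<in> W \<and> W \<subseteq> chart_dom c \<and> smooth_on (chart_map c ` W) (f \<circ> chart_inv c)"
    using W
    by (intro bexI[of _ ?c] exI[of _ "W \<inter> chart_dom ?c"]) (auto intro: smooth_vfun_chart)
qed

lemma smooth_vfun_single_chart:
  assumes "c \<in> \<A>" "open V" "V \<subseteq> chart_dom c"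
  shows "smooth_vfun \<A> V f \<longleftrightarrow> smooth_on (chart_map c ` V) (f \<circ> chart_inv c)"
  using assms smooth_vfun_chart[of V f c V] smooth_vfun_local[of V f] by blast

lemma smooth_vfun_subset: "smooth_vfun \<A> V f \<Longrightarrow> W \<subseteq> V \<Longrightarrow> smooth_vfun \<A> W f"
  unfolding smooth_vfun_def by (blast intro: smooth_on_subset)

lemma open_inter_image: "open V \<Longrightarrow> c \<in> \<A> \<Longrightarrow> open (chart_map c ` (V \<inter> chart_dom c))"
  by (auto intro: open_chart_image open_chart_dom)

lemma smooth_vfun_cong:
  assumes "open V" "\<And>p. p \<in> V \<Longrightarrow> f p = g p"
  shows "smooth_vfun \<A> V f \<longleftrightarrow> smooth_vfun \<A> V g"
proof -
  have "smooth_on (chart_map c ` (V \<inter> chart_dom c)) (f \<circ> chart_inv c) \<longleftrightarrow>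
      smooth_on (chart_map c ` (V \<inter> chart_dom c)) (g \<circ> chart_inv c)" if "c \<in> \<A>" for c
    using that by (intro smooth_on_cong open_inter_image assms(1)) (auto simp: assms(2))
  then show ?thesis by (simp add: smooth_vfun_def)
qed

lemma smooth_vfun_congI:
  "open V \<Longrightarrow> smooth_vfun \<A> V g \<Longrightarrow> (\<And>p. p \<in> V \<Longrightarrow> f p = g p) \<Longrightarrow> smooth_vfun \<A> V f"
  using smooth_vfun_cong[of V f g] by blast

lemma smooth_vfun_const: "smooth_vfun \<A> V (\<lambda>p. k)"
  by (simp add: smooth_vfun_def o_def smooth_on_const)

lemma smooth_vfun_linear:
  assumes "bounded_linear h" "open V" "smooth_vfun \<A> V f"
  shows "smooth_vfun \<A> V (\<lambda>p. h (f p))"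
  using assms(3) smooth_on_linear[OF assms(1) open_inter_image[OF assms(2)]]
  unfolding smooth_vfun_def o_def by blast

lemma smooth_vfun_add:
  assumes "open V" "smooth_vfun \<A> V f" "smooth_vfun \<A> V g"
  shows "smooth_vfun \<A> V (\<lambda>p. f p + g p)"
  using assms(2,3) smooth_on_add[OF open_inter_image[OF assms(1)]]
  unfolding smooth_vfun_def o_def by blast

lemma smooth_vfun_bilinear:
  assumes "bounded_bilinear b" "open V" "smooth_vfun \<A> V f" "smooth_vfun \<A> V g"
  shows "smooth_vfun \<A> V (\<lambda>p. b (f p) (g p))"
  using assms(3,4) smooth_on_bilinear[OF assms(1) open_inter_image[OF assms(2)]]
  unfolding smooth_vfun_def o_def by blast

lemmas smooth_vfun_scaleR = smooth_vfun_bilinear[OF bounded_bilinear_scaleR]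
lemmas smooth_vfun_inner = smooth_vfun_linear[OF bounded_linear_inner_left]

lemma smooth_vfun_diff:
  assumes "open V" "smooth_vfun \<A> V f" "smooth_vfun \<A> V g"
  shows "smooth_vfun \<A> V (\<lambda>p. f p - g p)"
  using smooth_vfun_add[OF assms(1,2)
      smooth_vfun_linear[OF bounded_linear_minus[OF bounded_linear_ident] assms(1,3)]] by simp

lemma smooth_vfun_sum:
  assumes "open V" "\<And>i. i \<in> I \<Longrightarrow> smooth_vfun \<A> V (f i)"
  shows "smooth_vfun \<A> V (\<lambda>p. \<Sum>i\<in>I. f i p)"
  using assms(2)
proof (induction I rule: infinite_finite_induct)
  case (insert i I)
  then show ?case using smooth_vfun_add[OF assms(1)] by auto
qed (simp_all add: smooth_vfun_const)

lemma smooth_vfun_differentiable: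
  assumes "smooth_vfun \<A> V f" "open V" "p \<in> V" "c \<in> \<A>" "p \<in> chart_dom c"
  shows "(f \<circ> chart_inv c) differentiable (at (chart_map c p))"
  using assms open_inter_image
  by (intro smooth_on_differentiable[OF smooth_vfun_chart[OF assms(1,4), of "V \<inter> chart_dom c"]]) auto

text \<open>The derivative of the transition map turns the preferred coordinates of \<open>v\<close>
  into its coordinates in \<open>c\<close>, and the chain rule does the same to \<open>f\<close>.
  Since the preferred chart changes with \<open>p\<close>, only a formula in a fixed
  \<open>c\<close> shows how the derivative depends on \<open>p\<close>.\<close>

lemma dir_deriv_chart:
  assumes f: "smooth_vfun \<A> V f" "open V" "p \<in> V" and c: "c \<in> \<A>" "p \<in> chart_dom c"
  shows "dir_deriv \<A> f p v = fderiv (f \<circ> chart_inv c) (chart_map c p) (coords \<A> c p v)"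
proof -
  let ?a = "chart_at \<A> p" and ?W = "chart_dom (chart_at \<A> p) \<inter> chart_dom c"
  have W: "open (chart_map ?a ` ?W)" "chart_map ?a p \<in> chart_map ?a ` ?W"
    using c by (auto intro!: open_chart_image)
  let ?g = "f \<circ> chart_inv c" and ?t = "chart_map c \<circ> chart_inv ?a"
  have "fderiv (f \<circ> chart_inv ?a) (chart_map ?a p) = fderiv (\<lambda>z. ?g (?t z)) (chart_map ?a p)"
    using c by (intro fderiv_cong_open[OF W]) (auto simp: chart_inv_map)
  moreover have "fderiv (\<lambda>z. ?g (?t z)) (chart_map ?a p) v
      = fderiv ?g (?t (chart_map ?a p)) (fderiv ?t (chart_map ?a p) v)"
    using c smooth_vfun_differentiable[OF f c]
    by (intro fderiv_chain[of ?t _ ?g] transition_differentiable) simp_all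
  ultimately show ?thesis
    using chart_at by (simp add: dir_deriv_def coords_def transition_deriv_def chart_inv_map)
qed

lemma dir_deriv_cong:
  assumes "open V" "p \<in> V" "\<And>q. q \<in> V \<Longrightarrow> f q = g q"
  shows "dir_deriv \<A> f p v = dir_deriv \<A> g p v"
proof -
  let ?c = "chart_at \<A> p"
  have "open (chart_map ?c ` (V \<inter> chart_dom ?c))" "chart_map ?c p \<in> chart_map ?c ` (V \<inter> chart_dom ?c)"
    using assms(1,2) by (auto intro: open_inter_image)
  then have "fderiv (f \<circ> chart_inv ?c) (chart_map ?c p) = fderiv (g \<circ> chart_inv ?c) (chart_map ?c p)"
    by (rule fderiv_cong_open) (use assms(3) in auto)
  then show ?thesis by (simp add: dir_deriv_def)
qed

lemma dir_deriv_const [simp]: "dir_deriv \<A> (\<lambda>q. k) p v = 0"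
  by (simp add: dir_deriv_def o_def)

section \<open>Sum, product and linearity rules for directional derivatives\<close>

context
  fixes V :: "'m set" and p :: 'm
  assumes V: "open V" "p \<in> V"
begin

lemma dir_deriv_linear_dir:
  assumes "smooth_vfun \<A> V f"
  shows "linear (dir_deriv \<A> f p)"
  unfolding dir_deriv_def[abs_def]
  by (intro linear_frechet_derivative smooth_vfun_differentiable[OF assms V] chart_at)

lemma dir_deriv_add:
  assumes "smooth_vfun \<A> V f" "smooth_vfun \<A> V g"
  shows "dir_deriv \<A> (\<lambda>q. f q + g q) p v = dir_deriv \<A> f p v + dir_deriv \<A> g p v"
  using fderiv_add[OF smooth_vfun_differentiable[OF assms(1) V chart_at]
      smooth_vfun_differentiable[OF assms(2) V chart_at]]
  by (simp add: dir_deriv_def o_def)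

lemma dir_deriv_linear:
  assumes "bounded_linear h" "smooth_vfun \<A> V f"
  shows "dir_deriv \<A> (\<lambda>q. h (f q)) p v = h (dir_deriv \<A> f p v)"
  using fderiv_linear[OF assms(1) smooth_vfun_differentiable[OF assms(2) V chart_at]]
  by (simp add: dir_deriv_def o_def)

lemma dir_deriv_bilinear:
  assumes "bounded_bilinear b" "smooth_vfun \<A> V f" "smooth_vfun \<A> V g"
  shows "dir_deriv \<A> (\<lambda>q. b (f q) (g q)) p v = b (f p) (dir_deriv \<A> g p v) + b (dir_deriv \<A> f p v) (g p)"
  using fderiv_bilinear[OF assms(1) smooth_vfun_differentiable[OF assms(2) V chart_at]
      smooth_vfun_differentiable[OF assms(3) V chart_at]]
  by (simp add: dir_deriv_def o_def chart_inv_map[OF chart_at])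

lemma dir_deriv_sum:
  assumes "\<And>i. i \<in> I \<Longrightarrow> smooth_vfun \<A> V (f i)"
  shows "dir_deriv \<A> (\<lambda>q. \<Sum>i\<in>I. f i q) p v = (\<Sum>i\<in>I. dir_deriv \<A> (f i) p v)"
  using fderiv_sum[OF smooth_vfun_differentiable[OF assms V chart_at], of I "\<lambda>i. i"]
  by (simp add: dir_deriv_def o_def)

lemmas dir_deriv_scaleR = dir_deriv_bilinear[OF bounded_bilinear_scaleR]
lemmas dir_deriv_mult = dir_deriv_bilinear[OF bounded_bilinear_mult]
lemmas dir_deriv_inner = dir_deriv_linear[OF bounded_linear_inner_left]

end

section \<open>Smooth vector fields in charts\<close>

lemma smooth_field_iff:
  assumes "open V"
  shows "smooth_field \<A> V X \<longleftrightarrow> (\<forall>c\<in>\<A>. smooth_vfun \<A> (V \<inter> chart_dom c) (\<lambda>q. coords \<A> c q (X q)))"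
  unfolding smooth_field_def
  using assms by (simp add: smooth_vfun_single_chart open_Int open_chart_dom field_in_chart_def[abs_def] o_def)

lemma smooth_field_coords:
  assumes "smooth_field \<A> V X" "open V" "c \<in> \<A>" "W \<subseteq> V" "W \<subseteq> chart_dom c"
  shows "smooth_vfun \<A> W (\<lambda>q. coords \<A> c q (X q))"
  using assms smooth_field_iff smooth_vfun_subset by (metis Int_subset_iff)

lemma smooth_field_local:
  assumes V: "open V" and X: "\<And>p. p \<in> V \<Longrightarrow> \<exists>c\<in>\<A>. \<exists>W. open W \<and> p \<in> W \<and> W \<subseteq> chart_dom c \<and>
    smooth_vfun \<A> W (\<lambda>q. coords \<A> c q (X q))"
  shows "smooth_field \<A> V X"
  unfolding smooth_field_iff[OF V]
proof (intro ballI smooth_vfun_local)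
  fix d p assume d: "d \<in> \<A>" "p \<in> V \<inter> chart_dom d"
  then obtain c W' where c: "c \<in> \<A>" "open W'" "p \<in> W'" "W' \<subseteq> chart_dom c"
    "smooth_vfun \<A> W' (\<lambda>q. coords \<A> c q (X q))"
    using X by blast
  define W where "W = W' \<inter> chart_dom d"
  have W: "open W" "p \<in> W" "W \<subseteq> chart_dom c" "W \<subseteq> chart_dom d"
    using c d by (auto simp: W_def)
  have o: "open (chart_map c ` W)" using W c by (intro open_chart_image)
  let ?x = "(\<lambda>q. coords \<A> c q (X q)) \<circ> chart_inv c"
  \<comment> \<open>The coordinates in \<open>d\<close> are the derivative of the transition map in
    the moving direction given by the coordinates in \<open>c\<close>.\<close>
  have "smooth_on (chart_map c ` W) (\<lambda>z. fderiv (chart_map d \<circ> chart_inv c) z (?x z))"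
    using c d W by (intro smooth_on_fderiv_field o smooth_transition smooth_vfun_chart[OF c(5)])
      (auto simp: W_def)
  then have "smooth_on (chart_map c ` W) ((\<lambda>q. coords \<A> d q (X q)) \<circ> chart_inv c)"
    by (subst smooth_on_cong[OF o, where g = "\<lambda>z. fderiv (chart_map d \<circ> chart_inv c) z (?x z)"])
       (use W c d in \<open>auto simp: chart_inv_map subset_iff transition_deriv_def[symmetric]
          transition_deriv_coords\<close>)
  then show "\<exists>c\<in>\<A>. \<exists>W. open W \<and> p \<in> W \<and> W \<subseteq> chart_dom c \<and>
      smooth_on (chart_map c ` W) ((\<lambda>q. coords \<A> d q (X q)) \<circ> chart_inv c)"
    using W c by blast
qed

lemma smooth_field_subset: "smooth_field \<A> V X \<Longrightarrow> W \<subseteq> V \<Longrightarrow> smooth_field \<A> W X"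
  unfolding smooth_field_def by (blast intro: smooth_on_subset)

lemma smooth_field_cong:
  assumes "open V" "\<And>p. p \<in> V \<Longrightarrow> X p = Y p"
  shows "smooth_field \<A> V X \<longleftrightarrow> smooth_field \<A> V Y"
  unfolding smooth_field_iff[OF assms(1)]
  using assms by (intro ball_cong refl smooth_vfun_cong) (auto intro: open_chart_dom)

lemma smooth_field_congI:
  "open V \<Longrightarrow> smooth_field \<A> V Y \<Longrightarrow> (\<And>p. p \<in> V \<Longrightarrow> X p = Y p) \<Longrightarrow> smooth_field \<A> V X"
  using smooth_field_cong[of V X Y] by blast

lemma smooth_field_const: "c \<in> \<A> \<Longrightarrow> smooth_field \<A> (chart_dom c) (\<lambda>q. of_coords \<A> c q u)"
proof (rule smooth_field_local)
  fix p assume c: "c \<in> \<A>" "p \<in> chart_dom c"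
  then have "smooth_vfun \<A> (chart_dom c) (\<lambda>q. coords \<A> c q (of_coords \<A> c q u))"
    using smooth_vfun_cong[OF open_chart_dom[OF c(1)], of "\<lambda>q. coords \<A> c q (of_coords \<A> c q u)" "\<lambda>q. u"]
    by (simp add: smooth_vfun_const)
  then show "\<exists>d\<in>\<A>. \<exists>W. open W \<and> p \<in> W \<and> W \<subseteq> chart_dom d \<and>
      smooth_vfun \<A> W (\<lambda>q. coords \<A> d q (of_coords \<A> c q u))"
    using c by blast
qed (rule open_chart_dom)

lemma smooth_field_scaleR:
  assumes "open V" "smooth_vfun \<A> V f" "smooth_field \<A> V X"
  shows "smooth_field \<A> V (\<lambda>p. f p *\<^sub>R X p)"
  unfolding smooth_field_iff[OF assms(1)]
proof
  fix c assume c: "c \<in> \<A>"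
  have o: "open (V \<inter> chart_dom c)" using assms(1) open_chart_dom[OF c] by blast
  show "smooth_vfun \<A> (V \<inter> chart_dom c) (\<lambda>q. coords \<A> c q (f q *\<^sub>R X q))"
    using smooth_vfun_scaleR[OF o smooth_vfun_subset[OF assms(2)] smooth_field_coords[OF assms(3,1) c]]
    by (subst smooth_vfun_cong[OF o, where g = "\<lambda>q. f q *\<^sub>R coords \<A> c q (X q)"])
       (auto simp: linear_cmul[OF linear_coords[OF c]])
qed

lemma smooth_field_add:
  assumes "open V" "smooth_field \<A> V X" "smooth_field \<A> V Y"
  shows "smooth_field \<A> V (\<lambda>p. X p + Y p)"
  unfolding smooth_field_iff[OF assms(1)]
proof
  fix c assume c: "c \<in> \<A>"
  have o: "open (V \<inter> chart_dom c)" using assms(1) open_chart_dom[OF c] by blast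
  show "smooth_vfun \<A> (V \<inter> chart_dom c) (\<lambda>q. coords \<A> c q (X q + Y q))"
    using smooth_vfun_add[OF o smooth_field_coords[OF assms(2,1) c] smooth_field_coords[OF assms(3,1) c]]
    by (subst smooth_vfun_cong[OF o, where g = "\<lambda>q. coords \<A> c q (X q) + coords \<A> c q (Y q)"])
       (auto simp: linear_add[OF linear_coords[OF c]])
qed

lemma smooth_field_zero: "open V \<Longrightarrow> smooth_field \<A> V (\<lambda>p. 0)"
  unfolding smooth_field_iff
proof
  fix c assume V: "open V" and c: "c \<in> \<A>"
  have o: "open (V \<inter> chart_dom c)" using V open_chart_dom[OF c] by blast
  show "smooth_vfun \<A> (V \<inter> chart_dom c) (\<lambda>q. coords \<A> c q 0)"
    by (subst smooth_vfun_cong[OF o, where g = "\<lambda>q. 0"])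
       (auto simp: linear_0[OF linear_coords[OF c]] smooth_vfun_const)
qed

lemma smooth_field_sum:
  assumes "open V" "\<And>i. i \<in> I \<Longrightarrow> smooth_field \<A> V (X i)"
  shows "smooth_field \<A> V (\<lambda>p. \<Sum>i\<in>I. X i p)"
  using assms(2)
proof (induction I rule: infinite_finite_induct)
  case (insert i I)
  then show ?case using smooth_field_add[OF assms(1)] by auto
qed (simp_all add: smooth_field_zero[OF assms(1)])

lemma smooth_dir_deriv:
  assumes V: "open V" and f: "smooth_vfun \<A> V f" and X: "smooth_field \<A> V X"
  shows "smooth_vfun \<A> V (\<lambda>p. dir_deriv \<A> f p (X p))"
proof (rule smooth_vfun_local)
  fix p assume p: "p \<in> V"
  let ?c = "chart_at \<A> p"
  define W where "W = V \<inter> chart_dom ?c"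
  have W: "open W" "p \<in> W" "W \<subseteq> V" "W \<subseteq> chart_dom ?c"
    using p V by (auto simp: W_def)
  have o: "open (chart_map ?c ` W)" using W chart_at by (intro open_chart_image)
  let ?x = "(\<lambda>q. coords \<A> ?c q (X q)) \<circ> chart_inv ?c"
  \<comment> \<open>The one chart \<open>?c\<close> computes the derivative at every point of
    \<open>W\<close>, although other points of \<open>W\<close> may prefer other charts.\<close>
  have "smooth_on (chart_map ?c ` W) (\<lambda>z. fderiv (f \<circ> chart_inv ?c) z (?x z))"
    using W by (intro smooth_on_fderiv_field o smooth_vfun_chart[OF f]
        smooth_vfun_chart[OF smooth_field_coords[OF X V chart_at(1) W(3,4)]] chart_at) auto
  then have "smooth_on (chart_map ?c ` W) ((\<lambda>p. dir_deriv \<A> f p (X p)) \<circ> chart_inv ?c)"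
    by (subst smooth_on_cong[OF o, where g = "\<lambda>z. fderiv (f \<circ> chart_inv ?c) z (?x z)"])
       (use W chart_at in \<open>auto simp: chart_inv_map subset_iff dir_deriv_chart[OF f V]\<close>)
  then show "\<exists>c\<in>\<A>. \<exists>W. open W \<and> p \<in> W \<and> W \<subseteq> chart_dom c \<and>
      smooth_on (chart_map c ` W) ((\<lambda>p. dir_deriv \<A> f p (X p)) \<circ> chart_inv c)"
    using W chart_at by blast
qed

end

section \<open>Two-forms and linear connections\<close>

locale manifold_form = manifold \<A>
  for \<A> :: "('m::{t2_space, second_countable_topology}, 'e::euclidean_space) atlas" +
  fixes \<omega> :: "'m \<Rightarrow> 'e \<Rightarrow> 'e \<Rightarrow> real"
  assumes two_form: "two_form \<A> \<omega>"
begin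

lemma bilinear_form: "bilinear (\<omega> x)"
  using two_form by (simp add: two_form_def)

lemma smooth_form:
  "open V \<Longrightarrow> smooth_field \<A> V X \<Longrightarrow> smooth_field \<A> V Y \<Longrightarrow> smooth_vfun \<A> V (\<lambda>x. \<omega> x (X x) (Y x))"
  using two_form by (simp add: two_form_def smooth_fun_eq_vfun)

lemmas form_simps =
  bilinear_ladd[OF bilinear_form] bilinear_radd[OF bilinear_form]
  bilinear_lmul[OF bilinear_form] bilinear_rmul[OF bilinear_form]
  bilinear_lzero[OF bilinear_form] bilinear_rzero[OF bilinear_form]
  bilinear_lsub[OF bilinear_form] bilinear_rsub[OF bilinear_form]

lemma form_rsum: "\<omega> x v (\<Sum>i\<in>I. u i) = (\<Sum>i\<in>I. \<omega> x v (u i))"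
  using linear_sum[of "\<omega> x v" u I] bilinear_form by (simp add: bilinear_def)

lemma form_skew: "\<omega> x u v = - \<omega> x v u"
proof -
  have "\<omega> x (u + v) (u + v) = 0" "\<omega> x u u = 0" "\<omega> x v v = 0"
    using two_form by (auto simp: two_form_def)
  then show ?thesis by (simp add: form_simps)
qed

end

locale manifold_nondegenerate_form = manifold_form \<A> \<omega>
  for \<A> :: "('m::{t2_space, second_countable_topology}, 'e::euclidean_space) atlas" and \<omega> +
  assumes nondegenerate: "nondegenerate \<omega>"
begin

lemma form_eqI:
  assumes "\<And>w. \<omega> x u w = \<omega> x v w"
  shows "u = v"
proof -
  have "\<forall>w. \<omega> x (u - v) w = 0" using assms by (simp add: form_simps)
  then have "u - v = 0" using nondegenerate unfolding nondegenerate_def by blast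
  then show ?thesis by simp
qed

text \<open>In a coordinate frame the pairings of \<open>X\<close> with the frame fields are the
  Gram matrix of \<omega> applied to the coordinates of \<open>X\<close>. Non-degeneracy makes this
  matrix injective, so the coordinates solve a smooth linear system. The hypothesis ranges over open
  subsets of \<open>V\<close> because the frame exists only on a chart domain. This gives smoothness
  to fields known only through \<omega>, on M as well as on N.\<close>

lemma smooth_field_by_form:
  assumes V: "open V"
    and X: "\<And>W Z. open W \<Longrightarrow> W \<subseteq> V \<Longrightarrow> smooth_field \<A> W Z \<Longrightarrow> smooth_vfun \<A> W (\<lambda>x. \<omega> x (X x) (Z x))"
  shows "smooth_field \<A> V X"
proof (rule smooth_field_local[OF V])
  fix p assume p: "p \<in> V"
  define c where "c = chart_at \<A> p"
  define W where "W = V \<inter> chart_dom c"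
  have c: "c \<in> \<A>" "p \<in> chart_dom c" by (auto simp: c_def)
  have W: "open W" "p \<in> W" "W \<subseteq> V" "W \<subseteq> chart_dom c"
    using p V c by (auto simp: W_def)
  define E where "E b q = of_coords \<A> c q b" for b q
  have E: "smooth_field \<A> W (E b)" for b
    using smooth_field_subset[OF smooth_field_const[OF c(1)] W(4)] by (simp add: E_def[abs_def])
  \<comment> \<open>The Gram matrix acting on coordinate vectors; its rows are collected into one
    vector so that source and target have the same type.\<close>
  define G where "G u q = (\<Sum>b\<in>Basis. \<omega> q (E u q) (E b q) *\<^sub>R b)" for u q
  have mem: "\<exists>q\<in>W. z = chart_map c q \<and> chart_inv c z = q" if "z \<in> chart_map c ` W" for z
    using that W c by auto
  interpret smooth_linear_system "chart_map c ` W" "\<lambda>z u. G u (chart_inv c z)"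
  proof (rule smooth_linear_system.intro)
    show "open (chart_map c ` W)" by (rule open_chart_image[OF c(1) W(1,4)])
  next
    fix z assume "z \<in> chart_map c ` W"
    then obtain q where q: "q \<in> W" "chart_inv c z = q" using mem by blast
    have lin: "linear (\<lambda>u. E u q)"
      unfolding E_def using linear_of_coords[OF c(1)] q W by blast
    show lin_G: "linear (\<lambda>u. G u (chart_inv c z))"
      by (rule linearI)
         (simp_all add: q G_def linear_add[OF lin] linear_cmul[OF lin] form_simps scaleR_add_left
           sum.distrib scaleR_sum_right)
    show "inj (\<lambda>u. G u (chart_inv c z))"
      unfolding linear_injective_0[OF lin_G]
    proof (intro allI impI)
      fix u assume "G u (chart_inv c z) = 0"
      then have 0: "\<omega> q (E u q) (E b q) = 0" if "b \<in> Basis" for b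
        using that inner_sum_left_Basis[of b "\<lambda>b. \<omega> q (E u q) (E b q)"] by (simp add: G_def q)
      have "E u q = 0"
      proof (rule form_eqI)
        fix w
        have "w = (\<Sum>b\<in>Basis. (coords \<A> c q w \<bullet> b) *\<^sub>R E b q)"
          unfolding E_def by (rule frame_expansion) (use q W c in auto)
        then have "\<omega> q (E u q) w = \<omega> q (E u q) (\<Sum>b\<in>Basis. (coords \<A> c q w \<bullet> b) *\<^sub>R E b q)"
          by (rule arg_cong)
        also have "\<dots> = 0" using 0 by (simp add: form_rsum form_simps)
        finally show "\<omega> q (E u q) w = \<omega> q 0 w" by (simp add: form_simps)
      qed
      then have "coords \<A> c q (E u q) = 0"
        using linear_0[OF linear_coords[OF c(1)], of q] q W by auto
      then show "u = 0" using q W c by (auto simp: E_def)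
    qed
  next
    fix b :: 'e
    have "smooth_vfun \<A> W (G b)"
      unfolding G_def[abs_def] using W E
      by (intro smooth_vfun_sum smooth_vfun_scaleR smooth_form smooth_vfun_const) auto
    then show "smooth_on (chart_map c ` W) (\<lambda>z. G b (chart_inv c z))"
      using smooth_vfun_chart[OF _ c(1) subset_refl W(4)] by (simp add: o_def)
  qed
  let ?X = "\<lambda>q. coords \<A> c q (X q)"
  have h: "smooth_vfun \<A> W (\<lambda>q. \<Sum>b\<in>Basis. \<omega> q (X q) (E b q) *\<^sub>R b)"
    using W E by (intro smooth_vfun_sum smooth_vfun_scaleR X smooth_vfun_const) auto
  have "smooth_vfun \<A> W (\<lambda>q. G (?X q) q)"
    by (rule smooth_vfun_congI[OF W(1) h]) (use W c in \<open>simp add: G_def E_def subset_iff\<close>)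
  from smooth_vfun_chart[OF this c(1) subset_refl W(4)]
  have "smooth_on (chart_map c ` W) (\<lambda>z. G ((?X \<circ> chart_inv c) z) (chart_inv c z))"
    by (simp add: o_def)
  then have "smooth_on (chart_map c ` W) (?X \<circ> chart_inv c)"
    by (rule smooth_on_solution)
  then have "smooth_vfun \<A> W ?X"
    using smooth_vfun_single_chart[OF c(1) W(1,4)] by blast
  then show "\<exists>c\<in>\<A>. \<exists>W. open W \<and> p \<in> W \<and> W \<subseteq> chart_dom c \<and> smooth_vfun \<A> W (\<lambda>q. coords \<A> c q (X q))"
    using c W by blast
qed

end

section \<open>Linear connections in coordinate frames\<close>

locale manifold_connection = manifold \<A>
  for \<A> :: "('m::{t2_space, second_countable_topology}, 'e::euclidean_space) atlas" +
  fixes D :: "('m \<Rightarrow> 'e) \<Rightarrow> ('m \<Rightarrow> 'e) \<Rightarrow> 'm \<Rightarrow> 'e"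
  assumes linear_connection: "linear_connection \<A> UNIV D"
begin

context
  fixes V :: "'m set"
  assumes V: "open V"
begin

lemma connection_laws:
  assumes "smooth_field \<A> V X" "smooth_field \<A> V Y" "smooth_field \<A> V X'" "smooth_field \<A> V Y'"
    "smooth_vfun \<A> V f"
  shows "smooth_field \<A> V (D X Y) \<and>
    (\<forall>x\<in>V. D (\<lambda>y. X y + X' y) Y x = D X Y x + D X' Y x) \<and>
    (\<forall>x\<in>V. D (\<lambda>y. f y *\<^sub>R X y) Y x = f x *\<^sub>R D X Y x) \<and>
    (\<forall>x\<in>V. D X (\<lambda>y. Y y + Y' y) x = D X Y x + D X Y' x) \<and>
    (\<forall>x\<in>V. D X (\<lambda>y. f y *\<^sub>R Y y) x = dir_deriv \<A> f x (X x) *\<^sub>R Y x + f x *\<^sub>R D X Y x) \<and>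
    ((\<forall>x\<in>V. X x = X' x \<and> Y x = Y' x) \<longrightarrow> (\<forall>x\<in>V. D X Y x = D X' Y' x))"
  by (rule linear_connection[unfolded linear_connection_def smooth_fun_eq_vfun, THEN spec, of V, THEN spec, of X,
        THEN spec, of Y, THEN spec, of X', THEN spec, of Y', THEN spec, of f, THEN mp])
     (use V assms in simp)

lemma smooth_conn:
  assumes "smooth_field \<A> V X" "smooth_field \<A> V Y"
  shows "smooth_field \<A> V (D X Y)"
  using connection_laws[OF assms assms smooth_vfun_const[of V 0]] by blast

lemma conn_add_left:
  assumes "smooth_field \<A> V X" "smooth_field \<A> V X'" "smooth_field \<A> V Y" "x \<in> V"
  shows "D (\<lambda>y. X y + X' y) Y x = D X Y x + D X' Y x"
  using connection_laws[OF assms(1,3,2,3) smooth_vfun_const[of V 0]] assms(4) by simp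

lemma conn_scale_left:
  assumes "smooth_vfun \<A> V f" "smooth_field \<A> V X" "smooth_field \<A> V Y" "x \<in> V"
  shows "D (\<lambda>y. f y *\<^sub>R X y) Y x = f x *\<^sub>R D X Y x"
  using connection_laws[OF assms(2,3,2,3,1)] assms(4) by simp

lemma conn_add_right:
  assumes "smooth_field \<A> V X" "smooth_field \<A> V Y" "smooth_field \<A> V Y'" "x \<in> V"
  shows "D X (\<lambda>y. Y y + Y' y) x = D X Y x + D X Y' x"
  using connection_laws[OF assms(1,2,1,3) smooth_vfun_const[of V 0]] assms(4) by simp

lemma conn_leibniz:
  assumes "smooth_vfun \<A> V f" "smooth_field \<A> V X" "smooth_field \<A> V Y" "x \<in> V"
  shows "D X (\<lambda>y. f y *\<^sub>R Y y) x = dir_deriv \<A> f x (X x) *\<^sub>R Y x + f x *\<^sub>R D X Y x"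
  using connection_laws[OF assms(2,3,2,3,1)] assms(4) by simp

lemma conn_cong:
  assumes "smooth_field \<A> V X" "smooth_field \<A> V Y" "smooth_field \<A> V X'" "smooth_field \<A> V Y'" "x \<in> V"
    "\<And>y. y \<in> V \<Longrightarrow> X y = X' y" "\<And>y. y \<in> V \<Longrightarrow> Y y = Y' y"
  shows "D X Y x = D X' Y' x"
  using connection_laws[OF assms(1-4) smooth_vfun_const[of V 0]] assms(5-) by simp

lemma conn_sum_left:
  assumes "\<And>i. i \<in> I \<Longrightarrow> smooth_vfun \<A> V (f i)" "\<And>i. i \<in> I \<Longrightarrow> smooth_field \<A> V (X i)"
    and Y: "smooth_field \<A> V Y" and x: "x \<in> V" and "finite I"
  shows "D (\<lambda>y. \<Sum>i\<in>I. f i y *\<^sub>R X i y) Y x = (\<Sum>i\<in>I. f i x *\<^sub>R D (X i) Y x)"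
  using assms(5,1,2)
proof (induction I)
  case empty
  then show ?case
    using conn_scale_left[OF smooth_vfun_const[of V 0] smooth_field_zero[OF V] Y x] by simp
next
  case (insert i I)
  then have "smooth_field \<A> V (\<lambda>y. f i y *\<^sub>R X i y)" "smooth_field \<A> V (\<lambda>y. \<Sum>i\<in>I. f i y *\<^sub>R X i y)"
    using V by (auto intro!: smooth_field_sum smooth_field_scaleR)
  then show ?case
    using insert conn_add_left[OF _ _ Y x] conn_scale_left[OF _ _ Y x] by simp
qed

lemma conn_sum_right:
  assumes "\<And>i. i \<in> I \<Longrightarrow> smooth_vfun \<A> V (f i)" "\<And>i. i \<in> I \<Longrightarrow> smooth_field \<A> V (Y i)"
    and X: "smooth_field \<A> V X" and x: "x \<in> V" and "finite I"
  shows "D X (\<lambda>y. \<Sum>i\<in>I. f i y *\<^sub>R Y i y) x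
    = (\<Sum>i\<in>I. dir_deriv \<A> (f i) x (X x) *\<^sub>R Y i x + f i x *\<^sub>R D X (Y i) x)"
  using assms(5,1,2)
proof (induction I)
  case empty
  then show ?case
    using conn_leibniz[OF smooth_vfun_const[of V 0] X smooth_field_zero[OF V] x] by simp
next
  case (insert i I)
  then have "smooth_field \<A> V (\<lambda>y. f i y *\<^sub>R Y i y)" "smooth_field \<A> V (\<lambda>y. \<Sum>i\<in>I. f i y *\<^sub>R Y i y)"
    using V by (auto intro!: smooth_field_sum smooth_field_scaleR)
  then show ?case
    using insert conn_add_right[OF X _ _ x] conn_leibniz[OF _ X _ x] by simp
qed

end

lemma smooth_frame: "c \<in> \<A> \<Longrightarrow> W \<subseteq> chart_dom c \<Longrightarrow> smooth_field \<A> W (\<lambda>q. of_coords \<A> c q u)"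
  using smooth_field_subset[OF smooth_field_const] .

text \<open>Linearity over functions, applied to the frame expansion of \<open>X\<close>, shows that
  only the value of \<open>X\<close> at \<open>x\<close> matters; \<open>conn_tensorial\<close>
  draws this conclusion.\<close>

lemma conn_frame_left:
  assumes V: "open V" "x \<in> V" and X: "smooth_field \<A> V X" and Y: "smooth_field \<A> V Y"
    and c: "c \<in> \<A>" "x \<in> chart_dom c"
  shows "D X Y x = (\<Sum>b\<in>Basis. (coords \<A> c x (X x) \<bullet> b) *\<^sub>R D (\<lambda>q. of_coords \<A> c q b) Y x)"
proof -
  define W where "W = V \<inter> chart_dom c"
  have W: "open W" "W \<subseteq> V" "W \<subseteq> chart_dom c" "x \<in> W" using V c by (auto simp: W_def)
  let ?X = "\<lambda>q. \<Sum>b\<in>Basis. (coords \<A> c q (X q) \<bullet> b) *\<^sub>R of_coords \<A> c q b"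
  have f: "smooth_vfun \<A> W (\<lambda>q. coords \<A> c q (X q) \<bullet> b)" for b
    by (intro smooth_vfun_inner W smooth_field_coords[OF X V(1) c(1)])
  have "smooth_field \<A> W ?X"
    by (intro smooth_field_sum smooth_field_scaleR W f smooth_frame c)
  then have "D X Y x = D ?X Y x"
    using W c frame_expansion[OF c(1)] smooth_field_subset[OF X W(2)] smooth_field_subset[OF Y W(2)]
    by (intro conn_cong[OF W(1)]) auto
  also have "\<dots> = (\<Sum>b\<in>Basis. (coords \<A> c x (X x) \<bullet> b) *\<^sub>R D (\<lambda>q. of_coords \<A> c q b) Y x)"
    using smooth_field_subset[OF Y W(2)] by (intro conn_sum_left[OF W(1)] W f smooth_frame c) auto
  finally show ?thesis .
qed

lemma conn_tensorial:
  assumes "open V" "x \<in> V" "smooth_field \<A> V X" "smooth_field \<A> V X'" "smooth_field \<A> V Y" "X x = X' x"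
  shows "D X Y x = D X' Y x"
  using conn_frame_left[OF assms(1-3,5) chart_at] conn_frame_left[OF assms(1,2,4,5) chart_at] assms(6)
  by simp

text \<open>The Leibniz rule on the frame expansion of \<open>Y\<close> separates the derivative of
  the coordinates from the connection acting on a field with constant coordinates. The definition of
  \<open>cov_deriv_along\<close> has the same shape, with the coordinates differentiated on
  N.\<close>

lemma conn_frame_right:
  assumes V: "open V" "x \<in> V" and X: "smooth_field \<A> V X" and Y: "smooth_field \<A> V Y"
    and c: "c \<in> \<A>" "x \<in> chart_dom c"
  shows "D X Y x = of_coords \<A> c x (dir_deriv \<A> (\<lambda>q. coords \<A> c q (Y q)) x (X x))
    + D X (\<lambda>q. of_coords \<A> c q (coords \<A> c x (Y x))) x"
proof -
  define W where "W = V \<inter> chart_dom c"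
  have W: "open W" "W \<subseteq> V" "W \<subseteq> chart_dom c" "x \<in> W" using V c by (auto simp: W_def)
  have XW: "smooth_field \<A> W X" by (rule smooth_field_subset[OF X W(2)])
  \<comment> \<open>Kept general in \<open>g\<close> in order to be used twice: for the coordinates
    of \<open>Y\<close>, and for the constant map with the same value at \<open>x\<close>. The final
    sum depends only on \<open>g x\<close>, so it is common to both.\<close>
  have expand: "D X (\<lambda>q. of_coords \<A> c q (g q)) x = of_coords \<A> c x (dir_deriv \<A> g x (X x))
      + (\<Sum>b\<in>Basis. (g x \<bullet> b) *\<^sub>R D X (\<lambda>q. of_coords \<A> c q b) x)"
    if g: "smooth_vfun \<A> W g" for g
  proof -
    let ?Y = "\<lambda>q. \<Sum>b\<in>Basis. (g q \<bullet> b) *\<^sub>R of_coords \<A> c q b"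
    have f: "smooth_vfun \<A> W (\<lambda>q. g q \<bullet> b)" for b by (intro smooth_vfun_inner W g)
    have sm: "smooth_field \<A> W ?Y"
      by (intro smooth_field_sum smooth_field_scaleR W f smooth_frame c)
    have eq: "of_coords \<A> c q (g q) = ?Y q" if "q \<in> W" for q
      using that W(3) by (intro linear_expand linear_of_coords c) auto
    have "D X (\<lambda>q. of_coords \<A> c q (g q)) x = D X ?Y x"
      by (rule conn_cong[OF W(1) XW smooth_field_congI[OF W(1) sm eq] XW sm W(4) refl eq])
    also have "\<dots> = (\<Sum>b\<in>Basis. dir_deriv \<A> (\<lambda>q. g q \<bullet> b) x (X x) *\<^sub>R of_coords \<A> c x b
        + (g x \<bullet> b) *\<^sub>R D X (\<lambda>q. of_coords \<A> c q b) x)"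
      by (intro conn_sum_right[OF W(1)] f smooth_frame c XW W finite_Basis)
    also have "\<dots> = (\<Sum>b\<in>Basis. (dir_deriv \<A> g x (X x) \<bullet> b) *\<^sub>R of_coords \<A> c x b)
        + (\<Sum>b\<in>Basis. (g x \<bullet> b) *\<^sub>R D X (\<lambda>q. of_coords \<A> c q b) x)"
      by (simp add: sum.distrib dir_deriv_inner[OF W(1,4) g])
    also have "(\<Sum>b\<in>Basis. (dir_deriv \<A> g x (X x) \<bullet> b) *\<^sub>R of_coords \<A> c x b)
        = of_coords \<A> c x (dir_deriv \<A> g x (X x))"
      by (intro linear_expand[symmetric] linear_of_coords c)
    finally show ?thesis .
  qed
  have YW: "smooth_field \<A> W Y" by (rule smooth_field_subset[OF Y W(2)])
  have g: "smooth_vfun \<A> W (\<lambda>q. coords \<A> c q (Y q))"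
    by (intro smooth_field_coords[OF Y V(1) c(1)] W)
  have Yq: "Y q = of_coords \<A> c q (coords \<A> c q (Y q))" if "q \<in> W" for q
    using that W(3) c by auto
  have "D X Y x = D X (\<lambda>q. of_coords \<A> c q (coords \<A> c q (Y q))) x"
    by (rule conn_cong[OF W(1) XW YW XW smooth_field_congI[OF W(1) YW Yq[symmetric]] W(4) refl Yq])
  then show ?thesis
    using expand[OF g] expand[OF smooth_vfun_const[of W "coords \<A> c x (Y x)"]] c
    by (simp add: linear_0[OF linear_of_coords])
qed

lemma smooth_const_field: "W \<subseteq> chart_dom (chart_at \<A> p) \<Longrightarrow> smooth_field \<A> W (const_field \<A> p u)"
  unfolding const_field_def[abs_def] by (rule smooth_frame) simp

text \<open>The Christoffel symbols in the preferred chart at \<open>x\<close> are \<open>tensor_at \<A> D x\<close>.\<close>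

lemma conn_preferred_chart:
  assumes V: "open V" "x \<in> V" and X: "smooth_field \<A> V X" and Y: "smooth_field \<A> V Y"
  shows "D X Y x = dir_deriv \<A> (\<lambda>q. coords \<A> (chart_at \<A> x) q (Y q)) x (X x)
    + tensor_at \<A> D x (X x) (Y x)"
proof -
  define W where "W = V \<inter> chart_dom (chart_at \<A> x)"
  have W: "open W" "W \<subseteq> V" "W \<subseteq> chart_dom (chart_at \<A> x)" "x \<in> W" using V by (auto simp: W_def)
  have "D X (const_field \<A> x (Y x)) x = D (const_field \<A> x (X x)) (const_field \<A> x (Y x)) x"
    by (rule conn_tensorial[OF W(1,4)])
       (simp_all add: smooth_const_field W smooth_field_subset[OF X W(2)])
  then show ?thesis
    using conn_frame_right[OF V X Y chart_at]
    by (simp add: tensor_at_def const_field_def[abs_def])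
qed

text \<open>These are the Christoffel symbols of \<open>D\<close> in the chart \<open>c\<close>. The
  frame fields depend linearly on their coordinate vectors only over the chart domain, hence the
  passage through \<open>conn_cong\<close> before each law.\<close>

lemma bilinear_conn_frame:
  assumes c: "c \<in> \<A>" "x \<in> chart_dom c"
  shows "bilinear (\<lambda>u v. D (\<lambda>q. of_coords \<A> c q u) (\<lambda>q. of_coords \<A> c q v) x)"
proof -
  let ?W = "chart_dom c" and ?K = "\<lambda>u q. of_coords \<A> c q u"
  have o: "open ?W" "x \<in> ?W" using c by auto
  have K: "smooth_field \<A> ?W (?K u)" for u by (rule smooth_frame[OF c(1) subset_refl])
  have lin: "linear (\<lambda>u. ?K u q)" if "q \<in> ?W" for q
    using that by (intro linear_of_coords c) auto
  have KA: "smooth_field \<A> ?W (\<lambda>q. ?K u q + ?K v q)" for u v by (rule smooth_field_add[OF o(1) K K])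
  have KS: "smooth_field \<A> ?W (\<lambda>q. r *\<^sub>R ?K v q)" for r v
    by (rule smooth_field_scaleR[OF o(1) smooth_vfun_const K])
  show ?thesis
    unfolding bilinear_def
  proof (intro conjI allI linearI)
    fix u v w r
    have "D (?K u) (?K (v + w)) x = D (?K u) (\<lambda>q. ?K v q + ?K w q) x"
      by (rule conn_cong[OF o(1) K K K KA o(2)]) (simp_all add: linear_add[OF lin])
    then show "D (?K u) (?K (v + w)) x = D (?K u) (?K v) x + D (?K u) (?K w) x"
      using conn_add_right[OF o(1) K K K o(2)] by simp
    have "D (?K u) (?K (r *\<^sub>R v)) x = D (?K u) (\<lambda>q. r *\<^sub>R ?K v q) x"
      by (rule conn_cong[OF o(1) K K K KS o(2)]) (simp_all add: linear_cmul[OF lin])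
    then show "D (?K u) (?K (r *\<^sub>R v)) x = r *\<^sub>R D (?K u) (?K v) x"
      using conn_leibniz[OF o(1) smooth_vfun_const K K o(2)] by simp
    have "D (?K (v + w)) (?K u) x = D (\<lambda>q. ?K v q + ?K w q) (?K u) x"
      by (rule conn_cong[OF o(1) K K KA K o(2)]) (simp_all add: linear_add[OF lin])
    then show "D (?K (v + w)) (?K u) x = D (?K v) (?K u) x + D (?K w) (?K u) x"
      using conn_add_left[OF o(1) K K K o(2)] by simp
    have "D (?K (r *\<^sub>R v)) (?K u) x = D (\<lambda>q. r *\<^sub>R ?K v q) (?K u) x"
      by (rule conn_cong[OF o(1) K K KS K o(2)]) (simp_all add: linear_cmul[OF lin])
    then show "D (?K (r *\<^sub>R v)) (?K u) x = r *\<^sub>R D (?K v) (?K u) x"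
      using conn_scale_left[OF o(1) smooth_vfun_const K K o(2)] by simp
  qed
qed

lemma bilinear_christoffel: "bilinear (tensor_at \<A> D x)"
  using bilinear_conn_frame[OF chart_at] by (simp add: tensor_at_def[abs_def] const_field_def[abs_def])

text \<open>Fields with constant coordinates in the same chart commute, so the bracket term vanishes
  and the antisymmetrised Christoffel symbols remain.\<close>

lemma torsion_at:
  "tensor_at \<A> (torsion \<A> D) x u v = tensor_at \<A> D x u v - tensor_at \<A> D x v u"
proof -
  let ?c = "chart_at \<A> x"
  have "fderiv (field_in_chart \<A> ?c (const_field \<A> x u)) (chart_map ?c x) w = 0" for u w
  proof -
    have "fderiv (field_in_chart \<A> ?c (const_field \<A> x u)) (chart_map ?c x) = fderiv (\<lambda>z. u) (chart_map ?c x)"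
      by (rule fderiv_cong_open[OF open_chart_image[OF chart_at(1) _ subset_refl]])
         (auto simp: field_in_chart_def const_field_def)
    then show ?thesis by simp
  qed
  then show ?thesis by (simp add: tensor_at_def torsion_def lie_bracket_def)
qed

end

section \<open>The covariant derivative of a two-form\<close>

locale manifold_form_connection = manifold_form \<A> \<omega> + manifold_connection \<A> D
  for \<A> :: "('m::{t2_space, second_countable_topology}, 'e::euclidean_space) atlas" and \<omega> D
begin

context
  fixes V :: "'m set"
  assumes V: "open V"
begin

lemma smooth_cov_deriv_form:
  assumes "smooth_field \<A> V X" "smooth_field \<A> V Y" "smooth_field \<A> V Z"
  shows "smooth_vfun \<A> V (cov_deriv_form \<A> D \<omega> X Y Z)"
  unfolding cov_deriv_form_def[abs_def]
  by (intro smooth_vfun_diff V smooth_dir_deriv smooth_form smooth_conn assms)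

context
  fixes x assumes x: "x \<in> V"
begin

lemma cov_deriv_form_add_left:
  assumes "smooth_field \<A> V X" "smooth_field \<A> V X'" "smooth_field \<A> V Y" "smooth_field \<A> V Z"
  shows "cov_deriv_form \<A> D \<omega> (\<lambda>y. X y + X' y) Y Z x
    = cov_deriv_form \<A> D \<omega> X Y Z x + cov_deriv_form \<A> D \<omega> X' Y Z x"
  using linear_add[OF dir_deriv_linear_dir[OF V x smooth_form[OF V assms(3,4)]]]
  by (simp add: cov_deriv_form_def conn_add_left[OF V assms(1,2,3) x] conn_add_left[OF V assms(1,2,4) x] form_simps)

lemma cov_deriv_form_scale_left:
  assumes "smooth_vfun \<A> V f" "smooth_field \<A> V X" "smooth_field \<A> V Y" "smooth_field \<A> V Z"
  shows "cov_deriv_form \<A> D \<omega> (\<lambda>y. f y *\<^sub>R X y) Y Z x = f x * cov_deriv_form \<A> D \<omega> X Y Z x"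
  using linear_cmul[OF dir_deriv_linear_dir[OF V x smooth_form[OF V assms(3,4)]]]
  by (simp add: cov_deriv_form_def conn_scale_left[OF V assms(1,2,3) x] conn_scale_left[OF V assms(1,2,4) x]
      form_simps right_diff_distrib)

lemma cov_deriv_form_add_right:
  assumes "smooth_field \<A> V X" "smooth_field \<A> V Y" "smooth_field \<A> V Y'" "smooth_field \<A> V Z"
  shows "cov_deriv_form \<A> D \<omega> X (\<lambda>y. Y y + Y' y) Z x
    = cov_deriv_form \<A> D \<omega> X Y Z x + cov_deriv_form \<A> D \<omega> X Y' Z x"
  by (simp add: cov_deriv_form_def conn_add_right[OF V assms(1,2,3) x] form_simps
      dir_deriv_add[OF V x smooth_form[OF V assms(2,4)] smooth_form[OF V assms(3,4)]])

text \<open>Differentiating \<open>f \<omega>(Y,Z)\<close> and applying the Leibniz rule to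
  \<open>D X (f Y)\<close> both produce \<open>X(f) \<omega>(Y,Z)\<close>, with opposite
  signs.\<close>

lemma cov_deriv_form_scale_right:
  assumes "smooth_vfun \<A> V f" "smooth_field \<A> V X" "smooth_field \<A> V Y" "smooth_field \<A> V Z"
  shows "cov_deriv_form \<A> D \<omega> X (\<lambda>y. f y *\<^sub>R Y y) Z x = f x * cov_deriv_form \<A> D \<omega> X Y Z x"
  by (simp add: cov_deriv_form_def conn_leibniz[OF V assms(1-3) x] form_simps
      dir_deriv_mult[OF V x assms(1) smooth_form[OF V assms(3,4)]] algebra_simps)

lemma cov_deriv_form_skew:
  assumes "smooth_field \<A> V X" "smooth_field \<A> V Y" "smooth_field \<A> V Z"
  shows "cov_deriv_form \<A> D \<omega> X Y Z x = - cov_deriv_form \<A> D \<omega> X Z Y x"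
proof -
  have "dir_deriv \<A> (\<lambda>y. \<omega> y (Y y) (Z y)) x (X x) = dir_deriv \<A> (\<lambda>y. - \<omega> y (Z y) (Y y)) x (X x)"
    by (rule dir_deriv_cong[OF V x]) (rule form_skew)
  also have "\<dots> = - dir_deriv \<A> (\<lambda>y. \<omega> y (Z y) (Y y)) x (X x)"
    by (rule dir_deriv_linear[OF V x bounded_linear_minus[OF bounded_linear_ident]
        smooth_form[OF V assms(3,2)]])
  finally show ?thesis
    using form_skew[of x "D X Y x" "Z x"] form_skew[of x "Y x" "D X Z x"]
    by (simp add: cov_deriv_form_def)
qed

end

end

end

text \<open>\<open>A\<close> enters as a bare function of points and vectors; its linearity and
  smoothness must be extracted from \<open>form_A\<close>. Likewise \<open>D\<close> is known only
  through \<open>D_eq\<close> on smooth fields, so even that it is a connection is something to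
  prove.\<close>

locale adapted_form_connection = manifold_nondegenerate_form \<A> \<omega> + manifold_form_connection \<A> \<omega> D0
  for \<A> :: "('m::{t2_space, second_countable_topology}, 'e::euclidean_space) atlas" and \<omega> D0 +
  fixes A :: "'m \<Rightarrow> 'e \<Rightarrow> 'e \<Rightarrow> 'e" and D :: "('m \<Rightarrow> 'e) \<Rightarrow> ('m \<Rightarrow> 'e) \<Rightarrow> 'm \<Rightarrow> 'e"
  assumes form_A: "open V \<Longrightarrow> smooth_field \<A> V X \<Longrightarrow> smooth_field \<A> V Y \<Longrightarrow> smooth_field \<A> V Z \<Longrightarrow> x \<in> V \<Longrightarrow>
      \<omega> x (A x (X x) (Y x)) (Z x) = cov_deriv_form \<A> D0 \<omega> X Y Z x / 2"
    and D_eq: "open V \<Longrightarrow> smooth_field \<A> V X \<Longrightarrow> smooth_field \<A> V Y \<Longrightarrow> x \<in> V \<Longrightarrow>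
      D X Y x = D0 X Y x + A x (X x) (Y x)"
begin

text \<open>\<open>form_A\<close> pairs only with smooth fields. The fields with constant
  coordinates attain every vector at \<open>x\<close>, so these pairings still determine a
  vector.\<close>

lemma form_field_eqI:
  assumes V: "open V" "x \<in> V"
    and eq: "\<And>W Z. open W \<Longrightarrow> W \<subseteq> V \<Longrightarrow> x \<in> W \<Longrightarrow> smooth_field \<A> W Z \<Longrightarrow> \<omega> x u (Z x) = \<omega> x v (Z x)"
  shows "u = v"
proof (rule form_eqI)
  fix w
  let ?W = "V \<inter> chart_dom (chart_at \<A> x)"
  have "\<omega> x u (const_field \<A> x w x) = \<omega> x v (const_field \<A> x w x)"
    by (rule eq[of ?W]) (use V in \<open>auto intro: smooth_const_field\<close>)
  then show "\<omega> x u w = \<omega> x v w" by simp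
qed

lemma smooth_A:
  assumes V: "open V" and "smooth_field \<A> V X" "smooth_field \<A> V Y"
  shows "smooth_field \<A> V (\<lambda>x. A x (X x) (Y x))"
proof (rule smooth_field_by_form[OF V])
  fix W Z assume W: "open W" "W \<subseteq> V" and Z: "smooth_field \<A> W Z"
  have XY: "smooth_field \<A> W X" "smooth_field \<A> W Y"
    using assms smooth_field_subset W by auto
  show "smooth_vfun \<A> W (\<lambda>x. \<omega> x (A x (X x) (Y x)) (Z x))"
    by (rule smooth_vfun_congI[OF W(1) smooth_vfun_linear[OF bounded_linear_divide[of 2] W(1)
            smooth_cov_deriv_form[OF W(1) XY Z]]])
       (rule form_A[OF W(1) XY Z])
qed

context
  fixes V x X Y
  assumes V: "open V" "x \<in> V" and XY: "smooth_field \<A> V X" "smooth_field \<A> V Y"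
begin

text \<open>This and the next three laws carry the function-linearity of \<nabla>\<omega> over to
  \<open>A\<close>, since \<open>form_A\<close> makes the two sides pair equally with every field
  near \<open>x\<close>.\<close>

lemma A_add_left:
  assumes "smooth_field \<A> V X'"
  shows "A x (X x + X' x) (Y x) = A x (X x) (Y x) + A x (X' x) (Y x)"
proof (rule form_field_eqI[OF V])
  fix W Z assume W: "open W" "W \<subseteq> V" "x \<in> W" and Z: "smooth_field \<A> W Z"
  have s: "smooth_field \<A> W X" "smooth_field \<A> W Y" "smooth_field \<A> W X'"
    using assms XY smooth_field_subset W by auto
  show "\<omega> x (A x (X x + X' x) (Y x)) (Z x) = \<omega> x (A x (X x) (Y x) + A x (X' x) (Y x)) (Z x)"
    using form_A[OF W(1) smooth_field_add[OF W(1) s(1,3)] s(2) Z W(3)] form_A[OF W(1) s(1,2) Z W(3)]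
      form_A[OF W(1) s(3,2) Z W(3)] cov_deriv_form_add_left[OF W(1,3) s(1,3,2) Z]
    by (simp add: form_simps)
qed

lemma A_scale_left:
  assumes "smooth_vfun \<A> V f"
  shows "A x (f x *\<^sub>R X x) (Y x) = f x *\<^sub>R A x (X x) (Y x)"
proof (rule form_field_eqI[OF V])
  fix W Z assume W: "open W" "W \<subseteq> V" "x \<in> W" and Z: "smooth_field \<A> W Z"
  have s: "smooth_field \<A> W X" "smooth_field \<A> W Y" and f: "smooth_vfun \<A> W f"
    using assms XY smooth_field_subset smooth_vfun_subset W by auto
  show "\<omega> x (A x (f x *\<^sub>R X x) (Y x)) (Z x) = \<omega> x (f x *\<^sub>R A x (X x) (Y x)) (Z x)"
    by (simp add: form_simps form_A[OF W(1) smooth_field_scaleR[OF W(1) f s(1)] s(2) Z W(3)] form_A[OF W(1) s(1,2) Z W(3)]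
      cov_deriv_form_scale_left[OF W(1,3) f s Z])
qed

lemma A_add_right:
  assumes "smooth_field \<A> V Y'"
  shows "A x (X x) (Y x + Y' x) = A x (X x) (Y x) + A x (X x) (Y' x)"
proof (rule form_field_eqI[OF V])
  fix W Z assume W: "open W" "W \<subseteq> V" "x \<in> W" and Z: "smooth_field \<A> W Z"
  have s: "smooth_field \<A> W X" "smooth_field \<A> W Y" "smooth_field \<A> W Y'"
    using assms XY smooth_field_subset W by auto
  show "\<omega> x (A x (X x) (Y x + Y' x)) (Z x) = \<omega> x (A x (X x) (Y x) + A x (X x) (Y' x)) (Z x)"
    using form_A[OF W(1) s(1) smooth_field_add[OF W(1) s(2,3)] Z W(3)] form_A[OF W(1) s(1,2) Z W(3)]
      form_A[OF W(1) s(1,3) Z W(3)] cov_deriv_form_add_right[OF W(1,3) s Z]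
    by (simp add: form_simps)
qed

lemma A_scale_right:
  assumes "smooth_vfun \<A> V f"
  shows "A x (X x) (f x *\<^sub>R Y x) = f x *\<^sub>R A x (X x) (Y x)"
proof (rule form_field_eqI[OF V])
  fix W Z assume W: "open W" "W \<subseteq> V" "x \<in> W" and Z: "smooth_field \<A> W Z"
  have s: "smooth_field \<A> W X" "smooth_field \<A> W Y" and f: "smooth_vfun \<A> W f"
    using assms XY smooth_field_subset smooth_vfun_subset W by auto
  show "\<omega> x (A x (X x) (f x *\<^sub>R Y x)) (Z x) = \<omega> x (f x *\<^sub>R A x (X x) (Y x)) (Z x)"
    by (simp add: form_simps form_A[OF W(1) s(1) smooth_field_scaleR[OF W(1) f s(2)] Z W(3)] form_A[OF W(1) s(1,2) Z W(3)]
      cov_deriv_form_scale_right[OF W(1,3) f s Z])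
qed

end

text \<open>A connection plus a tensor is a connection: the derivative term of the Leibniz rule
  comes from \<open>D0\<close>, and the laws of \<open>A\<close> supply the rest.\<close>

lemma linear_connection_adapted: "linear_connection \<A> UNIV D"
  unfolding linear_connection_def smooth_fun_eq_vfun
proof (intro allI impI, elim conjE, intro conjI ballI impI)
  fix V X Y X' Y' and f :: "'m \<Rightarrow> real"
  assume V: "open V" and X: "smooth_field \<A> V X" and Y: "smooth_field \<A> V Y"
    and X': "smooth_field \<A> V X'" and Y': "smooth_field \<A> V Y'" and f: "smooth_vfun \<A> V f"
  show "smooth_field \<A> V (D X Y)"
    by (rule smooth_field_congI[OF V smooth_field_add[OF V smooth_conn[OF V X Y] smooth_A[OF V X Y]]])
       (rule D_eq[OF V X Y])
  fix x assume x: "x \<in> V"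
  show "D (\<lambda>y. X y + X' y) Y x = D X Y x + D X' Y x"
    using D_eq[OF V smooth_field_add[OF V X X'] Y x] D_eq[OF V X Y x] D_eq[OF V X' Y x]
      conn_add_left[OF V X X' Y x] A_add_left[OF V x X Y X']
    by simp
  show "D (\<lambda>y. f y *\<^sub>R X y) Y x = f x *\<^sub>R D X Y x"
    using D_eq[OF V smooth_field_scaleR[OF V f X] Y x] D_eq[OF V X Y x]
      conn_scale_left[OF V f X Y x] A_scale_left[OF V x X Y f]
    by (simp add: scaleR_add_right)
  show "D X (\<lambda>y. Y y + Y' y) x = D X Y x + D X Y' x"
    using D_eq[OF V X smooth_field_add[OF V Y Y'] x] D_eq[OF V X Y x] D_eq[OF V X Y' x]
      conn_add_right[OF V X Y Y' x] A_add_right[OF V x X Y Y']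
    by simp
  show "D X (\<lambda>y. f y *\<^sub>R Y y) x = dir_deriv \<A> f x (X x) *\<^sub>R Y x + f x *\<^sub>R D X Y x"
    using D_eq[OF V X smooth_field_scaleR[OF V f Y] x] D_eq[OF V X Y x]
      conn_leibniz[OF V f X Y x] A_scale_right[OF V x X Y f]
    by (simp add: scaleR_add_right)
  assume "\<forall>x\<in>V. X x = X' x \<and> Y x = Y' x"
  then show "D X Y x = D X' Y' x"
    using D_eq[OF V X Y x] D_eq[OF V X' Y' x] conn_cong[OF V X Y X' Y' x] x by simp
qed

text \<open>The factor 1/2 in \<open>form_A\<close> accounts for two occurrences of
  \<open>A\<close>: each of \<open>\<omega>(A(X,Y),Z)\<close> and \<open>\<omega>(Y,A(X,Z))\<close>
  is half of the defect \<open>(\<nabla>\<omega>)(Y,Z)\<close>, the latter because the defect is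
  skew in \<open>Y\<close> and \<open>Z\<close>.\<close>

lemma preserves_two_form_adapted: "preserves_two_form \<A> D \<omega>"
  unfolding preserves_two_form_def
proof (intro allI impI ballI, elim conjE)
  fix V X Y Z x
  assume V: "open V" and X: "smooth_field \<A> V X" and Y: "smooth_field \<A> V Y"
    and Z: "smooth_field \<A> V Z" and x: "x \<in> V"
  have "cov_deriv_form \<A> D \<omega> X Y Z x
      = cov_deriv_form \<A> D0 \<omega> X Y Z x - \<omega> x (A x (X x) (Y x)) (Z x) + \<omega> x (A x (X x) (Z x)) (Y x)"
    using form_skew[of x "Y x" "A x (X x) (Z x)"]
    by (simp add: cov_deriv_form_def D_eq[OF V X Y x] D_eq[OF V X Z x] form_simps)
  then show "cov_deriv_form \<A> D \<omega> X Y Z x = 0"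
    using form_A[OF V X Y Z x] form_A[OF V X Z Y x] cov_deriv_form_skew[OF V x X Y Z] by simp
qed

end

section \<open>Families of linear and bilinear maps with smooth coefficients\<close>

context manifold
begin

context
  fixes V :: "'m set" and T :: "'m \<Rightarrow> 'a::euclidean_space \<Rightarrow> 'b::real_normed_vector" and f :: "'m \<Rightarrow> 'a"
  assumes V: "open V" and lin: "\<And>p. p \<in> V \<Longrightarrow> linear (T p)"
    and T: "\<And>u. smooth_vfun \<A> V (\<lambda>p. T p u)" and f: "smooth_vfun \<A> V f"
begin

lemma smooth_linear_family: "smooth_vfun \<A> V (\<lambda>p. T p (f p))"
  by (rule smooth_vfun_congI[OF V _ linear_expand[OF lin]])
     (intro smooth_vfun_sum smooth_vfun_scaleR smooth_vfun_inner V T f)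

text \<open>In the basis expansion the product rule differentiates either the coefficient
  \<open>T q b\<close>, with the vector frozen at \<open>f p\<close>, or the component of
  \<open>f\<close>. It serves for moving frames, where \<open>T\<close> changes coordinates or pairs
  frame fields.\<close>

lemma dir_deriv_linear_family:
  assumes p: "p \<in> V"
  shows "dir_deriv \<A> (\<lambda>q. T q (f q)) p v = dir_deriv \<A> (\<lambda>q. T q (f p)) p v + T p (dir_deriv \<A> f p v)"
proof -
  have f_b: "smooth_vfun \<A> V (\<lambda>q. f q \<bullet> b)" for b by (intro smooth_vfun_inner V f)
  have expand: "dir_deriv \<A> (\<lambda>q. T q (g q)) p v
      = (\<Sum>b\<in>Basis. (g p \<bullet> b) *\<^sub>R dir_deriv \<A> (\<lambda>q. T q b) p v) + T p (dir_deriv \<A> g p v)"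
    if g: "smooth_vfun \<A> V g" for g
  proof -
    have g_b: "smooth_vfun \<A> V (\<lambda>q. g q \<bullet> b)" for b by (intro smooth_vfun_inner V g)
    have "dir_deriv \<A> (\<lambda>q. T q (g q)) p v = dir_deriv \<A> (\<lambda>q. \<Sum>b\<in>Basis. (g q \<bullet> b) *\<^sub>R T q b) p v"
      by (rule dir_deriv_cong[OF V p linear_expand[OF lin]])
    also have "\<dots> = (\<Sum>b\<in>Basis. dir_deriv \<A> (\<lambda>q. (g q \<bullet> b) *\<^sub>R T q b) p v)"
      by (intro dir_deriv_sum[OF V p] smooth_vfun_scaleR V g_b T)
    also have "\<dots> = (\<Sum>b\<in>Basis. (g p \<bullet> b) *\<^sub>R dir_deriv \<A> (\<lambda>q. T q b) p v)
        + (\<Sum>b\<in>Basis. (dir_deriv \<A> g p v \<bullet> b) *\<^sub>R T p b)"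
      by (simp add: dir_deriv_scaleR[OF V p g_b T] dir_deriv_inner[OF V p g] sum.distrib)
    also have "(\<Sum>b\<in>Basis. (dir_deriv \<A> g p v \<bullet> b) *\<^sub>R T p b) = T p (dir_deriv \<A> g p v)"
      by (rule linear_expand[OF lin[OF p], symmetric])
    finally show ?thesis .
  qed
  show ?thesis
    using expand[OF f] expand[OF smooth_vfun_const[of V "f p"]] linear_0[OF lin[OF p]] by simp
qed

end

context
  fixes V :: "'m set" and T :: "'m \<Rightarrow> 'a::euclidean_space \<Rightarrow> 'c::euclidean_space \<Rightarrow> 'b::real_normed_vector"
    and f :: "'m \<Rightarrow> 'a" and g :: "'m \<Rightarrow> 'c"
  assumes V: "open V" and bil: "\<And>p. p \<in> V \<Longrightarrow> bilinear (T p)"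
    and T: "\<And>u v. smooth_vfun \<A> V (\<lambda>p. T p u v)" and f: "smooth_vfun \<A> V f" and g: "smooth_vfun \<A> V g"
begin

lemma bilinear_family_linear:
  "p \<in> V \<Longrightarrow> linear (T p u)" "p \<in> V \<Longrightarrow> linear (\<lambda>u. T p u v)"
  using bil by (auto simp: bilinear_def)

lemma smooth_family_partial: "smooth_vfun \<A> V (\<lambda>p. T p u (g p))"
  by (rule smooth_linear_family[where T = "\<lambda>p. T p u" and f = g, OF V bilinear_family_linear(1) T g])

lemma smooth_bilinear_family: "smooth_vfun \<A> V (\<lambda>p. T p (f p) (g p))"
  by (rule smooth_linear_family[where T = "\<lambda>p u. T p u (g p)" and f = f,
        OF V bilinear_family_linear(2) smooth_family_partial f])

lemma dir_deriv_bilinear_family: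
  assumes p: "p \<in> V"
  shows "dir_deriv \<A> (\<lambda>q. T q (f q) (g q)) p v = dir_deriv \<A> (\<lambda>q. T q (f p) (g p)) p v
    + T p (dir_deriv \<A> f p v) (g p) + T p (f p) (dir_deriv \<A> g p v)"
  using dir_deriv_linear_family[where T = "\<lambda>p u. T p u (g p)" and f = f and v = v,
      OF V bilinear_family_linear(2) smooth_family_partial f p]
    dir_deriv_linear_family[where T = "\<lambda>q. T q (f p)" and f = g and v = v,
      OF V bilinear_family_linear(1) T g p]
  by simp

end

lemma dir_deriv_chain:
  assumes f: "smooth_vfun \<A> V f" "open V" "p \<in> V" and g: "g differentiable (at (f p))"
  shows "dir_deriv \<A> (\<lambda>q. g (f q)) p v = fderiv g (f p) (dir_deriv \<A> f p v)"
  using fderiv_chain[of "f \<circ> chart_inv (chart_at \<A> p)" _ g, OF smooth_vfun_differentiable[OF f chart_at]] g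
  by (simp add: dir_deriv_def o_def)

end

section \<open>Maps between manifolds\<close>

locale manifold_map = M: manifold \<A> + N: manifold \<B>
  for \<A> :: "('m::{t2_space, second_countable_topology}, 'e::euclidean_space) atlas"
    and \<B> :: "('n::{t2_space, second_countable_topology}, 'f::euclidean_space) atlas" +
  fixes \<iota> :: "'n \<Rightarrow> 'm"
  assumes smooth_map: "smooth_map \<B> \<A> \<iota>"
begin

abbreviation d\<iota> :: "'n \<Rightarrow> 'f \<Rightarrow> 'e" where
  "d\<iota> \<equiv> differential \<B> \<A> \<iota>"

lemma open_preimage: "open U \<Longrightarrow> open (\<iota> -` U)"
  using smooth_map by (simp add: smooth_map_def open_vimage)

lemma smooth_chart_comp:
  assumes "d \<in> \<A>" "W \<subseteq> \<iota> -` chart_dom d"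
  shows "smooth_vfun \<B> W (chart_map d \<circ> \<iota>)"
proof -
  have "smooth_vfun \<B> (\<iota> -` chart_dom d) (chart_map d \<circ> \<iota>)"
    using smooth_map assms(1) by (simp add: smooth_vfun_def smooth_map_def Int_commute)
  then show ?thesis using assms(2) by (rule N.smooth_vfun_subset)
qed

text \<open>\<open>differential\<close> refers to the chart preferred at the image point, which
  moves with \<open>y\<close>. In a fixed chart \<open>d\<close> the image vectors become plain
  directional derivatives, hence smooth in \<open>y\<close>.\<close>

lemma coords_differential:
  assumes d: "d \<in> \<A>" "\<iota> y \<in> chart_dom d"
  shows "coords \<A> d (\<iota> y) (d\<iota> y u) = dir_deriv \<B> (chart_map d \<circ> \<iota>) y u"
proof -
  let ?a = "chart_at \<A> (\<iota> y)"
  let ?W = "\<iota> -` (chart_dom ?a \<inter> chart_dom d)"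
  have W: "open ?W" "y \<in> ?W" using d by (auto intro!: open_preimage)
  let ?t = "chart_map d \<circ> chart_inv ?a"
  have "dir_deriv \<B> (chart_map d \<circ> \<iota>) y u = dir_deriv \<B> (\<lambda>q. ?t ((chart_map ?a \<circ> \<iota>) q)) y u"
    by (rule N.dir_deriv_cong[OF W]) simp
  also have "\<dots> = fderiv ?t ((chart_map ?a \<circ> \<iota>) y) (dir_deriv \<B> (chart_map ?a \<circ> \<iota>) y u)"
    using M.transition_differentiable[OF M.chart_at(1) d(1) M.chart_at(2) d(2)]
    by (intro N.dir_deriv_chain[where g = ?t, OF smooth_chart_comp W]) auto
  finally show ?thesis by (simp add: coords_def transition_deriv_def differential_def)
qed

lemma linear_differential: "linear (d\<iota> y)"
  unfolding differential_def[abs_def]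
  by (rule N.dir_deriv_linear_dir[OF _ _ smooth_chart_comp[OF M.chart_at(1) subset_refl]])
     (auto intro: open_preimage)

lemma smooth_pullback:
  assumes f: "smooth_vfun \<A> U f" and U: "open U"
  shows "smooth_vfun \<B> (\<iota> -` U) (\<lambda>y. f (\<iota> y))"
proof (rule N.smooth_vfun_local)
  fix y assume y: "y \<in> \<iota> -` U"
  let ?c = "chart_at \<B> y" and ?d = "chart_at \<A> (\<iota> y)"
  define W where "W = chart_dom ?c \<inter> \<iota> -` (U \<inter> chart_dom ?d)"
  have W: "open W" "y \<in> W" "W \<subseteq> chart_dom ?c" "W \<subseteq> \<iota> -` (U \<inter> chart_dom ?d)"
    using y U by (auto simp: W_def intro!: open_Int open_preimage)
  have o: "open (chart_map ?c ` W)" "open (chart_map ?d ` (U \<inter> chart_dom ?d))"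
    using W U by (auto intro!: N.open_chart_image M.open_inter_image)
  let ?r = "chart_map ?d \<circ> \<iota> \<circ> chart_inv ?c"
  have "smooth_on (chart_map ?c ` W) (\<lambda>z. (f \<circ> chart_inv ?d) (?r z))"
  proof (rule smooth_on_compose[OF o])
    show "?r ` chart_map ?c ` W \<subseteq> chart_map ?d ` (U \<inter> chart_dom ?d)"
      using W by (auto simp: subset_iff)
    show "smooth_on (chart_map ?c ` W) ?r"
      using W by (intro N.smooth_vfun_chart[OF smooth_chart_comp[OF M.chart_at(1) subset_refl]]) auto
    show "smooth_on (chart_map ?d ` (U \<inter> chart_dom ?d)) (f \<circ> chart_inv ?d)"
      by (intro M.smooth_vfun_chart[OF f]) auto
  qed
  moreover have "(f \<circ> chart_inv ?d) (?r z) = ((\<lambda>y. f (\<iota> y)) \<circ> chart_inv ?c) z"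
    if "z \<in> chart_map ?c ` W" for z
    using that W by (auto simp: subset_iff)
  ultimately have "smooth_on (chart_map ?c ` W) ((\<lambda>y. f (\<iota> y)) \<circ> chart_inv ?c)"
    using smooth_on_cong[OF o(1), of "\<lambda>z. (f \<circ> chart_inv ?d) (?r z)" "(\<lambda>y. f (\<iota> y)) \<circ> chart_inv ?c"]
    by simp
  then show "\<exists>c\<in>\<B>. \<exists>W. open W \<and> y \<in> W \<and> W \<subseteq> chart_dom c \<and>
      smooth_on (chart_map c ` W) ((\<lambda>y. f (\<iota> y)) \<circ> chart_inv c)"
    using W by blast
qed

lemma dir_deriv_pullback:
  assumes f: "smooth_vfun \<A> U f" and U: "open U" "\<iota> y \<in> U"
  shows "dir_deriv \<B> (\<lambda>y. f (\<iota> y)) y u = dir_deriv \<A> f (\<iota> y) (d\<iota> y u)"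
proof -
  let ?a = "chart_at \<A> (\<iota> y)"
  let ?W = "\<iota> -` (U \<inter> chart_dom ?a)"
  have W: "open ?W" "y \<in> ?W" using U by (auto intro!: open_preimage)
  let ?t = "f \<circ> chart_inv ?a"
  have "dir_deriv \<B> (\<lambda>y. f (\<iota> y)) y u = dir_deriv \<B> (\<lambda>q. ?t ((chart_map ?a \<circ> \<iota>) q)) y u"
    by (rule N.dir_deriv_cong[OF W]) simp
  also have "\<dots> = fderiv ?t ((chart_map ?a \<circ> \<iota>) y) (dir_deriv \<B> (chart_map ?a \<circ> \<iota>) y u)"
    using M.smooth_vfun_differentiable[OF f U M.chart_at]
    by (intro N.dir_deriv_chain[where g = ?t, OF smooth_chart_comp W]) auto
  finally show ?thesis by (simp add: dir_deriv_def[of \<A>] differential_def)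
qed

text \<open>Sections of the pull-back bundle of TM along \<iota>: \<open>Z y\<close> is a tangent
  vector at \<open>\<iota> y\<close>. Its values at two points with the same image may differ, so
  \<open>Z\<close> need not come from a field on M.\<close>

definition smooth_section :: "'n set \<Rightarrow> ('n \<Rightarrow> 'e) \<Rightarrow> bool" where
  "smooth_section V Z \<longleftrightarrow>
     (\<forall>d\<in>\<A>. smooth_vfun \<B> (V \<inter> \<iota> -` chart_dom d) (\<lambda>y. coords \<A> d (\<iota> y) (Z y)))"

lemma smooth_section_coords:
  "smooth_section V Z \<Longrightarrow> d \<in> \<A> \<Longrightarrow> W \<subseteq> V \<Longrightarrow> W \<subseteq> \<iota> -` chart_dom d \<Longrightarrow>
    smooth_vfun \<B> W (\<lambda>y. coords \<A> d (\<iota> y) (Z y))"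
  unfolding smooth_section_def using N.smooth_vfun_subset by (metis Int_subset_iff)

lemma smooth_section_subset: "smooth_section V Z \<Longrightarrow> W \<subseteq> V \<Longrightarrow> smooth_section W Z"
  using smooth_section_coords[of V Z] unfolding smooth_section_def[of W] by (meson Int_lower1 Int_lower2 order_trans)

lemma smooth_section_differential:
  assumes V: "open V" and Y: "smooth_field \<B> V Y"
  shows "smooth_section V (\<lambda>y. d\<iota> y (Y y))"
  unfolding smooth_section_def
proof
  fix d assume d: "d \<in> \<A>"
  let ?W = "V \<inter> \<iota> -` chart_dom d"
  have o: "open ?W" using V d by (auto intro!: open_Int open_preimage)
  show "smooth_vfun \<B> ?W (\<lambda>y. coords \<A> d (\<iota> y) (d\<iota> y (Y y)))"
    by (rule N.smooth_vfun_congI[OF o N.smooth_dir_deriv[OF o smooth_chart_comp[OF d]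
          N.smooth_field_subset[OF Y]]])
       (use d in \<open>auto simp: coords_differential\<close>)
qed

lemma smooth_pulled_back_coords:
  assumes "smooth_field \<A> U F" "open U" "d \<in> \<A>" "W \<subseteq> \<iota> -` U" "W \<subseteq> \<iota> -` chart_dom d"
  shows "smooth_vfun \<B> W (\<lambda>y. coords \<A> d (\<iota> y) (F (\<iota> y)))"
proof -
  have "smooth_vfun \<A> (U \<inter> chart_dom d) (\<lambda>q. coords \<A> d q (F q))"
    using assms by (intro M.smooth_field_coords[OF assms(1)]) auto
  from smooth_pullback[OF this] have "smooth_vfun \<B> (\<iota> -` (U \<inter> chart_dom d)) (\<lambda>y. coords \<A> d (\<iota> y) (F (\<iota> y)))"
    using assms by (simp add: open_Int)
  then show ?thesis by (rule N.smooth_vfun_subset) (use assms in auto)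
qed

lemma smooth_section_local:
  assumes V: "open V" and Z: "\<And>y. y \<in> V \<Longrightarrow> \<exists>d\<in>\<A>. \<exists>W. open W \<and> y \<in> W \<and> W \<subseteq> \<iota> -` chart_dom d \<and>
    smooth_vfun \<B> W (\<lambda>y. coords \<A> d (\<iota> y) (Z y))"
  shows "smooth_section V Z"
  unfolding smooth_section_def
proof (intro ballI N.smooth_vfun_locally)
  fix e y assume e: "e \<in> \<A>" "y \<in> V \<inter> \<iota> -` chart_dom e"
  then obtain d W' where d: "d \<in> \<A>" "open W'" "y \<in> W'" "W' \<subseteq> \<iota> -` chart_dom d"
    "smooth_vfun \<B> W' (\<lambda>y. coords \<A> d (\<iota> y) (Z y))"
    using Z by blast
  define W where "W = W' \<inter> \<iota> -` chart_dom e"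
  have W: "open W" "y \<in> W" "W \<subseteq> \<iota> -` chart_dom d" "W \<subseteq> \<iota> -` chart_dom e" "W \<subseteq> W'"
    using d e by (auto simp: W_def intro!: open_Int open_preimage)
  \<comment> \<open>The change of fibre coordinates from \<open>d\<close> to \<open>e\<close> is a
    linear family over N whose entries are pulled back from the frame of \<open>d\<close> on
    M.\<close>
  have "smooth_vfun \<B> W (\<lambda>y. coords \<A> e (\<iota> y) (of_coords \<A> d (\<iota> y) (coords \<A> d (\<iota> y) (Z y))))"
  proof (rule N.smooth_linear_family[where T = "\<lambda>y u. coords \<A> e (\<iota> y) (of_coords \<A> d (\<iota> y) u)"
        and f = "\<lambda>y. coords \<A> d (\<iota> y) (Z y)", OF W(1)])
    fix p assume "p \<in> W"
    then show "linear (\<lambda>u. coords \<A> e (\<iota> p) (of_coords \<A> d (\<iota> p) u))"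
      using W e d linear_compose[OF M.linear_of_coords[OF d(1)] M.linear_coords[OF e(1)]]
      by (auto simp: o_def subset_iff)
  next
    show "smooth_vfun \<B> W (\<lambda>y. coords \<A> e (\<iota> y) (of_coords \<A> d (\<iota> y) u))" for u
      using W e d by (intro smooth_pulled_back_coords[OF M.smooth_field_const[OF d(1)]]) auto
  qed (rule N.smooth_vfun_subset[OF d(5) W(5)])
  then have "smooth_vfun \<B> W (\<lambda>y. coords \<A> e (\<iota> y) (Z y))"
    by (rule N.smooth_vfun_congI[OF W(1)]) (use W d in \<open>auto simp: subset_iff\<close>)
  then show "\<exists>W. open W \<and> y \<in> W \<and> smooth_vfun \<B> W (\<lambda>y. coords \<A> e (\<iota> y) (Z y))"
    using W by blast
qed

end

section \<open>Two-forms along a map\<close>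

locale manifold_map_form = manifold_map \<A> \<B> \<iota> + M: manifold_form \<A> \<omega>
  for \<A> :: "('m::{t2_space, second_countable_topology}, 'e::euclidean_space) atlas"
    and \<B> :: "('n::{t2_space, second_countable_topology}, 'f::euclidean_space) atlas"
    and \<iota> :: "'n \<Rightarrow> 'm" and \<omega>
begin

lemma form_frame:
  assumes d: "d \<in> \<A>"
  shows "\<iota> y \<in> chart_dom d \<Longrightarrow> bilinear (\<lambda>u v. \<omega> (\<iota> y) (of_coords \<A> d (\<iota> y) u) (of_coords \<A> d (\<iota> y) v))"
    and "W \<subseteq> \<iota> -` chart_dom d \<Longrightarrow>
      smooth_vfun \<B> W (\<lambda>y. \<omega> (\<iota> y) (of_coords \<A> d (\<iota> y) u) (of_coords \<A> d (\<iota> y) v))"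
proof -
  assume "\<iota> y \<in> chart_dom d"
  note lin = M.linear_of_coords[OF d this]
  show "bilinear (\<lambda>u v. \<omega> (\<iota> y) (of_coords \<A> d (\<iota> y) u) (of_coords \<A> d (\<iota> y) v))"
    unfolding bilinear_def
    by (intro conjI allI linearI) (simp_all add: linear_add[OF lin] linear_cmul[OF lin] M.form_simps)
next
  assume W: "W \<subseteq> \<iota> -` chart_dom d"
  have "smooth_vfun \<A> (chart_dom d) (\<lambda>q. \<omega> q (of_coords \<A> d q u) (of_coords \<A> d q v))"
    using d by (intro M.smooth_form M.smooth_field_const) auto
  from N.smooth_vfun_subset[OF smooth_pullback[OF this] W] d
  show "smooth_vfun \<B> W (\<lambda>y. \<omega> (\<iota> y) (of_coords \<A> d (\<iota> y) u) (of_coords \<A> d (\<iota> y) v))"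
    by simp
qed

text \<open>\<open>two_form\<close> promises smoothness on fields of M only. In a frame the pairing
  of two sections is a bilinear family whose coefficients, the pairings of frame fields, are pulled
  back from M.\<close>

lemma smooth_form_sections:
  assumes V: "open V" and Z: "smooth_section V Z" "smooth_section V Z'"
  shows "smooth_vfun \<B> V (\<lambda>y. \<omega> (\<iota> y) (Z y) (Z' y))"
proof (rule N.smooth_vfun_locally)
  fix y assume y: "y \<in> V"
  let ?d = "chart_at \<A> (\<iota> y)"
  define W where "W = V \<inter> \<iota> -` chart_dom ?d"
  have W: "open W" "y \<in> W" "W \<subseteq> V" "W \<subseteq> \<iota> -` chart_dom ?d"
    using y V by (auto simp: W_def intro!: open_Int open_preimage)
  let ?E = "\<lambda>y. of_coords \<A> ?d (\<iota> y)" and ?C = "\<lambda>y. coords \<A> ?d (\<iota> y)"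
  have "smooth_vfun \<B> W (\<lambda>y. \<omega> (\<iota> y) (?E y (?C y (Z y))) (?E y (?C y (Z' y))))"
    by (rule N.smooth_bilinear_family[where T = "\<lambda>y u v. \<omega> (\<iota> y) (?E y u) (?E y v)"
          and f = "\<lambda>y. ?C y (Z y)" and g = "\<lambda>y. ?C y (Z' y)", OF W(1)])
       (use W in \<open>auto intro!: form_frame smooth_section_coords[OF Z(1)] smooth_section_coords[OF Z(2)]\<close>)
  then have "smooth_vfun \<B> W (\<lambda>y. \<omega> (\<iota> y) (Z y) (Z' y))"
    by (rule N.smooth_vfun_congI[OF W(1)]) (use W in \<open>auto simp: subset_iff\<close>)
  then show "\<exists>W. open W \<and> y \<in> W \<and> smooth_vfun \<B> W (\<lambda>y. \<omega> (\<iota> y) (Z y) (Z' y))"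
    using W by blast
qed

lemma two_form_pullback: "two_form \<B> (pullback_form \<B> \<A> \<iota> \<omega>)"
  unfolding two_form_def smooth_fun_eq_vfun
proof (intro conjI allI impI; (elim conjE)?)
  fix x
  show "bilinear (pullback_form \<B> \<A> \<iota> \<omega> x)"
    unfolding bilinear_def pullback_form_def
    by (intro conjI allI linearI)
       (simp_all add: linear_add[OF linear_differential] linear_cmul[OF linear_differential] M.form_simps)
  show "pullback_form \<B> \<A> \<iota> \<omega> x u u = 0" for u
    using M.two_form by (simp add: pullback_form_def two_form_def)
next
  fix V X Y assume "open V" "smooth_field \<B> V X" "smooth_field \<B> V Y"
  then show "smooth_vfun \<B> V (\<lambda>x. pullback_form \<B> \<A> \<iota> \<omega> x (X x) (Y x))"
    unfolding pullback_form_def by (intro smooth_form_sections smooth_section_differential)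
qed

end

section \<open>Covariant derivatives along a map\<close>

locale manifold_map_connection = manifold_map \<A> \<B> \<iota> + M: manifold_connection \<A> D
  for \<A> :: "('m::{t2_space, second_countable_topology}, 'e::euclidean_space) atlas"
    and \<B> :: "('n::{t2_space, second_countable_topology}, 'f::euclidean_space) atlas"
    and \<iota> :: "'n \<Rightarrow> 'm" and D
begin

abbreviation cov_along :: "('n \<Rightarrow> 'f) \<Rightarrow> ('n \<Rightarrow> 'e) \<Rightarrow> 'n \<Rightarrow> 'e" where
  "cov_along \<equiv> cov_deriv_along \<B> \<A> \<iota> D"

lemma cov_along_eq:
  "cov_along X Z x = dir_deriv \<B> (\<lambda>y. coords \<A> (chart_at \<A> (\<iota> x)) (\<iota> y) (Z y)) x (X x)
    + tensor_at \<A> D (\<iota> x) (d\<iota> x (X x)) (Z x)"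
  by (simp add: cov_deriv_along_def tensor_at_def)

lemmas christoffel_simps =
  bilinear_ladd[OF M.bilinear_christoffel] bilinear_radd[OF M.bilinear_christoffel]
  bilinear_lmul[OF M.bilinear_christoffel] bilinear_rmul[OF M.bilinear_christoffel]

context
  fixes V :: "'n set" and x :: 'n and Z :: "'n \<Rightarrow> 'e"
  assumes V: "open V" "x \<in> V" and Z: "smooth_section V Z"
begin

lemma preferred_chart_neighbourhood:
  obtains W where "open W" "x \<in> W" "W \<subseteq> V" "W \<subseteq> \<iota> -` chart_dom (chart_at \<A> (\<iota> x))"
  using V by (intro that[of "V \<inter> \<iota> -` chart_dom (chart_at \<A> (\<iota> x))"])
    (auto intro!: open_Int open_preimage)

lemma cov_along_add_left: "cov_along (\<lambda>y. X y + X' y) Z x = cov_along X Z x + cov_along X' Z x"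
proof -
  obtain W where W: "open W" "x \<in> W" "W \<subseteq> V" "W \<subseteq> \<iota> -` chart_dom (chart_at \<A> (\<iota> x))"
    by (rule preferred_chart_neighbourhood)
  have "smooth_vfun \<B> W (\<lambda>y. coords \<A> (chart_at \<A> (\<iota> x)) (\<iota> y) (Z y))"
    by (rule smooth_section_coords[OF Z M.chart_at(1) W(3,4)])
  from linear_add[OF N.dir_deriv_linear_dir[OF W(1,2) this]]
  show ?thesis by (simp add: cov_along_eq linear_add[OF linear_differential] christoffel_simps)
qed

lemma cov_along_scale_left: "cov_along (\<lambda>y. f y *\<^sub>R X y) Z x = f x *\<^sub>R cov_along X Z x"
proof -
  obtain W where W: "open W" "x \<in> W" "W \<subseteq> V" "W \<subseteq> \<iota> -` chart_dom (chart_at \<A> (\<iota> x))"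
    by (rule preferred_chart_neighbourhood)
  have "smooth_vfun \<B> W (\<lambda>y. coords \<A> (chart_at \<A> (\<iota> x)) (\<iota> y) (Z y))"
    by (rule smooth_section_coords[OF Z M.chart_at(1) W(3,4)])
  from linear_cmul[OF N.dir_deriv_linear_dir[OF W(1,2) this]]
  show ?thesis
    by (simp add: cov_along_eq linear_cmul[OF linear_differential] christoffel_simps scaleR_add_right)
qed

lemma cov_along_add_right:
  assumes Z': "smooth_section V Z'"
  shows "cov_along X (\<lambda>y. Z y + Z' y) x = cov_along X Z x + cov_along X Z' x"
proof -
  obtain W where W: "open W" "x \<in> W" "W \<subseteq> V" "W \<subseteq> \<iota> -` chart_dom (chart_at \<A> (\<iota> x))"
    by (rule preferred_chart_neighbourhood)
  let ?C = "\<lambda>y. coords \<A> (chart_at \<A> (\<iota> x)) (\<iota> y)"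
  have s: "smooth_vfun \<B> W (\<lambda>y. ?C y (Z y))" "smooth_vfun \<B> W (\<lambda>y. ?C y (Z' y))"
    by (rule smooth_section_coords[OF _ M.chart_at(1) W(3,4)], rule Z Z')+
  have "dir_deriv \<B> (\<lambda>y. ?C y (Z y + Z' y)) x (X x) = dir_deriv \<B> (\<lambda>y. ?C y (Z y) + ?C y (Z' y)) x (X x)"
    by (rule N.dir_deriv_cong[OF W(1,2)])
       (use W in \<open>auto simp: linear_add[OF M.linear_coords] subset_iff\<close>)
  then show ?thesis by (simp add: cov_along_eq N.dir_deriv_add[OF W(1,2) s] christoffel_simps)
qed

lemma cov_along_leibniz:
  assumes f: "smooth_vfun \<B> V f"
  shows "cov_along X (\<lambda>y. f y *\<^sub>R Z y) x = dir_deriv \<B> f x (X x) *\<^sub>R Z x + f x *\<^sub>R cov_along X Z x"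
proof -
  obtain W where W: "open W" "x \<in> W" "W \<subseteq> V" "W \<subseteq> \<iota> -` chart_dom (chart_at \<A> (\<iota> x))"
    by (rule preferred_chart_neighbourhood)
  let ?C = "\<lambda>y. coords \<A> (chart_at \<A> (\<iota> x)) (\<iota> y)"
  have s: "smooth_vfun \<B> W f" "smooth_vfun \<B> W (\<lambda>y. ?C y (Z y))"
    by (rule N.smooth_vfun_subset[OF f W(3)], rule smooth_section_coords[OF Z M.chart_at(1) W(3,4)])
  have "dir_deriv \<B> (\<lambda>y. ?C y (f y *\<^sub>R Z y)) x (X x) = dir_deriv \<B> (\<lambda>y. f y *\<^sub>R ?C y (Z y)) x (X x)"
    by (rule N.dir_deriv_cong[OF W(1,2)])
       (use W in \<open>auto simp: linear_cmul[OF M.linear_coords] subset_iff\<close>)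
  then show ?thesis
    by (simp add: cov_along_eq N.dir_deriv_scaleR[OF W(1,2) s] christoffel_simps scaleR_add_right)
qed

text \<open>The defining formula of \<open>cov_deriv_along\<close> uses the chart preferred at \<open>\<iota> x\<close>; it holds in every
  chart around \<open>\<iota> x\<close>, which is what makes the result depend smoothly on \<open>x\<close>.\<close>

lemma cov_along_frame:
  assumes d: "d \<in> \<A>" "\<iota> x \<in> chart_dom d"
  shows "cov_along X Z x = of_coords \<A> d (\<iota> x) (dir_deriv \<B> (\<lambda>y. coords \<A> d (\<iota> y) (Z y)) x (X x))
    + D (\<lambda>q. of_coords \<A> d q (coords \<A> d (\<iota> x) (d\<iota> x (X x))))
        (\<lambda>q. of_coords \<A> d q (coords \<A> d (\<iota> x) (Z x))) (\<iota> x)"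
proof -
  let ?a = "chart_at \<A> (\<iota> x)"
  define U where "U = chart_dom ?a \<inter> chart_dom d"
  define W where "W = V \<inter> \<iota> -` U"
  have U: "open U" "\<iota> x \<in> U" "U \<subseteq> chart_dom d" "U \<subseteq> chart_dom ?a" using d by (auto simp: U_def)
  have W: "open W" "x \<in> W" "W \<subseteq> V" "W \<subseteq> \<iota> -` chart_dom d" "W \<subseteq> \<iota> -` chart_dom ?a"
    using V U by (auto simp: W_def intro!: open_Int open_preimage)
  let ?E = "\<lambda>u q. of_coords \<A> d q u"
  define T where "T y u = coords \<A> ?a (\<iota> y) (?E u (\<iota> y))" for y u
  define g where "g y = coords \<A> d (\<iota> y) (Z y)" for y
  define w where "w = coords \<A> d (\<iota> x) (d\<iota> x (X x))"
  have E: "smooth_field \<A> U (?E u)" for u by (rule M.smooth_frame[OF d(1) U(3)])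
  have E_w: "?E w (\<iota> x) = d\<iota> x (X x)" and E_g: "?E (g x) (\<iota> x) = Z x"
    using d by (simp_all add: w_def g_def)
  have lin: "linear (T y)" if "y \<in> W" for y
  proof -
    have y: "\<iota> y \<in> chart_dom d" "\<iota> y \<in> chart_dom ?a" using that W by auto
    show ?thesis
      unfolding T_def[abs_def]
      using linear_compose[OF M.linear_of_coords[OF d(1) y(1)] M.linear_coords[OF M.chart_at(1) y(2)]]
      by (simp add: o_def)
  qed
  have T: "smooth_vfun \<B> W (\<lambda>y. T y u)" for u
    unfolding T_def using W U by (intro smooth_pulled_back_coords[OF E U(1) M.chart_at(1)]) (auto simp: W_def)
  have g: "smooth_vfun \<B> W g"
    unfolding g_def[abs_def] by (rule smooth_section_coords[OF Z d(1) W(3,4)])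
  have "dir_deriv \<B> (\<lambda>y. coords \<A> ?a (\<iota> y) (Z y)) x (X x) = dir_deriv \<B> (\<lambda>y. T y (g y)) x (X x)"
    by (rule N.dir_deriv_cong[OF W(1,2)]) (use W d in \<open>auto simp: T_def g_def\<close>)
  also have "\<dots> = dir_deriv \<B> (\<lambda>y. T y (g x)) x (X x) + T x (dir_deriv \<B> g x (X x))"
    by (rule N.dir_deriv_linear_family[OF W(1) lin T g W(2)])
  \<comment> \<open>The derivative of the coordinate change along \<iota> is taken on M, where
    \<open>conn_preferred_chart\<close> expresses it by \<open>D\<close> on frame fields. This is
    the inhomogeneous term in the transformation law of Christoffel symbols.\<close>
  also have "dir_deriv \<B> (\<lambda>y. T y (g x)) x (X x)
      = dir_deriv \<A> (\<lambda>q. coords \<A> ?a q (?E (g x) q)) (\<iota> x) (?E w (\<iota> x))"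
    unfolding T_def E_w
    by (rule dir_deriv_pullback[OF M.smooth_field_coords[OF E U(1) M.chart_at(1) subset_refl U(4)] U(1,2)])
  also have "\<dots> = D (?E w) (?E (g x)) (\<iota> x) - tensor_at \<A> D (\<iota> x) (d\<iota> x (X x)) (Z x)"
    using M.conn_preferred_chart[OF U(1,2) E E, of w "g x"] by (simp add: E_w E_g)
  finally show ?thesis
    by (simp add: cov_along_eq T_def g_def[abs_def] w_def)
qed

end

lemma cov_along_cong:
  assumes V: "open V" "x \<in> V" and eq: "X x = X' x" "\<And>y. y \<in> V \<Longrightarrow> Z y = Z' y"
  shows "cov_along X Z x = cov_along X' Z' x"
proof -
  have "dir_deriv \<B> (\<lambda>y. coords \<A> (chart_at \<A> (\<iota> x)) (\<iota> y) (Z y)) x (X x)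
      = dir_deriv \<B> (\<lambda>y. coords \<A> (chart_at \<A> (\<iota> x)) (\<iota> y) (Z' y)) x (X x)"
    by (rule N.dir_deriv_cong[OF V]) (simp add: eq)
  then show ?thesis using V by (simp add: cov_along_eq eq)
qed

text \<open>On \<open>W\<close> all values are computed in the single chart \<open>?d\<close> by
  \<open>cov_along_frame\<close>: a directional derivative of smooth coordinates plus the
  Christoffel symbols of \<open>?d\<close>, a bilinear family applied to smooth functions.\<close>

lemma smooth_section_cov_along:
  assumes V: "open V" and X: "smooth_field \<B> V X" and Z: "smooth_section V Z"
  shows "smooth_section V (cov_along X Z)"
proof (rule smooth_section_local[OF V])
  fix y assume y: "y \<in> V"
  let ?d = "chart_at \<A> (\<iota> y)"
  define W where "W = V \<inter> \<iota> -` chart_dom ?d"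
  have W: "open W" "y \<in> W" "W \<subseteq> V" "W \<subseteq> \<iota> -` chart_dom ?d"
    using y V by (auto simp: W_def intro!: open_Int open_preimage)
  let ?E = "\<lambda>u q. of_coords \<A> ?d q u" and ?C = "\<lambda>y. coords \<A> ?d (\<iota> y)"
  define T where "T y u v = ?C y (D (?E u) (?E v) (\<iota> y))" for y u v
  have bil: "bilinear (T p)" if "p \<in> W" for p
  proof -
    have p: "\<iota> p \<in> chart_dom ?d" using that W by auto
    note l = M.linear_coords[OF M.chart_at(1) p] and b = M.bilinear_conn_frame[OF M.chart_at(1) p]
    show ?thesis
      unfolding bilinear_def T_def
      by (intro conjI allI linearI)
         (simp_all add: bilinear_ladd[OF b] bilinear_radd[OF b] bilinear_lmul[OF b] bilinear_rmul[OF b]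
           linear_add[OF l] linear_cmul[OF l])
  qed
  have T: "smooth_vfun \<B> W (\<lambda>p. T p u v)" for u v
  proof -
    have "smooth_field \<A> (chart_dom ?d) (D (?E u) (?E v))"
      by (intro M.smooth_conn M.smooth_field_const) auto
    then show ?thesis
      unfolding T_def by (rule smooth_pulled_back_coords) (use W in auto)
  qed
  have s: "smooth_vfun \<B> W (\<lambda>p. ?C p (Z p))" "smooth_vfun \<B> W (\<lambda>p. ?C p (d\<iota> p (X p)))"
    by (rule smooth_section_coords[OF _ M.chart_at(1) W(3,4)],
        rule Z smooth_section_differential[OF V X])+
  have "smooth_vfun \<B> W (\<lambda>p. dir_deriv \<B> (\<lambda>y. ?C y (Z y)) p (X p) + T p (?C p (d\<iota> p (X p))) (?C p (Z p)))"
    by (rule N.smooth_vfun_add[OF W(1) N.smooth_dir_deriv[OF W(1) s(1) N.smooth_field_subset[OF X W(3)]]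
        N.smooth_bilinear_family[where T = T and f = "\<lambda>p. ?C p (d\<iota> p (X p))" and g = "\<lambda>p. ?C p (Z p)",
          OF W(1) bil T s(2,1)]])
  then have "smooth_vfun \<B> W (\<lambda>p. ?C p (cov_along X Z p))"
  proof (rule N.smooth_vfun_congI[OF W(1)])
    fix p assume p: "p \<in> W"
    then have p': "p \<in> V" "\<iota> p \<in> chart_dom ?d" using W by auto
    show "?C p (cov_along X Z p) = dir_deriv \<B> (\<lambda>y. ?C y (Z y)) p (X p)
        + T p (?C p (d\<iota> p (X p))) (?C p (Z p))"
      using p' by (simp add: cov_along_frame[OF V p'(1) Z M.chart_at(1) p'(2)] T_def
          linear_add[OF M.linear_coords])
  qed
  then show "\<exists>d\<in>\<A>. \<exists>W. open W \<and> y \<in> W \<and> W \<subseteq> \<iota> -` chart_dom d \<and>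
      smooth_vfun \<B> W (\<lambda>y. coords \<A> d (\<iota> y) (cov_along X Z y))"
    using W by blast
qed

text \<open>In the preferred charts the difference \<open>\<nabla>\<^sub>X(d\<iota> Y) - \<nabla>\<^sub>Y(d\<iota> X) - d\<iota>[X,Y]\<close> of coordinate
  derivatives reduces to the second derivative of \<open>\<iota>\<close>, which is symmetric.\<close>

lemma dir_deriv_differential:
  assumes V: "open V" "x \<in> V" and X: "smooth_field \<B> V X"
  defines "c \<equiv> chart_at \<B> x" and "a \<equiv> chart_at \<A> (\<iota> x)"
  defines "F \<equiv> chart_map a \<circ> \<iota> \<circ> chart_inv c"
  shows "dir_deriv \<B> (\<lambda>y. coords \<A> a (\<iota> y) (d\<iota> y (X y))) x v
    = fderiv (\<lambda>z. fderiv F z (X x)) (chart_map c x) v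
      + d\<iota> x (fderiv (field_in_chart \<B> c X) (chart_map c x) v)"
proof -
  have c: "c \<in> \<B>" "x \<in> chart_dom c" and a: "a \<in> \<A>" "\<iota> x \<in> chart_dom a" by (auto simp: c_def a_def)
  define W where "W = V \<inter> chart_dom c \<inter> \<iota> -` chart_dom a"
  have W: "open W" "x \<in> W" "W \<subseteq> V" "W \<subseteq> chart_dom c" "W \<subseteq> \<iota> -` chart_dom a"
    using V c a by (auto simp: W_def intro!: open_Int open_preimage)
  let ?S = "chart_map c ` W" and ?X = "field_in_chart \<B> c X"
  have S: "open ?S" "chart_map c x \<in> ?S" using W c by (auto intro: N.open_chart_image)
  have s: "smooth_vfun \<B> W (chart_map a \<circ> \<iota>)" by (rule smooth_chart_comp[OF a(1) W(5)])
  have F: "smooth_on ?S F"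
    unfolding F_def by (rule N.smooth_vfun_chart[OF s c(1) subset_refl W(4)])
  have "smooth_vfun \<B> W (\<lambda>q. coords \<B> c q (X q))"
    by (rule N.smooth_field_coords[OF X V(1) c(1) W(3,4)])
  from N.smooth_vfun_differentiable[OF this W(1,2) c]
  have dX: "?X differentiable (at (chart_map c x))"
    by (simp add: field_in_chart_def[abs_def] o_def)
  have X0: "?X (chart_map c x) = X x" using c by (simp add: field_in_chart_def) (simp add: c_def)
  have "dir_deriv \<B> (\<lambda>y. coords \<A> a (\<iota> y) (d\<iota> y (X y))) x v
      = fderiv ((\<lambda>y. coords \<A> a (\<iota> y) (d\<iota> y (X y))) \<circ> chart_inv c) (chart_map c x) v"
    by (simp add: dir_deriv_def c_def)
  \<comment> \<open>In the charts \<open>c\<close> and \<open>a\<close> the map is \<open>F\<close>,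
    and the pushed-forward field is the derivative of \<open>F\<close> in the moving direction
    \<open>?X\<close>.\<close>
  also have "\<dots> = fderiv (\<lambda>z. fderiv F z (?X z)) (chart_map c x) v"
  proof (rule fun_cong[OF fderiv_cong_open[OF S]])
    fix z assume "z \<in> ?S"
    then obtain y where y: "y \<in> W" "z = chart_map c y" "chart_inv c z = y" using W c by auto
    have y': "y \<in> chart_dom c" "\<iota> y \<in> chart_dom a" using y W by auto
    show "((\<lambda>y. coords \<A> a (\<iota> y) (d\<iota> y (X y))) \<circ> chart_inv c) z = fderiv F z (?X z)"
      using coords_differential[OF a(1) y'(2)] N.dir_deriv_chart[OF s W(1) y(1) c(1) y'(1)]
      by (simp add: y(3) field_in_chart_def F_def) (simp add: y(2))
  qed
  also have "\<dots> = fderiv (\<lambda>z. fderiv F z (X x)) (chart_map c x) v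
      + fderiv F (chart_map c x) (fderiv ?X (chart_map c x) v)"
    using fderiv_smooth_field[OF S F dX] by (simp add: X0)
  also have "fderiv F (chart_map c x) u = d\<iota> x u" for u
    by (simp add: F_def differential_def dir_deriv_def a_def c_def)
  finally show ?thesis .
qed

text \<open>Once the second derivatives of \<iota> cancel, the derivatives of the coordinates of
  \<open>X\<close> and \<open>Y\<close> make up the image of their bracket. What remains is the
  antisymmetrised Christoffel symbols, which \<open>torsion_at\<close> identifies as the
  torsion.\<close>

lemma torsion_along:
  assumes V: "open V" "x \<in> V" and X: "smooth_field \<B> V X" and Y: "smooth_field \<B> V Y"
  shows "cov_along X (\<lambda>y. d\<iota> y (Y y)) x - cov_along Y (\<lambda>y. d\<iota> y (X y)) x - d\<iota> x (lie_bracket \<B> X Y x)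
    = tensor_at \<A> (torsion \<A> D) (\<iota> x) (d\<iota> x (X x)) (d\<iota> x (Y x))"
proof -
  let ?c = "chart_at \<B> x" and ?a = "chart_at \<A> (\<iota> x)"
  let ?F = "chart_map ?a \<circ> \<iota> \<circ> chart_inv ?c"
  let ?W = "chart_dom ?c \<inter> \<iota> -` chart_dom ?a"
  have W: "open ?W" by (auto intro!: open_Int open_preimage)
  have "smooth_on (chart_map ?c ` ?W) ?F"
    using N.smooth_vfun_chart[OF smooth_chart_comp[OF M.chart_at(1) Int_lower2] N.chart_at(1) subset_refl Int_lower1]
    by (simp add: o_assoc)
  then have sym: "fderiv (\<lambda>z. fderiv ?F z (Y x)) (chart_map ?c x) (X x)
      = fderiv (\<lambda>z. fderiv ?F z (X x)) (chart_map ?c x) (Y x)"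
    by (intro fderiv_symmetric[of "chart_map ?c ` ?W"] N.open_chart_image W) auto
  show ?thesis
    using sym
    by (simp add: cov_along_eq dir_deriv_differential[OF V X] dir_deriv_differential[OF V Y]
        lie_bracket_def Let_def linear_diff[OF linear_differential] M.torsion_at)
qed

end

section \<open>Parallel two-forms along a map\<close>

locale manifold_map_form_connection =
  manifold_map_form \<A> \<B> \<iota> \<omega> + manifold_map_connection \<A> \<B> \<iota> D
  for \<A> :: "('m::{t2_space, second_countable_topology}, 'e::euclidean_space) atlas"
    and \<B> :: "('n::{t2_space, second_countable_topology}, 'f::euclidean_space) atlas"
    and \<iota> :: "'n \<Rightarrow> 'm" and \<omega> D +
  assumes preserves_form: "preserves_two_form \<A> D \<omega>"
begin

text \<open>\<open>preserves_form\<close> concerns fields on M, while \<open>Z\<close> and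
  \<open>Z'\<close> are only sections along \<iota>. With their coordinates frozen at
  \<open>x\<close> they become frame fields on M, to which parallelism applies; the derivatives of
  the coordinates restore the missing halves of the covariant derivatives.\<close>

lemma cov_along_preserves_form:
  assumes V: "open V" "x \<in> V" and Z: "smooth_section V Z" "smooth_section V Z'"
  shows "dir_deriv \<B> (\<lambda>y. \<omega> (\<iota> y) (Z y) (Z' y)) x (X x)
    = \<omega> (\<iota> x) (cov_along X Z x) (Z' x) + \<omega> (\<iota> x) (Z x) (cov_along X Z' x)"
proof -
  let ?a = "chart_at \<A> (\<iota> x)"
  define W where "W = V \<inter> \<iota> -` chart_dom ?a"
  have W: "open W" "x \<in> W" "W \<subseteq> V" "W \<subseteq> \<iota> -` chart_dom ?a"
    using V by (auto simp: W_def intro!: open_Int open_preimage)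
  let ?U = "chart_dom ?a" and ?K = "const_field \<A> (\<iota> x)"
  let ?C = "\<lambda>y. coords \<A> ?a (\<iota> y)" and ?E = "\<lambda>u q. of_coords \<A> ?a q u"
  define T where "T y u v = \<omega> (\<iota> y) (?E u (\<iota> y)) (?E v (\<iota> y))" for y u v
  have bil: "bilinear (T y)" if "y \<in> W" for y
    unfolding T_def[abs_def] by (rule form_frame(1)) (use that W in auto)
  have T: "smooth_vfun \<B> W (\<lambda>y. T y u v)" for u v
    unfolding T_def by (rule form_frame(2)[OF M.chart_at(1) W(4)])
  have s: "smooth_vfun \<B> W (\<lambda>y. ?C y (Z y))" "smooth_vfun \<B> W (\<lambda>y. ?C y (Z' y))"
    by (rule smooth_section_coords[OF _ M.chart_at(1) W(3,4)], rule Z)+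
  have "dir_deriv \<B> (\<lambda>y. \<omega> (\<iota> y) (Z y) (Z' y)) x (X x)
      = dir_deriv \<B> (\<lambda>y. T y (?C y (Z y)) (?C y (Z' y))) x (X x)"
    by (rule N.dir_deriv_cong[OF W(1,2)]) (use W in \<open>auto simp: T_def subset_iff\<close>)
  also have "\<dots> = dir_deriv \<B> (\<lambda>y. T y (Z x) (Z' x)) x (X x)
      + \<omega> (\<iota> x) (dir_deriv \<B> (\<lambda>y. ?C y (Z y)) x (X x)) (Z' x)
      + \<omega> (\<iota> x) (Z x) (dir_deriv \<B> (\<lambda>y. ?C y (Z' y)) x (X x))"
    using N.dir_deriv_bilinear_family[where T = T and f = "\<lambda>y. ?C y (Z y)" and g = "\<lambda>y. ?C y (Z' y)",
        OF W(1) bil T s W(2), of "X x"]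
    by (simp add: T_def)
  also have "dir_deriv \<B> (\<lambda>y. T y (Z x) (Z' x)) x (X x)
      = dir_deriv \<A> (\<lambda>q. \<omega> q (?K (Z x) q) (?K (Z' x) q)) (\<iota> x) (d\<iota> x (X x))"
    unfolding T_def const_field_def
    by (rule dir_deriv_pullback[of ?U]) (auto intro!: M.smooth_form M.smooth_field_const)
  also have "\<dots> = \<omega> (\<iota> x) (tensor_at \<A> D (\<iota> x) (d\<iota> x (X x)) (Z x)) (Z' x)
      + \<omega> (\<iota> x) (Z x) (tensor_at \<A> D (\<iota> x) (d\<iota> x (X x)) (Z' x))"
  proof -
    have K: "smooth_field \<A> ?U (?K u)" for u by (rule M.smooth_const_field) simp
    have "cov_deriv_form \<A> D \<omega> (?K (d\<iota> x (X x))) (?K (Z x)) (?K (Z' x)) (\<iota> x) = 0"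
      using preserves_form K unfolding preserves_two_form_def
      by (meson M.chart_at M.open_chart_dom)
    then show ?thesis by (simp add: cov_deriv_form_def tensor_at_def)
  qed
  finally show ?thesis by (simp add: cov_along_eq M.form_simps)
qed

end

section \<open>The induced connection\<close>

context manifold_nondegenerate_form
begin

text \<open>In finite dimension the injective map sending \<open>w\<close> to its pairings is
  surjective. Applied to the form on N, this gives the existence of the tangential part.\<close>

lemma form_represents:
  assumes "linear l"
  obtains w where "\<And>v. \<omega> x w v = l v"
proof -
  define L where "L w = (\<Sum>b\<in>Basis. \<omega> x w b *\<^sub>R b)" for w
  have L_b: "L w \<bullet> b = \<omega> x w b" if "b \<in> Basis" for w b
    unfolding L_def using inner_sum_left_Basis[OF that, of "\<lambda>b. \<omega> x w b"] by simp
  have lin: "linear L"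
    by (rule linearI) (simp_all add: L_def form_simps scaleR_add_left sum.distrib scaleR_sum_right)
  have eq: "\<omega> x w v = l v" if "\<And>b. b \<in> Basis \<Longrightarrow> \<omega> x w b = l b" "linear l" for w v l
  proof -
    have "linear (\<omega> x w)" using bilinear_form by (simp add: bilinear_def)
    from linear_expand[OF this, of v] linear_expand[OF that(2), of v] show ?thesis
      using that(1) by simp
  qed
  have "inj L"
    unfolding linear_injective_0[OF lin]
  proof (intro allI impI)
    fix w assume "L w = 0"
    then have "\<omega> x w v = 0" for v
      using eq[of w "\<lambda>v. 0" v] L_b[of _ w] by (simp add: linearI)
    then show "w = 0" by (intro form_eqI) (simp add: form_simps)
  qed
  then obtain w where w: "L w = (\<Sum>b\<in>Basis. l b *\<^sub>R b)"
    using linear_injective_imp_surjective[OF lin] by (metis surjD)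
  have "\<omega> x w b = l b" if "b \<in> Basis" for b
    using L_b[OF that, of w] inner_sum_left_Basis[OF that, of l] by (simp add: w)
  then show ?thesis using that eq[OF _ assms] by blast
qed

end

section \<open>Tangential projection and the connection on the submanifold\<close>

locale almost_symplectic_map = manifold_map_form_connection \<A> \<B> \<iota> \<omega> D
  for \<A> :: "('m::{t2_space, second_countable_topology}, 'e::euclidean_space) atlas"
    and \<B> :: "('n::{t2_space, second_countable_topology}, 'f::euclidean_space) atlas"
    and \<iota> :: "'n \<Rightarrow> 'm" and \<omega> D +
  assumes nondegenerate_pullback: "nondegenerate (pullback_form \<B> \<A> \<iota> \<omega>)"
begin

abbreviation \<omega>\<^sub>N :: "'n \<Rightarrow> 'f \<Rightarrow> 'f \<Rightarrow> real" where
  "\<omega>\<^sub>N \<equiv> pullback_form \<B> \<A> \<iota> \<omega>"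

abbreviation D\<^sub>N :: "('n \<Rightarrow> 'f) \<Rightarrow> ('n \<Rightarrow> 'f) \<Rightarrow> 'n \<Rightarrow> 'f" where
  "D\<^sub>N \<equiv> induced_connection \<B> \<A> \<iota> \<omega> D"

abbreviation (input) pushed :: "('n \<Rightarrow> 'f) \<Rightarrow> 'n \<Rightarrow> 'e" where
  "pushed Y \<equiv> \<lambda>y. d\<iota> y (Y y)"

sublocale F: manifold_nondegenerate_form \<B> \<omega>\<^sub>N
  by unfold_locales (rule two_form_pullback nondegenerate_pullback)+

text \<open>That \<open>u - d\<iota> x w\<close> is normal means precisely that \<open>w\<close>
  represents the functional \<open>\<omega>(u, d\<iota> v)\<close> under the form on N. Such
  \<open>w\<close> exists and is unique by non-degeneracy, so the definite description is
  meaningful; afterwards \<open>tangential\<close> is handled only through this identity.\<close>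

lemma tangential_form: "\<omega>\<^sub>N x (tangential \<B> \<A> \<iota> \<omega> x u) v = \<omega> (\<iota> x) u (d\<iota> x v)"
proof -
  have normal: "u - d\<iota> x w \<in> normal_space \<B> \<A> \<iota> \<omega> x \<longleftrightarrow> (\<forall>v. \<omega>\<^sub>N x w v = \<omega> (\<iota> x) u (d\<iota> x v))" for w
    by (auto simp: normal_space_def pullback_form_def M.form_simps)
  have "linear (\<lambda>v. \<omega> (\<iota> x) u (d\<iota> x v))"
    by (rule linearI) (simp_all add: linear_add[OF linear_differential] linear_cmul[OF linear_differential] M.form_simps)
  then obtain w where w: "\<And>v. \<omega>\<^sub>N x w v = \<omega> (\<iota> x) u (d\<iota> x v)"
    using F.form_represents by blast
  have "\<exists>!w. u - d\<iota> x w \<in> normal_space \<B> \<A> \<iota> \<omega> x"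
    unfolding normal by (rule ex1I[of _ w]) (auto intro!: F.form_eqI[of x] simp: w)
  from theI'[OF this] show ?thesis by (simp add: tangential_def normal)
qed

lemma tangential_eqI:
  "(\<And>v. \<omega> (\<iota> x) u (d\<iota> x v) = \<omega>\<^sub>N x w v) \<Longrightarrow> tangential \<B> \<A> \<iota> \<omega> x u = w"
  by (rule F.form_eqI[of x]) (simp add: tangential_form)

lemma linear_tangential: "linear (tangential \<B> \<A> \<iota> \<omega> x)"
  by (rule linearI; rule tangential_eqI) (simp_all add: F.form_simps M.form_simps tangential_form)

lemma tangential_differential: "tangential \<B> \<A> \<iota> \<omega> x (d\<iota> x w) = w"
  by (rule tangential_eqI) (simp add: pullback_form_def)

lemma induced_form: "\<omega>\<^sub>N x (D\<^sub>N X Y x) v = \<omega> (\<iota> x) (cov_along X (pushed Y) x) (d\<iota> x v)"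
  by (simp add: induced_connection_def tangential_form)

lemma linear_connection_induced: "linear_connection \<B> UNIV D\<^sub>N"
  unfolding linear_connection_def smooth_fun_eq_vfun
proof (intro allI impI, elim conjE, intro conjI ballI impI)
  fix V X Y X' Y' and f :: "'n \<Rightarrow> real"
  assume V: "open V" and X: "smooth_field \<B> V X" and Y: "smooth_field \<B> V Y"
    and Y': "smooth_field \<B> V Y'" and f: "smooth_vfun \<B> V f"
  note dY = smooth_section_differential[OF V Y] and dY' = smooth_section_differential[OF V Y']
  show "smooth_field \<B> V (D\<^sub>N X Y)"
  proof (rule F.smooth_field_by_form[OF V])
    fix W Z assume W: "open W" "W \<subseteq> V" and Z: "smooth_field \<B> W Z"
    show "smooth_vfun \<B> W (\<lambda>x. \<omega>\<^sub>N x (D\<^sub>N X Y x) (Z x))"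
      unfolding induced_form
      by (rule smooth_form_sections[OF W(1) smooth_section_subset[OF smooth_section_cov_along[OF V X dY] W(2)]
            smooth_section_differential[OF W(1) Z]])
  qed
  fix x assume x: "x \<in> V"
  show "D\<^sub>N (\<lambda>y. X y + X' y) Y x = D\<^sub>N X Y x + D\<^sub>N X' Y x"
    by (simp add: induced_connection_def cov_along_add_left[OF V x dY] linear_add[OF linear_tangential])
  show "D\<^sub>N (\<lambda>y. f y *\<^sub>R X y) Y x = f x *\<^sub>R D\<^sub>N X Y x"
    by (simp add: induced_connection_def cov_along_scale_left[OF V x dY] linear_cmul[OF linear_tangential])
  show "D\<^sub>N X (\<lambda>y. Y y + Y' y) x = D\<^sub>N X Y x + D\<^sub>N X Y' x"
    by (simp add: induced_connection_def linear_add[OF linear_differential]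
        cov_along_add_right[OF V x dY dY'] linear_add[OF linear_tangential])
  \<comment> \<open>The derivative term is a multiple of \<open>d\<iota> x (Y x)\<close>, which is
    tangential already, so the projection returns the same multiple of \<open>Y x\<close>.\<close>
  show "D\<^sub>N X (\<lambda>y. f y *\<^sub>R Y y) x = dir_deriv \<B> f x (X x) *\<^sub>R Y x + f x *\<^sub>R D\<^sub>N X Y x"
    by (simp add: induced_connection_def linear_cmul[OF linear_differential] cov_along_leibniz[OF V x dY f]
        linear_add[OF linear_tangential] linear_cmul[OF linear_tangential] tangential_differential)
  assume eq: "\<forall>x\<in>V. X x = X' x \<and> Y x = Y' x"
  have "cov_along X (pushed Y) x = cov_along X' (pushed Y') x"
    by (rule cov_along_cong[OF V x]) (simp_all add: eq x)
  then show "D\<^sub>N X Y x = D\<^sub>N X' Y' x" by (simp add: induced_connection_def)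
qed

lemma preserves_two_form_induced: "preserves_two_form \<B> D\<^sub>N \<omega>\<^sub>N"
  unfolding preserves_two_form_def
proof (intro allI impI ballI, elim conjE)
  fix V X Y Z x
  assume V: "open V" and X: "smooth_field \<B> V X" and Y: "smooth_field \<B> V Y"
    and Z: "smooth_field \<B> V Z" and x: "x \<in> V"
  \<comment> \<open>\<open>induced_form\<close> evaluates the derivative in the first slot only;
    skewness on both N and M moves it there and back.\<close>
  have "\<omega>\<^sub>N x (Y x) (D\<^sub>N X Z x) = \<omega> (\<iota> x) (d\<iota> x (Y x)) (cov_along X (pushed Z) x)"
    by (subst F.form_skew, subst M.form_skew) (simp add: induced_form)
  then show "cov_deriv_form \<B> D\<^sub>N \<omega>\<^sub>N X Y Z x = 0"
    using cov_along_preserves_form[OF V x smooth_section_differential[OF V Y]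
        smooth_section_differential[OF V Z], of X]
    by (simp add: cov_deriv_form_def induced_form) (simp add: pullback_form_def)
qed

text \<open>The bracket is computed on N and its image is tangential, so projecting the identity
  \<open>torsion_along\<close> leaves it intact.\<close>

lemma torsion_induced:
  assumes "open V" "x \<in> V" "smooth_field \<B> V X" "smooth_field \<B> V Y"
  shows "torsion \<B> D\<^sub>N X Y x = tangential \<B> \<A> \<iota> \<omega> x
    (tensor_at \<A> (torsion \<A> D) (\<iota> x) (d\<iota> x (X x)) (d\<iota> x (Y x)))"
  unfolding torsion_along[OF assms, symmetric]
  by (simp add: torsion_def induced_connection_def linear_diff[OF linear_tangential] tangential_differential)

lemma almost_symplectic_connection_induced: "almost_symplectic_connection \<B> \<omega>\<^sub>N D\<^sub>N"
  by (simp add: almost_symplectic_connection_def two_form_pullback nondegenerate_pullback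
      linear_connection_induced preserves_two_form_induced)

lemma torsion_free_induced:
  assumes "torsion_free \<A> D"
  shows "torsion_free \<B> D\<^sub>N"
  unfolding torsion_free_def
proof (intro allI impI ballI, elim conjE)
  fix V X Y x
  assume V: "open V" "x \<in> V" and XY: "smooth_field \<B> V X" "smooth_field \<B> V Y"
  have K: "smooth_field \<A> (chart_dom (chart_at \<A> (\<iota> x))) (const_field \<A> (\<iota> x) u)" for u
    by (rule M.smooth_const_field) simp
  \<comment> \<open>\<open>torsion_free\<close> speaks of fields on open sets; the
    constant-coordinate fields inside \<open>tensor_at\<close> are smooth on the domain of the chart
    at \<open>\<iota> x\<close>.\<close>
  have "tensor_at \<A> (torsion \<A> D) (\<iota> x) u v = 0" for u v
    using assms K unfolding torsion_free_def tensor_at_def by (meson M.chart_at M.open_chart_dom)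
  then show "torsion \<B> D\<^sub>N X Y x = 0"
    by (simp add: torsion_induced[OF V XY] linear_0[OF linear_tangential])
qed

end

text \<open>Parallelism turns each derivative of \<omega> into two pairings, and vanishing torsion
  does the same to each bracket. Of the twelve terms, six cancel outright and six in pairs by
  skewness.\<close>

lemma (in manifold_form) closed_two_form_of_symplectic_connection:
  assumes "preserves_two_form \<A> D \<omega>" "torsion_free \<A> D"
  shows "closed_two_form \<A> \<omega>"
  unfolding closed_two_form_def
proof (intro allI impI ballI, elim conjE)
  fix V X Y Z x
  assume V: "open V" and XYZ: "smooth_field \<A> V X" "smooth_field \<A> V Y" "smooth_field \<A> V Z"
    and x: "x \<in> V"
  have d: "dir_deriv \<A> (\<lambda>y. \<omega> y (B y) (C y)) x (A x) = \<omega> x (D A B x) (C x) + \<omega> x (B x) (D A C x)"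
    if "smooth_field \<A> V A" "smooth_field \<A> V B" "smooth_field \<A> V C" for A B C
  proof -
    have "cov_deriv_form \<A> D \<omega> A B C x = 0"
      using assms(1) V x that unfolding preserves_two_form_def by blast
    then show ?thesis by (simp add: cov_deriv_form_def)
  qed
  have b: "lie_bracket \<A> A B x = D A B x - D B A x"
    if "smooth_field \<A> V A" "smooth_field \<A> V B" for A B
  proof -
    have "torsion \<A> D A B x = 0"
      using assms(2) V x that unfolding torsion_free_def by blast
    then show ?thesis by (simp add: torsion_def)
  qed
  have "\<omega> x (X x) (D Y Z x) = - \<omega> x (D Y Z x) (X x)" "\<omega> x (Y x) (D X Z x) = - \<omega> x (D X Z x) (Y x)"
    "\<omega> x (Z x) (D Y X x) = - \<omega> x (D Y X x) (Z x)" "\<omega> x (X x) (D Z Y x) = - \<omega> x (D Z Y x) (X x)"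
    by (rule form_skew)+
  then show "ext_deriv2 \<A> \<omega> X Y Z x = 0"
    using XYZ by (simp add: ext_deriv2_def d b form_simps)
qed

theorem corollary2p10:
  fixes \<A> :: "('m::{t2_space, second_countable_topology}, 'e::euclidean_space) atlas"
    and \<B> :: "('n::{t2_space, second_countable_topology}, 'f::euclidean_space) atlas"
    and Q :: "'m \<Rightarrow> ('e \<Rightarrow>\<^sub>L 'e) set"
    and \<omega> :: "'m \<Rightarrow> 'e \<Rightarrow> 'e \<Rightarrow> real"
    and \<iota> :: "'n \<Rightarrow> 'm"
    and D :: "('m \<Rightarrow> 'e) \<Rightarrow> ('m \<Rightarrow> 'e) \<Rightarrow> 'm \<Rightarrow> 'e"
    and n k :: nat
  assumes "n > 1" and "DIM('e) = 4 * n"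
    and "k \<le> 2 * n" and "DIM('f) = 2 * k"
    and "almost_qs_hermitian \<A> Q \<omega>"
    and "adapted_connection n \<A> Q \<omega> D"
    and "almost_symplectic_submanifold \<B> \<A> \<iota> \<omega>"
  shows "almost_symplectic_connection \<B> (pullback_form \<B> \<A> \<iota> \<omega>) (induced_connection \<B> \<A> \<iota> \<omega> D) \<and>
    (\<forall>V X Y. open V \<and> smooth_field \<B> V X \<and> smooth_field \<B> V Y \<longrightarrow>
       (\<forall>x\<in>V. torsion \<B> (induced_connection \<B> \<A> \<iota> \<omega> D) X Y x =
          tangential \<B> \<A> \<iota> \<omega> x
            (tensor_at \<A> (torsion \<A> D) (\<iota> x)
               (differential \<B> \<A> \<iota> x (X x)) (differential \<B> \<A> \<iota> x (Y x))))) \<and>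
    (torsion_free \<A> D \<longrightarrow>
       symplectic_submanifold \<B> \<A> \<iota> \<omega> \<and>
       symplectic_connection \<B> (pullback_form \<B> \<A> \<iota> \<omega>) (induced_connection \<B> \<A> \<iota> \<omega> D))"
proof -
  obtain D0 A where
    D0: "unimodular_oproiu_connection n \<A> Q (\<lambda>x. wedge_power (2 * n) (\<omega> x)) D0" and
    A: "\<forall>V X Y Z. open V \<and> smooth_field \<A> V X \<and> smooth_field \<A> V Y \<and> smooth_field \<A> V Z \<longrightarrow>
           (\<forall>x\<in>V. \<omega> x (A x (X x) (Y x)) (Z x) = cov_deriv_form \<A> D0 \<omega> X Y Z x / 2)" and
    D: "\<forall>V X Y. open V \<and> smooth_field \<A> V X \<and> smooth_field \<A> V Y \<longrightarrow>
           (\<forall>x\<in>V. D X Y x = D0 X Y x + A x (X x) (Y x))"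
    using assms(6) unfolding adapted_connection_def by (elim exE conjE) (rule that)
  have M: "manifold \<A>" "manifold_form_axioms \<A> \<omega>" "manifold_nondegenerate_form_axioms \<omega>"
    using assms(5) by (simp_all add: almost_qs_hermitian_def manifold_def manifold_form_axioms_def
        manifold_nondegenerate_form_axioms_def)
  have conn: "manifold_connection_axioms \<A> D0"
    using D0 by (simp add: unimodular_oproiu_connection_def manifold_connection_axioms_def)
  interpret M: adapted_form_connection \<A> \<omega> D0 A D
  proof (intro adapted_form_connection.intro manifold_nondegenerate_form.intro
      manifold_form_connection.intro manifold_form.intro manifold_connection.intro
      adapted_form_connection_axioms.intro M conn)
    fix V X Y x assume V: "open V" "smooth_field \<A> V X" "smooth_field \<A> V Y" "x \<in> V"
    then show "D X Y x = D0 X Y x + A x (X x) (Y x)"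
      using D[THEN spec, of V, THEN spec, of X, THEN spec, of Y] by simp
    fix Z assume "smooth_field \<A> V Z"
    then show "\<omega> x (A x (X x) (Y x)) (Z x) = cov_deriv_form \<A> D0 \<omega> X Y Z x / 2"
      using A[THEN spec, of V, THEN spec, of X, THEN spec, of Y, THEN spec, of Z] V by simp
  qed
  have N: "manifold \<B>" "manifold_map_axioms \<A> \<B> \<iota>"
    "nondegenerate (pullback_form \<B> \<A> \<iota> \<omega>)"
    using assms(7) by (simp_all add: almost_symplectic_submanifold_def immersion_def manifold_def
        manifold_map_axioms_def)
  \<comment> \<open>The connection induced on N is that of \<open>D\<close>, not of
    \<open>D0\<close>: its connection laws and \<open>D\<omega> = 0\<close> are the two results
    established for the sum.\<close>
  interpret almost_symplectic_map \<A> \<B> \<iota> \<omega> D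
    by (intro almost_symplectic_map.intro manifold_map_form_connection.intro manifold_map_form.intro
        manifold_map_connection.intro manifold_map.intro manifold_form.intro manifold_connection.intro
        almost_symplectic_map_axioms.intro manifold_map_form_connection_axioms.intro
        manifold_connection_axioms.intro M N M.linear_connection_adapted M.preserves_two_form_adapted)
  \<comment> \<open>Closedness is derived on N from the induced connection, so no exterior
    derivative has to be pulled back along \<iota>.\<close>
  have "closed_two_form \<B> \<omega>\<^sub>N" "torsion_free \<B> D\<^sub>N" if "torsion_free \<A> D"
    using F.closed_two_form_of_symplectic_connection[OF preserves_two_form_induced]
      torsion_free_induced[OF that] by auto
  moreover have "torsion \<B> D\<^sub>N X Y x = tangential \<B> \<A> \<iota> \<omega> x
      (tensor_at \<A> (torsion \<A> D) (\<iota> x) (d\<iota> x (X x)) (d\<iota> x (Y x)))"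
    if "open V \<and> smooth_field \<B> V X \<and> smooth_field \<B> V Y" "x \<in> V" for V X Y x
    using torsion_induced[of V x X Y] that by simp
  ultimately show ?thesis
    using almost_symplectic_connection_induced assms(7)
    unfolding symplectic_submanifold_def symplectic_connection_def by (intro conjI allI impI ballI)
qed

end
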